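(* Let $\pi=\{p_1,\dots,p_n\}$ be a set of primes, $\pi'=\mathbb{P}\setminus\pi$, and $\sigma^{\pi}=\{\pi,\pi'\}$. A finite group $G$ is a $\pi$-separable $P\sigma^{\pi}T$-group if and only if there are subgroups $D$ and $M$ of $G$ such that the following conditions hold: (i) $G=D\rtimes M$ (with $D$ normal in $G$), where $D$ is an abelian Hall subgroup of $G$ of odd order, $M$ is $\pi$-decomposable, and every element of $G$ induces (by conjugation) a power automorphism in $D$; (ii) $O_{\pi}(D)$ has a normal complement in a Hall $\pi$-subgroup of $G$; (iii) $O_{\pi'}(D)$ has a normal complement in a Hall $\pi'$-subgroup of $G$.
   Context: All groups are finite; $\mathbb{P}$ is the set of all primes. $G$ is $\pi$-separable if every chief factor of $G$ is a $\pi$-group or a $\pi'$-group. $M$ is $\pi$-decomposable if $M=O_{\pi}(M)\times O_{\pi'}(M)$. For a set of primes $\tau$, $O_\tau(X)$ is the largest normal $\tau$-subgroup of $X$. A power automorphism of $D$ is an automorphism mapping every subgroup of $D$ onto itself. For a partition $\sigma=\{\sigma_i\mid i\in I\}$ of $\mathbb{P}$ let $\sigma(G)$ be the set of those $\sigma_i$ containing a prime divisor of $|G|$. A complete Hall $\sigma$-set of $G$ is a set $\mathcal{H}$ of subgroups of $G$ such that every member $\neq 1$ of $\mathcal{H}$ is a Hall $\sigma_i$-subgroup of $G$ for some $\sigma_i\in\sigma$ and $\mathcal{H}$ contains exactly one Hall $\sigma_i$-subgroup of $G$ for every $\sigma_i\in\sigma(G)$. A subgroup $A$ of $G$ is $\sigma$-permutable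 in $G$ if $G$ possesses a complete Hall $\sigma$-set and $AH=HA$ for every Hall $\sigma_i$-subgroup $H$ of $G$ and all $i\in I$. $G$ is a $P\sigma T$-group if whenever $K$ is a $\sigma$-permutable subgroup of $H$ and $H$ is a $\sigma$-permutable subgroup of $G$, then $K$ is a $\sigma$-permutable subgroup of $G$. A $P\sigma^{\pi}T$-group is a $P\sigma T$-group for the partition $\sigma=\sigma^{\pi}=\{\pi,\pi'\}$. *)

theory Defs
  imports
    "HOL-Algebra.SndIsomorphismGrp"
    "HOL-Computational_Algebra.Primes"
    "HOL-Library.Disjoint_Sets"
begin

text \<open>
  All notions are intended for finite groups. A subgroup \<open>H\<close> of \<open>G\<close>, regarded as a group, is
  \<open>G\<lparr>carrier := H\<rparr>\<close>; sets of primes are sets of natural numbers.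
\<close>

definition all_primes :: "nat set" where
  "all_primes = {p. prime p}"

definition primes_compl :: "nat set \<Rightarrow> nat set" where
  "primes_compl \<tau> = all_primes - \<tau>"

definition tau_group :: "nat set \<Rightarrow> ('a, 'b) monoid_scheme \<Rightarrow> bool" where
  "tau_group \<tau> X \<longleftrightarrow> (\<forall>p. prime p \<and> p dvd order X \<longrightarrow> p \<in> \<tau>)"

definition hall_subgroup :: "('a, 'b) monoid_scheme \<Rightarrow> 'a set \<Rightarrow> bool" where
  "hall_subgroup G H \<longleftrightarrow> subgroup H G \<and> coprime (card H) (card (rcosets\<^bsub>G\<^esub> H))"

definition hall_tau_subgroup :: "nat set \<Rightarrow> ('a, 'b) monoid_scheme \<Rightarrow> 'a set \<Rightarrow> bool" where
  "hall_tau_subgroup \<tau> G H \<longleftrightarrow>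
     subgroup H G \<and> tau_group \<tau> (G\<lparr>carrier := H\<rparr>) \<and>
     (\<forall>p\<in>\<tau>. prime p \<longrightarrow> \<not> p dvd card (rcosets\<^bsub>G\<^esub> H))"

text \<open>\<open>Greatest\<close> is taken with respect to inclusion; see \<open>tau_core_is_greatest\<close>.\<close>

definition tau_core :: "nat set \<Rightarrow> ('a, 'b) monoid_scheme \<Rightarrow> 'a set" where
  "tau_core \<tau> X = (GREATEST N. N \<lhd> X \<and> tau_group \<tau> (X\<lparr>carrier := N\<rparr>))"

definition chief_factor :: "('a, 'b) monoid_scheme \<Rightarrow> 'a set \<Rightarrow> 'a set \<Rightarrow> bool" where
  "chief_factor G H K \<longleftrightarrow>
     H \<lhd> G \<and> K \<lhd> G \<and> K \<subset> H \<and>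
     (\<forall>L. L \<lhd> G \<and> K \<subseteq> L \<and> L \<subseteq> H \<longrightarrow> L = K \<or> L = H)"

definition pi_separable :: "nat set \<Rightarrow> ('a, 'b) monoid_scheme \<Rightarrow> bool" where
  "pi_separable \<pi> G \<longleftrightarrow>
     (\<forall>H K. chief_factor G H K \<longrightarrow>
        tau_group \<pi> (G\<lparr>carrier := H\<rparr> Mod K) \<or>
        tau_group (primes_compl \<pi>) (G\<lparr>carrier := H\<rparr> Mod K))"

definition is_internal_direct_product ::
    "('a, 'b) monoid_scheme \<Rightarrow> 'a set \<Rightarrow> 'a set \<Rightarrow> bool" where
  "is_internal_direct_product X A B \<longleftrightarrow>
     A \<lhd> X \<and> B \<lhd> X \<and> A \<inter> B = {\<one>\<^bsub>X\<^esub>} \<and> A <#>\<^bsub>X\<^esub> B = carrier X"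

definition is_internal_semidirect_product ::
    "('a, 'b) monoid_scheme \<Rightarrow> 'a set \<Rightarrow> 'a set \<Rightarrow> bool" where
  "is_internal_semidirect_product X A B \<longleftrightarrow>
     A \<lhd> X \<and> subgroup B X \<and> A \<inter> B = {\<one>\<^bsub>X\<^esub>} \<and> A <#>\<^bsub>X\<^esub> B = carrier X"

definition pi_decomposable :: "nat set \<Rightarrow> ('a, 'b) monoid_scheme \<Rightarrow> bool" where
  "pi_decomposable \<pi> X \<longleftrightarrow>
     is_internal_direct_product X (tau_core \<pi> X) (tau_core (primes_compl \<pi>) X)"

definition has_normal_complement :: "('a, 'b) monoid_scheme \<Rightarrow> 'a set \<Rightarrow> bool" where
  "has_normal_complement X A \<longleftrightarrow>
     subgroup A X \<and>
     (\<exists>N. N \<lhd> X \<and> A \<inter> N = {\<one>\<^bsub>X\<^esub>} \<and> A <#>\<^bsub>X\<^esub> N = carrier X)"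

definition power_automorphism :: "('a, 'b) monoid_scheme \<Rightarrow> ('a \<Rightarrow> 'a) \<Rightarrow> bool" where
  "power_automorphism X f \<longleftrightarrow> f \<in> iso X X \<and> (\<forall>S. subgroup S X \<longrightarrow> f ` S = S)"

text \<open>
  In the following, \<open>\<sigma>\<close> is a partition of the set of all primes, given as its set of blocks.
\<close>

definition sigma_of_group :: "nat set set \<Rightarrow> ('a, 'b) monoid_scheme \<Rightarrow> nat set set" where
  "sigma_of_group \<sigma> G = {s \<in> \<sigma>. \<exists>p\<in>s. prime p \<and> p dvd order G}"

definition complete_hall_set ::
    "nat set set \<Rightarrow> ('a, 'b) monoid_scheme \<Rightarrow> 'a set set \<Rightarrow> bool" where
  "complete_hall_set \<sigma> G \<H> \<longleftrightarrow>
     (\<forall>H\<in>\<H>. subgroup H G) \<and>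
     (\<forall>H\<in>\<H>. H \<noteq> {\<one>\<^bsub>G\<^esub>} \<longrightarrow> (\<exists>s\<in>\<sigma>. hall_tau_subgroup s G H)) \<and>
     (\<forall>s\<in>sigma_of_group \<sigma> G. \<exists>!H. H \<in> \<H> \<and> hall_tau_subgroup s G H)"

definition sigma_permutable ::
    "nat set set \<Rightarrow> ('a, 'b) monoid_scheme \<Rightarrow> 'a set \<Rightarrow> bool" where
  "sigma_permutable \<sigma> G A \<longleftrightarrow>
     subgroup A G \<and> (\<exists>\<H>. complete_hall_set \<sigma> G \<H>) \<and>
     (\<forall>s\<in>\<sigma>. \<forall>H. hall_tau_subgroup s G H \<longrightarrow> A <#>\<^bsub>G\<^esub> H = H <#>\<^bsub>G\<^esub> A)"

definition P_sigma_T_group :: "nat set set \<Rightarrow> ('a, 'b) monoid_scheme \<Rightarrow> bool" where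
  "P_sigma_T_group \<sigma> G \<longleftrightarrow>
     (\<forall>H K. sigma_permutable \<sigma> G H \<and> sigma_permutable \<sigma> (G\<lparr>carrier := H\<rparr>) K \<longrightarrow>
        sigma_permutable \<sigma> G K)"

definition sigma_pi :: "nat set \<Rightarrow> nat set set" where
  "sigma_pi \<pi> = {\<pi>, primes_compl \<pi>}"

definition P_sigma_pi_T_group :: "nat set \<Rightarrow> ('a, 'b) monoid_scheme \<Rightarrow> bool" where
  "P_sigma_pi_T_group \<pi> G \<longleftrightarrow> P_sigma_T_group (sigma_pi \<pi>) G"

lemma partition_on_sigma_pi:
  assumes "finite \<pi>" "\<pi> \<noteq> {}" "\<pi> \<subseteq> all_primes"
  shows "partition_on all_primes (sigma_pi \<pi>)"
proof -
  have "primes_compl \<pi> \<noteq> {}"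
    using assms(1) primes_infinite unfolding primes_compl_def all_primes_def
    by (metis finite.emptyI finite_Diff2)
  then show ?thesis
    using assms(2,3) by (auto simp: partition_on_def sigma_pi_def primes_compl_def disjoint_def)
qed

context group
begin

lemma card_normal_set_mult_dvd:
  assumes "finite (carrier G)" and N: "N \<lhd> G" and K: "subgroup K G"
  shows "card (N <#> K) dvd card N * card K"
proof -
  interpret second_isomorphism_grp N G K
    using N K by (simp add: second_isomorphism_grp_def second_isomorphism_grp_axioms_def)
  have sub: "subgroup (N <#> K) G" by (rule normal_set_mult_subgroup)
  have NK: "N \<lhd> G\<lparr>carrier := N <#> K\<rparr>"
    using H_contained_in_set_mult N normal_restrict_supergroup sub by blast
  have NiK: "N \<inter> K \<lhd> G\<lparr>carrier := K\<rparr>"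
    using normal_subgrp_intersection_normal by (simp add: Int_commute)
  have grpNK: "group (G\<lparr>carrier := N <#> K\<rparr>)" and grpK: "group (G\<lparr>carrier := K\<rparr>)"
    using sub K subgroup_imp_group by auto
  have "G\<lparr>carrier := K\<rparr> Mod (N \<inter> K) \<cong> G\<lparr>carrier := N <#> K\<rparr> Mod N"
    using normal_intersection_quotient_isom by (auto simp: is_iso_def)
  then have eq: "order (G\<lparr>carrier := K\<rparr> Mod (N \<inter> K)) = order (G\<lparr>carrier := N <#> K\<rparr> Mod N)"
    by (auto simp: is_iso_def dest: iso_same_order)
  have "order (G\<lparr>carrier := N <#> K\<rparr> Mod N) * card N = card (N <#> K)"
    using group.lagrange[OF grpNK normal_imp_subgroup[OF NK]]
    by (simp add: order_def FactGroup_def)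
  moreover have "order (G\<lparr>carrier := K\<rparr> Mod (N \<inter> K)) * card (N \<inter> K) = card K"
    using group.lagrange[OF grpK normal_imp_subgroup[OF NiK]]
    by (simp add: order_def FactGroup_def)
  ultimately show ?thesis
    using eq by (metis dvd_triv_left mult.commute mult_dvd_mono dvd_refl)
qed

lemma tau_core_is_greatest:
  assumes fin: "finite (carrier G)"
  shows "tau_core \<tau> G \<lhd> G" and "tau_group \<tau> (G\<lparr>carrier := tau_core \<tau> G\<rparr>)"
    and "N \<lhd> G \<Longrightarrow> tau_group \<tau> (G\<lparr>carrier := N\<rparr>) \<Longrightarrow> N \<subseteq> tau_core \<tau> G"
proof -
  let ?P = "\<lambda>N. N \<lhd> G \<and> tau_group \<tau> (G\<lparr>carrier := N\<rparr>)"
  have sub: "N \<subseteq> carrier G" if "N \<lhd> G" for N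
    using that normal_imp_subgroup subgroup.subset by blast
  have "{N. ?P N} \<subseteq> Pow (carrier G)" using sub by blast
  then have finP: "finite {N. ?P N}" using fin by (meson finite_Pow_iff finite_subset)
  have "?P {\<one>}" using one_is_normal by (auto simp: tau_group_def order_def)
  then obtain A where A: "?P A" and A_max: "\<And>B. ?P B \<Longrightarrow> A \<subseteq> B \<Longrightarrow> A = B"
    using finite_has_maximal[OF finP] by auto
  have greatest: "N \<subseteq> A" if N: "?P N" for N
  proof -
    have subs: "subgroup A G" "subgroup N G" using A N normal_imp_subgroup by auto
    have norm: "A <#> N \<lhd> G" using A N normal_subgroup_set_mult_closed by blast
    have "tau_group \<tau> (G\<lparr>carrier := A <#> N\<rparr>)"
      unfolding tau_group_def
    proof (intro allI impI)
      fix p :: nat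
      assume p: "prime p \<and> p dvd order (G\<lparr>carrier := A <#> N\<rparr>)"
      then have "p dvd card A * card N"
        using card_normal_set_mult_dvd[OF fin _ subs(2)] A
        by (auto simp: order_def intro: dvd_trans)
      then show "p \<in> \<tau>"
        using p A N by (auto simp: tau_group_def order_def prime_dvd_mult_iff)
    qed
    moreover have "A \<subseteq> A <#> N" "N \<subseteq> A <#> N"
      using A N subs second_isomorphism_grp.H_contained_in_set_mult[of A G N]
        second_isomorphism_grp.S_contained_in_set_mult[of A G N]
      by (simp_all add: second_isomorphism_grp_def second_isomorphism_grp_axioms_def)
    ultimately show ?thesis using A_max norm by blast
  qed
  have "tau_core \<tau> G = A"
    unfolding tau_core_def using A greatest by (intro Greatest_equality) auto
  then show "tau_core \<tau> G \<lhd> G" and "tau_group \<tau> (G\<lparr>carrier := tau_core \<tau> G\<rparr>)"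
    and "N \<lhd> G \<Longrightarrow> tau_group \<tau> (G\<lparr>carrier := N\<rparr>) \<Longrightarrow> N \<subseteq> tau_core \<tau> G"
    using A greatest by auto
qed

end

end

theory Submission
  imports Defs "HOL-Algebra.Sylow" "HOL-Algebra.Group_Action" "HOL-Algebra.Multiplicative_Group"
begin

text \<open>Write \<open>\<tau>\<close> for \<open>\<pi>\<close> or \<open>\<pi>'\<close>, so that every statement about \<open>\<tau>\<close> comes with its mirror image for
\<open>\<tau>'\<close>. Let \<open>R = O\<^sup>\<tau>(G)\<close> be the subgroup generated by the \<open>\<tau>'\<close>-elements and \<open>S\<close> the one generated by
the \<open>\<tau>\<close>-elements. Then \<open>D = R \<inter> S\<close> is the smallest normal subgroup with \<open>\<pi>\<close>-decomposable quotient,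
and this \<open>D\<close> will satisfy (i)-(iii).

\<^bold>\<open>From permutability to the structure.\<close> Let \<open>V/N\<close> be a normal \<open>\<tau>\<close>-section of \<open>G\<close>. Each subgroup
\<open>K\<close> between \<open>N\<close> and \<open>V\<close> permutes with all Hall subgroups of \<open>V\<close>, hence, by transitivity, with all
Hall subgroups of \<open>G\<close>; comparing indices, the Hall \<open>\<tau>'\<close>-subgroups normalize \<open>K\<close>. So \<open>R\<close> acts on
\<open>V/N\<close> by power automorphisms, and its \<open>\<tau>'\<close>-elements act coprimely (\<open>Hall_normalizes_section\<close>,
\<open>residual_powers_act\<close>). A coprime power automorphism that moves one \<open>p\<close>-element moves every
nontrivial \<open>p\<close>-element, and forces these elements to be central (\<open>moved_central\<close>, \<open>moved_all\<close>). If
a normal \<open>\<tau>\<close>-section at the bottom of \<open>R\<close>, with a \<open>\<tau>'\<close>-group above it, is centralized by \<open>R\<close>, then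
it is a direct factor by the Schur-Zassenhaus theorem, so it is trivial because \<open>R\<close> is generated
by \<open>\<tau>'\<close>-elements (\<open>central_tau_section_trivial\<close>). Applied to \<open>S/X\<close> with \<open>X = O\<^sup>\<tau>(D)\<close> this shows
that \<open>D/X\<close> is a central Hall subgroup of \<open>S/X\<close>, of odd order, in which \<open>R\<close> has no nontrivial fixed
point.

It remains to see that \<open>O\<^sup>\<tau>(D)\<close> and \<open>O\<^sup>\<tau>\<^sup>'(D)\<close> meet trivially (\<open>no_tau_chief_factor\<close>). Otherwise
there is a chief factor \<open>N/W\<close> of \<open>G\<close> with \<open>N\<close> the intersection, say a \<open>\<tau>\<close>-group. On \<open>N/W\<close> each
element \<open>y\<close> of \<open>X\<close> acts by a single exponent, so \<open>y\<close> and all its conjugates act in the same way;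
but if \<open>y\<close> has prime power order and lies outside \<open>N\<close>, then modulo \<open>N\<close> some conjugate of \<open>y\<close> is a
power \<open>y\<^sup>t\<close> with \<open>t - 1\<close> prime to the order of \<open>y\<close>. Hence \<open>X\<close> centralizes \<open>N/W\<close>, and \<open>N/W\<close> would
split off again. Therefore \<open>D\<close> is the direct product of its two parts, and everything else in
(i)-(iii) is read off from the two quotients.

\<^bold>\<open>From the structure to permutability.\<close> For a subgroup \<open>D\<close> as in (i)-(iii), a subgroup \<open>K\<close> is
\<open>\<sigma>\<close>-permutable in \<open>G\<close> exactly when \<open>D\<close> normalizes \<open>K\<close>, and a \<open>\<sigma>\<close>-permutable subgroup of a subgroup
normalized by \<open>D\<close> is again normalized by \<open>D\<close> (\<open>permutable_normalized_part\<close>, \<open>Hall_product_swap\<close>).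
Transitivity is then immediate. What makes both proofs work is that (ii) and (iii) let
\<open>\<tau>\<close>-elements of \<open>G\<close> centralize the \<open>\<tau>\<close>-part of \<open>D\<close>.\<close>

section \<open>Numbers with prime divisors in a given set\<close>

definition tau_number :: "nat set \<Rightarrow> nat \<Rightarrow> bool" where
  "tau_number \<tau> n \<longleftrightarrow> (\<forall>p. prime p \<and> p dvd n \<longrightarrow> p \<in> \<tau>)"

lemma tau_number_compl:
  "tau_number (primes_compl \<tau>) n \<longleftrightarrow> (\<forall>p. prime p \<and> p dvd n \<longrightarrow> p \<notin> \<tau>)"
  by (auto simp: tau_number_def primes_compl_def all_primes_def)

lemma tau_number_compl_compl [simp]:
  "tau_number (primes_compl (primes_compl \<tau>)) n = tau_number \<tau> n"
  by (auto simp: tau_number_def primes_compl_def all_primes_def)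

lemma tau_number_1 [simp]: "tau_number \<tau> (Suc 0)"
  by (auto simp: tau_number_def)

lemma tau_number_mult [simp]: "tau_number \<tau> (m * n) \<longleftrightarrow> tau_number \<tau> m \<and> tau_number \<tau> n"
  by (auto simp: tau_number_def prime_dvd_mult_iff)

lemma tau_number_dvd: "tau_number \<tau> n \<Longrightarrow> m dvd n \<Longrightarrow> tau_number \<tau> m"
  by (auto simp: tau_number_def intro: dvd_trans)

lemma tau_number_power: "tau_number \<tau> m \<Longrightarrow> tau_number \<tau> (m ^ n)"
  by (induction n) auto

lemma tau_number_prime_power: "prime p \<Longrightarrow> p \<in> \<tau> \<Longrightarrow> tau_number \<tau> (p ^ n)"
  using primes_dvd_imp_eq[of _ p] by (intro tau_number_power) (auto simp: tau_number_def)

lemma tau_number_coprime: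
  assumes "tau_number \<tau> m" "tau_number (primes_compl \<tau>) n"
  shows "coprime m n"
proof (rule ccontr)
  assume "\<not> coprime m n"
  then obtain p where "prime p" "p dvd gcd m n"
    by (metis coprime_iff_gcd_eq_1 prime_factor_nat)
  then show False using assms unfolding tau_number_compl by (auto simp: tau_number_def)
qed

lemma tau_number_both: "tau_number \<tau> n \<Longrightarrow> tau_number (primes_compl \<tau>) n \<Longrightarrow> n = 1"
  using tau_number_coprime[of \<tau> n n] by simp

lemma tau_number_split:
  assumes "0 < n"
  obtains a b where "n = a * b" "tau_number \<tau> a" "tau_number (primes_compl \<tau>) b"
proof -
  from assms have "\<exists>a b. n = a * b \<and> tau_number \<tau> a \<and> tau_number (primes_compl \<tau>) b"
  proof (induction n rule: less_induct)
    case (less n)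
    show ?case
    proof (cases "n = 1")
      case True
      then show ?thesis by (intro exI[of _ 1]) auto
    next
      case False
      then obtain p where p: "prime p" "p dvd n" using prime_factor_nat by blast
      then obtain m where m: "n = p * m" by blast
      have "m < n" "0 < m" using m less.prems prime_gt_1_nat[OF p(1)] by auto
      then obtain a b where ab: "m = a * b" "tau_number \<tau> a" "tau_number (primes_compl \<tau>) b"
        using less.IH by blast
      show ?thesis
      proof (cases "p \<in> \<tau>")
        case True
        then have "tau_number \<tau> (p * a)"
          using ab p tau_number_prime_power[of p \<tau> 1] by simp
        then show ?thesis using ab m by (metis mult.assoc)
      next
        case False
        then have "tau_number (primes_compl \<tau>) (p * b)"
          using ab p tau_number_prime_power[of p "primes_compl \<tau>" 1]
          by (simp add: primes_compl_def all_primes_def)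
        then show ?thesis using ab m by (metis mult.left_commute)
      qed
    qed
  qed
  then show thesis using that by blast
qed

section \<open>Conjugation, products and indices of subgroups\<close>

text \<open>The index \<open>|L : K|\<close> when \<open>K\<close> is a subgroup of \<open>L\<close>. As a function of the two sets it does not
depend on the ambient group, so it can be used unchanged for subgroups of subgroups.\<close>

definition index :: "'a set \<Rightarrow> 'a set \<Rightarrow> nat" where
  "index L K = card L div card K"

context group
begin

definition conj_by :: "'a \<Rightarrow> 'a \<Rightarrow> 'a" where
  "conj_by g x = g \<otimes> x \<otimes> inv g"

lemma inv_cancel [simp]:
  assumes "x \<in> carrier G" "y \<in> carrier G"
  shows "inv x \<otimes> (x \<otimes> y) = y" "x \<otimes> (inv x \<otimes> y) = y"
  using assms by (simp_all add: m_assoc[symmetric])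

lemmas group_word_simps = conj_by_def m_assoc inv_mult_group

lemma conj_by_closed [simp]: "g \<in> carrier G \<Longrightarrow> x \<in> carrier G \<Longrightarrow> conj_by g x \<in> carrier G"
  by (simp add: conj_by_def)

lemma conj_by_mult:
  "g \<in> carrier G \<Longrightarrow> x \<in> carrier G \<Longrightarrow> y \<in> carrier G \<Longrightarrow> conj_by g (x \<otimes> y) = conj_by g x \<otimes> conj_by g y"
  by (simp add: group_word_simps)

lemma conj_by_conj_by:
  "g \<in> carrier G \<Longrightarrow> h \<in> carrier G \<Longrightarrow> x \<in> carrier G \<Longrightarrow> conj_by g (conj_by h x) = conj_by (g \<otimes> h) x"
  by (simp add: group_word_simps)

lemma conj_by_one [simp]: "g \<in> carrier G \<Longrightarrow> conj_by g \<one> = \<one>" "x \<in> carrier G \<Longrightarrow> conj_by \<one> x = x"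
  by (simp_all add: conj_by_def)

lemma conj_by_inv: "g \<in> carrier G \<Longrightarrow> x \<in> carrier G \<Longrightarrow> conj_by g (inv x) = inv (conj_by g x)"
  by (simp add: group_word_simps)

lemma conj_by_hom: "g \<in> carrier G \<Longrightarrow> conj_by g \<in> hom G G"
  by (auto simp: hom_def conj_by_mult)

lemma conj_by_group_hom: "g \<in> carrier G \<Longrightarrow> group_hom G G (conj_by g)"
  by (simp add: conj_by_hom group_hom.intro group_hom_axioms.intro)

lemma conj_by_pow: "g \<in> carrier G \<Longrightarrow> x \<in> carrier G \<Longrightarrow> conj_by g (x [^] (n::nat)) = conj_by g x [^] n"
  by (induction n) (auto simp: conj_by_mult)

lemma conj_by_int_pow: "g \<in> carrier G \<Longrightarrow> x \<in> carrier G \<Longrightarrow> conj_by g (x [^] (n::int)) = conj_by g x [^] n"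
  by (simp add: conj_by_group_hom group_hom.hom_int_pow)

lemma conj_by_eq_iff_commute:
  "g \<in> carrier G \<Longrightarrow> x \<in> carrier G \<Longrightarrow> conj_by g x = x \<longleftrightarrow> g \<otimes> x = x \<otimes> g"
  by (metis conj_by_def inv_solve_right m_closed)

lemma conj_by_inv_cancel [simp]:
  "g \<in> carrier G \<Longrightarrow> x \<in> carrier G \<Longrightarrow> conj_by (inv g) (conj_by g x) = x"
  "g \<in> carrier G \<Longrightarrow> x \<in> carrier G \<Longrightarrow> conj_by g (conj_by (inv g) x) = x"
  by (simp_all add: conj_by_conj_by)

lemma inj_on_conj_by: "g \<in> carrier G \<Longrightarrow> inj_on (conj_by g) (carrier G)"
  by (rule inj_on_inverseI[where g = "conj_by (inv g)"]) simp

lemma conj_by_subgroup: "g \<in> carrier G \<Longrightarrow> subgroup H G \<Longrightarrow> subgroup (conj_by g ` H) G"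
  using group_hom.subgroup_img_is_subgroup[OF conj_by_group_hom] by blast

lemma normal_conj_by: "N \<lhd> G \<Longrightarrow> g \<in> carrier G \<Longrightarrow> x \<in> N \<Longrightarrow> conj_by g x \<in> N"
  unfolding conj_by_def by (simp add: normal.inv_op_closed2)

lemma normal_cjI:
  assumes "subgroup N G" "\<And>g x. g \<in> carrier G \<Longrightarrow> x \<in> N \<Longrightarrow> conj_by g x \<in> N"
  shows "N \<lhd> G"
  using assms by (auto simp: normal_inv_iff conj_by_def)

lemma sub_mult: "subgroup H G \<Longrightarrow> x \<in> H \<Longrightarrow> y \<in> H \<Longrightarrow> x \<otimes> y \<in> H"
  by (rule subgroup.m_closed)

lemma sub_inv: "subgroup H G \<Longrightarrow> x \<in> H \<Longrightarrow> inv x \<in> H"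
  by (rule subgroup.m_inv_closed)

lemma sub_one: "subgroup H G \<Longrightarrow> \<one> \<in> H"
  by (rule subgroup.one_closed)

lemma sub_carrier: "subgroup H G \<Longrightarrow> x \<in> H \<Longrightarrow> x \<in> carrier G"
  by (rule subgroup.mem_carrier)

lemma sub_int_pow: "subgroup H G \<Longrightarrow> x \<in> H \<Longrightarrow> x [^] (n::int) \<in> H"
  by (rule subgroup_int_pow_closed)

lemma sub_pow: "subgroup H G \<Longrightarrow> x \<in> H \<Longrightarrow> x [^] (n::nat) \<in> H"
  using sub_int_pow[of H x "int n"] by (simp add: int_pow_int)

lemma sub_cancel_l:
  assumes "subgroup H G" "x \<in> H" "y \<in> carrier G"
  shows "x \<otimes> y \<in> H \<longleftrightarrow> y \<in> H"
  using assms by (metis inv_cancel(1) sub_carrier sub_inv sub_mult)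

lemma sub_cancel_r:
  assumes "subgroup H G" "x \<in> H" "y \<in> carrier G"
  shows "y \<otimes> x \<in> H \<longleftrightarrow> y \<in> H"
  using assms by (metis inv_solve_right m_closed sub_carrier sub_inv sub_mult)

lemma coprime_pow_mem:
  assumes H: "subgroup H G" and x: "x \<in> carrier G"
    and "x [^] (m::nat) \<in> H" "x [^] (n::nat) \<in> H" "coprime m n"
  shows "x \<in> H"
proof -
  obtain u v where uv: "u * int m + v * int n = 1"
    using assms(5) by (metis bezout_int coprime_imp_gcd_eq_1 of_nat_1 gcd_int_int_eq)
  have "x = x [^] (int m * u + int n * v)" using uv x by (simp add: mult.commute)
  also have "\<dots> = (x [^] m) [^] u \<otimes> (x [^] n) [^] v"
    using x by (simp add: int_pow_mult int_pow_pow[symmetric] int_pow_int)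
  also have "\<dots> \<in> H" using assms by (simp add: sub_int_pow sub_mult)
  finally show ?thesis .
qed

lemma set_mult_memI: "a \<in> A \<Longrightarrow> b \<in> B \<Longrightarrow> a \<otimes> b \<in> A <#> B"
  by (auto simp: set_mult_def)

lemma set_mult_memE:
  assumes "x \<in> A <#> B" obtains a b where "a \<in> A" "b \<in> B" "x = a \<otimes> b"
  using assms by (auto simp: set_mult_def)

lemma subgroup_set_mult_normal:
  assumes "N \<lhd> G" "subgroup K G"
  shows "subgroup (N <#> K) G" "N <#> K = K <#> N"
  using assms commut_normal[of K N]
  by (simp_all add: second_isomorphism_grp.normal_set_mult_subgroup
      second_isomorphism_grp_def second_isomorphism_grp_axioms_def)

lemma subgroup_set_mult_comm:
  assumes "subgroup A G" "subgroup B G" "A <#> B = B <#> A"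
  shows "subgroup (A <#> B) G"
proof (rule subgroupI)
  show "A <#> B \<subseteq> carrier G" by (simp add: assms setmult_subset_G subgroup.subset)
  show "A <#> B \<noteq> {}" using set_mult_memI[of \<one> A \<one> B] assms sub_one by blast
  fix x assume "x \<in> A <#> B"
  then obtain a b where ab: "a \<in> A" "b \<in> B" "x = a \<otimes> b" by (rule set_mult_memE)
  have "inv x = inv b \<otimes> inv a"
    using ab assms by (simp add: inv_mult_group sub_carrier)
  then show "inv x \<in> A <#> B"
    using ab assms set_mult_memI[of "inv b" B "inv a" A] by (simp add: sub_inv)
  fix y assume "y \<in> A <#> B"
  then obtain a' b' where ab': "a' \<in> A" "b' \<in> B" "y = a' \<otimes> b'" by (rule set_mult_memE)
  have "b \<otimes> a' \<in> A <#> B" using ab ab' assms(3) set_mult_memI[of b B a' A] by simp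
  then obtain c d where cd: "c \<in> A" "d \<in> B" "b \<otimes> a' = c \<otimes> d" by (rule set_mult_memE)
  have c: "a \<in> carrier G" "b \<in> carrier G" "a' \<in> carrier G" "b' \<in> carrier G"
       "c \<in> carrier G" "d \<in> carrier G" using ab ab' cd assms sub_carrier by blast+
  have "x \<otimes> y = a \<otimes> (b \<otimes> a') \<otimes> b'" using c by (simp add: ab ab' m_assoc)
  also have "\<dots> = (a \<otimes> c) \<otimes> (d \<otimes> b')" using c by (simp add: cd m_assoc)
  also have "\<dots> \<in> A <#> B" using ab ab' cd assms by (intro set_mult_memI sub_mult) auto
  finally show "x \<otimes> y \<in> A <#> B" .
qed

lemma set_mult_supset:
  assumes "subgroup A G" "subgroup B G"
  shows "A \<subseteq> A <#> B" "B \<subseteq> A <#> B"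
proof -
  show "A \<subseteq> A <#> B"
    using assms by (metis r_one set_mult_memI sub_carrier sub_one subsetI)
  show "B \<subseteq> A <#> B"
    using assms by (metis l_one set_mult_memI sub_carrier sub_one subsetI)
qed

lemma set_mult_least:
  assumes "subgroup C G" "A \<subseteq> C" "B \<subseteq> C"
  shows "A <#> B \<subseteq> C"
  using assms by (auto simp: set_mult_def intro: sub_mult)

lemma subgroup_carrier_iff:
  assumes "subgroup L G"
  shows "subgroup K (G\<lparr>carrier := L\<rparr>) \<longleftrightarrow> subgroup K G \<and> K \<subseteq> L"
  using assms by (metis incl_subgroup subgroup.subset subgroup_incl partial_object.select_convs(1)
      partial_object.update_convs(1) partial_object.surjective)

lemma normal_carrier_iff:
  assumes L: "subgroup L G"
  shows "N \<lhd> G\<lparr>carrier := L\<rparr> \<longleftrightarrow>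
    subgroup N G \<and> N \<subseteq> L \<and> (\<forall>g\<in>L. \<forall>x\<in>N. conj_by g x \<in> N)"
proof -
  interpret L: group "G\<lparr>carrier := L\<rparr>" using L subgroup_imp_group by blast
  show ?thesis
    unfolding L.normal_inv_iff subgroup_carrier_iff[OF L]
    using L by (auto simp: conj_by_def m_inv_consistent)
qed

end

locale finite_group = group +
  assumes fin: "finite (carrier G)"
begin

lemma subgroup_finite_group: "subgroup H G \<Longrightarrow> finite_group (G\<lparr>carrier := H\<rparr>)"
  using subgroup_imp_group[of H] finite_subset[OF subgroup.subset fin, of H]
  by (simp add: finite_group_def finite_group_axioms_def)

lemma factor_finite_group: "N \<lhd> G \<Longrightarrow> finite_group (G Mod N)"
  using fin by (simp add: finite_group_def finite_group_axioms_def normal.factorgroup_is_group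
      carrier_FactGroup)

lemma sub_finite: "subgroup H G \<Longrightarrow> finite H"
  using fin finite_subset subgroup.subset by blast

lemma card_sub_pos: "subgroup H G \<Longrightarrow> 0 < card H"
  using sub_finite sub_one by (metis card_gt_0_iff empty_iff)

lemma card_rcosets_mult:
  assumes "subgroup L G" "subgroup K G" "K \<subseteq> L"
  shows "card (rcosets\<^bsub>G\<lparr>carrier := L\<rparr>\<^esub> K) * card K = card L"
  using group.lagrange[OF subgroup_imp_group[OF assms(1)], of K] assms
  by (simp add: order_def subgroup_carrier_iff)

lemma card_sub_dvd: "subgroup K G \<Longrightarrow> subgroup L G \<Longrightarrow> K \<subseteq> L \<Longrightarrow> card K dvd card L"
  by (metis card_rcosets_mult dvd_triv_right)

lemma index_card: "subgroup K G \<Longrightarrow> subgroup L G \<Longrightarrow> K \<subseteq> L \<Longrightarrow> index L K * card K = card L"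
  by (simp add: card_sub_dvd index_def)

lemma card_rcosets_index:
  assumes "subgroup K G" "subgroup L G" "K \<subseteq> L"
  shows "card (rcosets\<^bsub>G\<lparr>carrier := L\<rparr>\<^esub> K) = index L K"
  using card_rcosets_mult[OF assms(2,1,3)] card_sub_pos[OF assms(1)]
  by (metis index_def nonzero_mult_div_cancel_right not_gr0)

lemma index_pos: "subgroup K G \<Longrightarrow> subgroup L G \<Longrightarrow> K \<subseteq> L \<Longrightarrow> 0 < index L K"
  by (metis card_sub_pos index_card mult_0 not_gr0)

lemma index_trans:
  assumes "subgroup K G" "subgroup H G" "subgroup L G" "K \<subseteq> H" "H \<subseteq> L"
  shows "index L K = index L H * index H K"
proof -
  have "index L K * card K = index L H * index H K * card K"
    using assms index_card[of K H] index_card[of H L] index_card[of K L] by (simp add: mult.assoc)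
  then show ?thesis using card_sub_pos[OF assms(1)] by simp
qed

lemma index_eqI:
  assumes "subgroup K G" "n * card K = card L" shows "index L K = n"
  using assms card_sub_pos[OF assms(1)] unfolding index_def
  by (metis nonzero_mult_div_cancel_right not_gr0)

lemma index_1_imp_eq:
  assumes "subgroup K G" "subgroup L G" "K \<subseteq> L" "index L K = 1"
  shows "K = L"
  using assms index_card[of K L] card_subset_eq[OF sub_finite[of L] assms(3)] by simp

lemma index_one [simp]: "index L {\<one>} = card L"
  by (simp add: index_def)

lemma index_self [simp]: "subgroup L G \<Longrightarrow> index L L = Suc 0"
  using card_sub_pos[of L] by (simp add: index_def)

text \<open>The fibre of \<open>(a, b) \<mapsto> ab\<close> over \<open>ab\<close> consists of the pairs \<open>(ac, c\<^sup>-\<^sup>1b)\<close> with \<open>c\<close> in the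
intersection.\<close>

lemma card_set_mult:
  assumes A: "subgroup A G" and B: "subgroup B G"
  shows "card (A <#> B) * card (A \<inter> B) = card A * card B"
proof -
  let ?f = "\<lambda>x. {p \<in> A \<times> B. fst p \<otimes> snd p = x}"
  have fins: "finite A" "finite B" using sub_finite A B by auto
  have U: "A \<times> B = (\<Union>x\<in>A <#> B. ?f x)" using set_mult_memI by fastforce
  have finAB: "finite (A <#> B)"
    using fin finite_subset setmult_subset_G A B by (meson subgroup.subset)
  have "card (?f x) = card (A \<inter> B)" if "x \<in> A <#> B" for x
  proof -
    from that obtain a b where ab: "a \<in> A" "b \<in> B" "x = a \<otimes> b" by (rule set_mult_memE)
    have c: "a \<in> carrier G" "b \<in> carrier G" using ab A B sub_carrier by auto
    have "bij_betw (\<lambda>d. (a \<otimes> d, inv d \<otimes> b)) (A \<inter> B) (?f x)"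
    proof (rule bij_betwI[where g = "\<lambda>p. inv a \<otimes> fst p"])
      show "(\<lambda>d. (a \<otimes> d, inv d \<otimes> b)) \<in> A \<inter> B \<rightarrow> ?f x"
        using ab c A B by (auto simp: sub_mult sub_inv sub_carrier[OF A] m_assoc)
      show "(\<lambda>p. inv a \<otimes> fst p) \<in> ?f x \<rightarrow> A \<inter> B"
      proof (rule funcsetI)
        fix p assume p: "p \<in> ?f x"
        then have c': "fst p \<in> carrier G" "snd p \<in> carrier G" using A B sub_carrier by auto
        have "inv a \<otimes> fst p = b \<otimes> inv (snd p)"
          using p ab c c' by (simp add: inv_solve_right m_assoc)
        then show "inv a \<otimes> fst p \<in> A \<inter> B"
          using p ab A B sub_mult[OF A sub_inv[OF A ab(1)], of "fst p"]
            sub_mult[OF B ab(2) sub_inv[OF B], of "snd p"] by auto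
      qed
      fix d assume "d \<in> A \<inter> B"
      then show "inv a \<otimes> fst (a \<otimes> d, inv d \<otimes> b) = d"
        using c A by (simp add: sub_carrier)
    next
      fix p assume p: "p \<in> ?f x"
      then have c': "fst p \<in> carrier G" "snd p \<in> carrier G" using A B sub_carrier by auto
      have "inv (fst p) \<otimes> (a \<otimes> b) = inv (fst p) \<otimes> (fst p \<otimes> snd p)"
        using p ab by simp
      then show "(a \<otimes> (inv a \<otimes> fst p), inv (inv a \<otimes> fst p) \<otimes> b) = p"
        using c c' by (simp add: inv_mult_group m_assoc prod_eq_iff)
    qed
    then show ?thesis using bij_betw_same_card by fastforce
  qed
  moreover have "card (A \<times> B) = (\<Sum>x\<in>A <#> B. card (?f x))"
    by (subst U, subst card_UN_disjoint) (use fins finAB in auto)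
  ultimately show ?thesis by (simp add: card_cartesian_product)
qed

text \<open>The index of \<open>K\<close> in \<open>NK\<close> equals that of \<open>N \<inter> K\<close> in \<open>N\<close>. It divides both a \<open>\<tau>\<close>-number and a
\<open>\<tau>'\<close>-number, so it is 1. This is the form in which orders are compared throughout.\<close>

lemma tau_section_below:
  assumes sub: "subgroup N G" "subgroup K G" "subgroup B G" "subgroup W G"
    and NK: "subgroup (N <#> K) G"
    and incl: "W \<subseteq> N" "W \<subseteq> K" "N \<subseteq> B" "K \<subseteq> B"
    and tau: "tau_number \<tau> (index N W)" "tau_number (primes_compl \<tau>) (index B K)"
  shows "N \<subseteq> K"
proof -
  let ?M = "N \<inter> K"
  have M: "subgroup ?M G" using sub subgroups_Inter_pair by blast
  have NKB: "N <#> K \<subseteq> B" using set_mult_least incl sub by blast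
  have KNK: "K \<subseteq> N <#> K" using set_mult_supset sub by blast
  have "index (N <#> K) K * card K * card ?M = index N ?M * card ?M * card K"
    using card_set_mult[OF sub(1,2)] index_card[OF sub(2) NK KNK] index_card[OF M sub(1)] by simp
  then have eq: "index (N <#> K) K = index N ?M"
    using card_sub_pos[OF M] card_sub_pos[OF sub(2)] by simp
  have "index (N <#> K) K dvd index B K"
    using index_trans[OF sub(2) NK sub(3) KNK NKB] by simp
  moreover have "index N ?M dvd index N W"
    using index_trans[OF sub(4) M sub(1)] incl by simp
  ultimately have "index N ?M = 1"
    using tau eq tau_number_dvd tau_number_both by metis
  then show ?thesis using index_1_imp_eq[OF M sub(1)] by blast
qed

lemma pow_index_mem:
  assumes N: "N \<lhd> G" and L: "subgroup L G" "N \<subseteq> L" and g: "g \<in> L"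
  shows "g [^] index L N \<in> N"
proof -
  have NL: "N \<lhd> G\<lparr>carrier := L\<rparr>" using N L normal_restrict_supergroup by blast
  interpret L: finite_group "G\<lparr>carrier := L\<rparr>" using L subgroup_finite_group by blast
  interpret Q: finite_group "G\<lparr>carrier := L\<rparr> Mod N" using NL L.factor_finite_group by blast
  have sN: "subgroup N G" using N normal_imp_subgroup by blast
  have ord: "order (G\<lparr>carrier := L\<rparr> Mod N) = index L N"
    using card_rcosets_index[OF sN L] by (simp add: order_def FactGroup_def)
  have car: "N #> g \<in> carrier (G\<lparr>carrier := L\<rparr> Mod N)"
    using g by (auto simp: carrier_FactGroup r_coset_consistent)
  have "(N #>\<^bsub>G\<lparr>carrier := L\<rparr>\<^esub> g) [^]\<^bsub>G\<lparr>carrier := L\<rparr> Mod N\<^esub> index L N = N"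
    using Q.pow_order_eq_1[of "N #> g"] car ord by (simp)
  then have "N #> (g [^] index L N) = N"
    using normal.FactGroup_pow[OF NL, of g "index L N"] g L
    by (simp add: nat_pow_consistent[symmetric])
  then show ?thesis
    using g L sN by (meson coset_join1 nat_pow_closed sub_carrier subgroup.subset)
qed

text \<open>Modulo \<open>N\<close> the order of \<open>g\<close> divides \<open>n\<close> as well as \<open>|L : N|\<close>.\<close>

lemma tau_elt_mem:
  assumes N: "N \<lhd> G" and L: "subgroup L G" "N \<subseteq> L" and g: "g \<in> L" "g [^] (n::nat) \<in> N"
    and tau: "tau_number \<tau> n" "tau_number (primes_compl \<tau>) (index L N)"
  shows "g \<in> N"
  using coprime_pow_mem[of N g n "index L N"] pow_index_mem[OF N L g(1)] g L tau tau_number_coprime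
    normal_imp_subgroup[OF N] sub_carrier by blast

text \<open>Both factors are powers of \<open>x\<close>, so they lie in every subgroup that contains \<open>x\<close>.\<close>

lemma tau_parts:
  assumes x: "x \<in> carrier G"
  obtains i j :: int where "x = x [^] i \<otimes> x [^] j"
    "tau_number \<tau> (ord (x [^] i))" "tau_number (primes_compl \<tau>) (ord (x [^] j))"
proof -
  have "0 < ord x" using ord_ge_1[OF fin x] by simp
  then obtain a b where ab: "ord x = a * b" "tau_number \<tau> a" "tau_number (primes_compl \<tau>) b"
    by (rule tau_number_split)
  then have "coprime a b" using tau_number_coprime by blast
  then obtain u v where uv: "u * int a + v * int b = 1"
    by (metis bezout_int coprime_imp_gcd_eq_1 of_nat_1 gcd_int_int_eq)
  have "x [^] (v * int b) \<otimes> x [^] (u * int a) = x [^] (u * int a + v * int b)"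
    using x by (simp add: int_pow_mult[symmetric] add.commute)
  then have e: "x = x [^] (v * int b) \<otimes> x [^] (u * int a)" using uv x by simp
  have "(x [^] (v * int b)) [^] int a = \<one>" "(x [^] (u * int a)) [^] int b = \<one>"
    using x ab by (simp_all add: int_pow_pow int_pow_eq_id)
  then have "ord (x [^] (v * int b)) dvd a" "ord (x [^] (u * int a)) dvd b"
    using x by (simp_all add: int_pow_int pow_eq_id)
  then show thesis using that[OF e] ab tau_number_dvd by blast
qed

end

section \<open>Fixed points, Sylow subgroups and abelian complements\<close>

lemma (in group) group_actionI:
  assumes closed: "\<And>g x. g \<in> carrier G \<Longrightarrow> x \<in> E \<Longrightarrow> act g x \<in> E"
    and one: "\<And>x. x \<in> E \<Longrightarrow> act \<one> x = x"
    and mult: "\<And>g h x. g \<in> carrier G \<Longrightarrow> h \<in> carrier G \<Longrightarrow> x \<in> E \<Longrightarrow> act (g \<otimes> h) x = act g (act h x)"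
  shows "group_action G E (\<lambda>g. \<lambda>x\<in>E. act g x)"
proof -
  have bij: "(\<lambda>x\<in>E. act g x) \<in> Bij E" if g: "g \<in> carrier G" for g
  proof -
    have "act (inv g) (act g x) = x" "act g (act (inv g) x) = x" if "x \<in> E" for x
      using that g one mult[of "inv g" g x] mult[of g "inv g" x] by auto
    then have "bij_betw (act g) E E"
      using g closed by (intro bij_betwI[where g = "act (inv g)"]) auto
    then show ?thesis by (simp add: Bij_def bij_betw_restrict_eq)
  qed
  have "compose E (\<lambda>x\<in>E. act g x) (\<lambda>x\<in>E. act h x) = (\<lambda>x\<in>E. act (g \<otimes> h) x)"
    if "g \<in> carrier G" "h \<in> carrier G" for g h
    using that closed mult by (auto simp: compose_def)
  then have "(\<lambda>g. \<lambda>x\<in>E. act g x) \<in> hom G (BijGroup E)"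
    using bij by (auto simp: hom_def BijGroup_def)
  then show ?thesis
    by (simp add: group_action_def group_hom_def group_hom_axioms_def group_BijGroup)
qed

text \<open>The orbit of a point that is not fixed has length a power of \<open>p\<close> greater than 1. The factor \<open>k\<close>
allows for a kernel of the action, so that the lemma applies to \<open>p\<close>-groups given as sections of a
larger group.\<close>

lemma (in group_action) fixed_points_mod_prime:
  assumes fin: "finite E" and p: "prime (p::nat)" and ord: "order G = p ^ a * k" and k: "0 < k"
    and stab: "\<And>x. x \<in> E \<Longrightarrow> k dvd card (stabilizer G \<phi> x)"
  shows "p dvd card E \<longleftrightarrow> p dvd card {x \<in> E. \<forall>g\<in>carrier G. \<phi> g x = x}"
proof -
  let ?F = "{x \<in> E. \<forall>g\<in>carrier G. \<phi> g x = x}"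
  let ?f = "\<lambda>x. if x \<in> ?F then 0 else 1 :: nat"
  have "p dvd (\<Sum>x\<in>orb. ?f x)" if "orb \<in> orbits G E \<phi>" for orb
  proof -
    from that obtain x where x: "x \<in> E" "orb = orbit G \<phi> x" by (auto simp: orbits_def)
    show ?thesis
    proof (cases "x \<in> ?F")
      case True
      then have "orb \<subseteq> ?F" using x by (auto simp: orbit_def)
      then show ?thesis by (simp add: sum.neutral subset_iff)
    next
      case False
      have "orb \<subseteq> E" using x element_image by (auto simp: orbit_def)
      have "y \<notin> ?F" if "y \<in> orb" for y
      proof
        assume y: "y \<in> ?F"
        have "x \<in> orbit G \<phi> y" using that x orbit_sym y by blast
        then have "x = y" using y by (auto simp: orbit_def)
        then show False using False y by simp
      qed
      then have "(\<Sum>x\<in>orb. ?f x) = (\<Sum>x\<in>orb. 1)" by (intro sum.cong) auto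
      then have "(\<Sum>x\<in>orb. ?f x) = card orb" by simp
      moreover have "card orb dvd p ^ a"
      proof -
        have "card orb * card (stabilizer G \<phi> x) = p ^ a * k"
          using orbit_stabilizer_theorem[OF x(1)] x(2) ord by simp
        moreover obtain c where "card (stabilizer G \<phi> x) = k * c" using stab x by blast
        ultimately have "k * (card orb * c) = k * p ^ a" by (simp add: algebra_simps)
        then have "card orb * c = p ^ a" using k by simp
        then show ?thesis by (metis dvd_triv_left)
      qed
      moreover have "card orb \<noteq> 1"
      proof
        assume "card orb = 1"
        then obtain z where z: "orb = {z}" using card_1_singletonE by blast
        have "x \<in> orb" using x orbit_refl by blast
        then have "orb = {x}" using z by auto
        then have "\<phi> g x = x" if "g \<in> carrier G" for g using that x by (auto simp: orbit_def)
        then show False using False x by blast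
      qed
      ultimately show ?thesis using divides_primepow_nat[OF p] by (metis dvd_power neq0_conv power_0)
    qed
  qed
  then have "p dvd (\<Sum>x\<in>E. ?f x)"
    unfolding disjoint_sum[OF fin, symmetric] by (rule dvd_sum)
  moreover have "(\<Sum>x\<in>E. ?f x) + card ?F = card E"
  proof -
    have "(\<Sum>x\<in>E. ?f x) = (\<Sum>x\<in>E - ?F. 1)"
      by (rule sum.mono_neutral_cong_right) (use fin in auto)
    moreover have "card (E - ?F) = card E - card ?F" "card ?F \<le> card E"
      using fin by (auto intro: card_Diff_subset card_mono)
    ultimately show ?thesis by simp
  qed
  ultimately show ?thesis using dvd_add_right_iff[of p "\<Sum>x\<in>E. ?f x" "card ?F"] by argo
qed

context finite_group
begin

lemma coset_eq_iff:
  assumes "subgroup N G" "x \<in> carrier G" "y \<in> carrier G"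
  shows "N #> x = N #> y \<longleftrightarrow> x \<otimes> inv y \<in> N"
proof -
  have iff: "x \<otimes> inv y \<in> N \<longleftrightarrow> x \<in> N #> y"
    using subgroup.rcos_module[OF assms(1) is_group assms(3,2)] by (rule sym)
  show ?thesis
    unfolding iff
  proof
    assume "N #> x = N #> y"
    then show "x \<in> N #> y" using rcos_self[OF assms(2,1)] by (rule subst)
  next
    assume "x \<in> N #> y"
    from repr_independence[OF this assms(3,1)] show "N #> x = N #> y" by (rule sym)
  qed
qed

text \<open>Choose a representative \<open>r C\<close> in each coset \<open>C\<close>. The elements \<open>g \<cdot> r C \<cdot> (r (gC))\<^sup>-\<^sup>1\<close> lie in
\<open>N\<close>, and their product \<open>\<delta> g\<close> over all \<open>C\<close> satisfies \<open>\<delta> (gh) = g (\<delta> h) g\<^sup>-\<^sup>1 \<cdot> \<delta> g\<close>. On \<open>N\<close> the map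
\<open>\<delta>\<close> is the power map with exponent \<open>|G : N|\<close>, a bijection because the two orders are coprime. So
the kernel of \<open>\<delta>\<close> is a complement.\<close>

lemma abelian_normal_complement:
  assumes N: "N \<lhd> G" and comm: "\<And>x y. x \<in> N \<Longrightarrow> y \<in> N \<Longrightarrow> x \<otimes> y = y \<otimes> x"
    and cop: "coprime (card N) (index (carrier G) N)"
  obtains C where "subgroup C G" "C \<inter> N = {\<one>}" "N <#> C = carrier G"
proof -
  have sN: "subgroup N G" using N normal_imp_subgroup by blast
  let ?A = "G\<lparr>carrier := N\<rparr>"
  interpret A: comm_group ?A
    using comm subgroup_imp_group[OF sN] by (intro group.group_comm_groupI) auto
  define E where "E = rcosets N"
  define r where "r C = (SOME x. x \<in> C)" for C :: "'a set"
  have finE: "finite E"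
    unfolding E_def using fin by (simp add: RCOSETS_def)
  have r: "r C \<in> carrier G" "N #> r C = C" if C: "C \<in> E" for C
  proof -
    obtain g where g: "g \<in> carrier G" "C = N #> g" using C by (auto simp: E_def RCOSETS_def)
    have "g \<in> C" using g rcos_self sN by blast
    then have rC: "r C \<in> C" unfolding r_def by (rule someI)
    then show "r C \<in> carrier G" using g sN by (meson r_coset_subset_G subgroup.subset subsetD)
    show "N #> r C = C" using repr_independence[of "r C" N g] rC g sN by simp
  qed
  define act where "act g C = N #> (g \<otimes> r C)" for g C
  have act: "act g C \<in> E" if "g \<in> carrier G" "C \<in> E" for g C
    using that r by (simp add: act_def E_def rcosetsI sN subgroup.subset)
  have rN: "r (N #> x) \<otimes> inv x \<in> N" if "x \<in> carrier G" for x
    using that r[of "N #> x"] coset_eq_iff[OF sN, of "r (N #> x)" x]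
    by (simp add: E_def rcosetsI sN subgroup.subset)
  have act_mult: "act (g \<otimes> h) C = act g (act h C)"
    if "g \<in> carrier G" "h \<in> carrier G" "C \<in> E" for g h C
  proof -
    have c: "r C \<in> carrier G" "r (act h C) \<in> carrier G" using that r act by auto
    have "g \<otimes> h \<otimes> r C \<otimes> inv (g \<otimes> r (act h C)) = conj_by g (inv (r (act h C) \<otimes> inv (h \<otimes> r C)))"
      using that c by (simp add: group_word_simps)
    also have "\<dots> \<in> N"
      using rN[of "h \<otimes> r C"] that c sN normal_conj_by[OF N] by (simp add: act_def sub_inv)
    finally show ?thesis
      using that c coset_eq_iff[OF sN] by (simp add: act_def[of g] act_def[of "g \<otimes> h"])
  qed
  have act_one: "act \<one> C = C" if "C \<in> E" for C using that r by (simp add: act_def)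
  define f where "f g C = g \<otimes> r C \<otimes> inv (r (act g C))" for g C
  have f: "f g C \<in> N" if "g \<in> carrier G" "C \<in> E" for g C
  proof -
    have "f g C = inv (r (act g C) \<otimes> inv (g \<otimes> r C))"
      using that r act by (simp add: f_def group_word_simps)
    then show ?thesis using rN[of "g \<otimes> r C"] that r sN by (simp add: act_def sub_inv)
  qed
  define \<delta> where "\<delta> g = finprod ?A (f g) E" for g
  have dN: "\<delta> g \<in> N" if "g \<in> carrier G" for g
    using A.finprod_closed[of "f g" E] f that by (auto simp: \<delta>_def)
  have reindex: "finprod ?A (\<lambda>C. f g (act h C)) E = \<delta> g"
    if gh: "g \<in> carrier G" "h \<in> carrier G" for g h
  proof -
    have inj: "inj_on (act h) E"
      using act_mult[of "inv h" h] act_one gh by (intro inj_on_inverseI[where g = "act (inv h)"]) simp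
    have "act h ` E = E"
      using inj act gh finE by (intro card_subset_eq) (auto simp: card_image)
    then show ?thesis
      using A.finprod_reindex[of "f g" "act h" E] inj f gh by (auto simp: \<delta>_def)
  qed
  have hom_conj_by: "finprod ?A (\<lambda>C. conj_by g (F C)) E' = conj_by g (finprod ?A F E')"
    if "g \<in> carrier G" "finite E'" "F \<in> E' \<rightarrow> N" for g F and E' :: "'a set set"
    using that(2,3)
  proof (induction E')
    case empty
    then show ?case using that(1) by simp
  next
    case (insert x E')
    then have "F x \<in> N" "F \<in> E' \<rightarrow> N" by auto
    moreover have "finprod ?A F E' \<in> N" using insert A.finprod_closed[of F E'] by auto
    ultimately show ?case
      using insert that(1) normal_conj_by[OF N] sub_carrier[OF sN] by (simp add: conj_by_mult Pi_def)
  qed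
  have crossed: "\<delta> (g \<otimes> h) = conj_by g (\<delta> h) \<otimes> \<delta> g"
    if gh: "g \<in> carrier G" "h \<in> carrier G" for g h
  proof -
    have eq: "f (g \<otimes> h) C = conj_by g (f h C) \<otimes> f g (act h C)" if C: "C \<in> E" for C
    proof -
      have c: "r C \<in> carrier G" "r (act h C) \<in> carrier G" "r (act g (act h C)) \<in> carrier G"
        using C r act gh by auto
      show ?thesis using c gh C act_mult[of g h C] by (simp add: f_def group_word_simps)
    qed
    have "\<delta> (g \<otimes> h) = finprod ?A (\<lambda>C. conj_by g (f h C) \<otimes>\<^bsub>?A\<^esub> f g (act h C)) E"
      unfolding \<delta>_def using eq f act gh normal_conj_by[OF N] by (intro A.finprod_cong') (auto intro: sub_mult sN)
    also have "\<dots> = finprod ?A (\<lambda>C. conj_by g (f h C)) E \<otimes>\<^bsub>?A\<^esub> finprod ?A (\<lambda>C. f g (act h C)) E"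
      using f act gh normal_conj_by[OF N] by (intro A.finprod_multf) auto
    also have "\<dots> = conj_by g (\<delta> h) \<otimes> \<delta> g"
      using hom_conj_by[of g E "f h"] reindex[OF gh] f gh finE by (simp add: \<delta>_def Pi_def)
    finally show ?thesis .
  qed
  let ?m = "index (carrier G) N"
  have cardE: "card E = ?m"
    using card_rcosets_index[OF sN subgroup_self] by (simp add: E_def subgroup.subset[OF sN])
  have d_N: "\<delta> n = n [^] ?m" if n: "n \<in> N" for n
  proof -
    have nc: "n \<in> carrier G" using n sN sub_carrier by blast
    have "f n C = n" if C: "C \<in> E" for C
    proof -
      have "act n C = C"
        using C n nc r coset_eq_iff[OF sN, of "n \<otimes> r C" "r C"] by (simp add: act_def m_assoc)
      then show ?thesis using r[OF C] nc by (simp add: f_def m_assoc)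
    qed
    then have "\<delta> n = finprod ?A (\<lambda>C. n) E"
      unfolding \<delta>_def using n by (intro A.finprod_cong') auto
    also have "\<dots> = n [^] ?m"
      using A.finprod_const[of n E] n cardE by (simp add: nat_pow_consistent[symmetric])
    finally show ?thesis .
  qed
  define C where "C = {g \<in> carrier G. \<delta> g = \<one>}"
  have d1: "\<delta> \<one> = \<one>" using d_N[of \<one>] sub_one[OF sN] by simp
  have "subgroup C G"
  proof (rule subgroupI)
    show "C \<subseteq> carrier G" "C \<noteq> {}" using d1 by (auto simp: C_def)
    fix g assume g: "g \<in> C"
    then have gc: "g \<in> carrier G" "\<delta> g = \<one>" by (auto simp: C_def)
    then have "\<delta> (inv g) = \<one>"
      using crossed[of g "inv g"] d1 dN[of "inv g"] sub_carrier[OF sN]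
      by (metis conj_by_inv_cancel(1) conj_by_one(1) inv_closed r_inv r_one conj_by_closed)
    then show "inv g \<in> C" using gc by (auto simp: C_def)
    fix h assume h: "h \<in> C"
    show "g \<otimes> h \<in> C" using g h crossed[of g h] by (simp add: C_def)
  qed
  moreover have "C \<inter> N = {\<one>}"
  proof -
    have "x = \<one>" if x: "x \<in> C" "x \<in> N" for x
    proof -
      have xc: "x \<in> carrier G" using x sN sub_carrier by blast
      have "x [^] ?m = \<one>" using x d_N by (simp add: C_def)
      moreover have "x [^] card N = \<one>"
        using group.pow_order_eq_1[OF A.is_group, of x] x
        by (simp add: order_def nat_pow_consistent[symmetric])
      ultimately have "x \<in> {\<one>}"
        using coprime_pow_mem[OF triv_subgroup xc, of "card N" ?m] cop by simp
      then show ?thesis by simp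
    qed
    then show ?thesis using d1 sub_one[OF sN] by (auto simp: C_def)
  qed
  moreover have "N <#> C = carrier G"
  proof
    show "N <#> C \<subseteq> carrier G"
      using sN by (intro setmult_subset_G) (auto simp: C_def subgroup.subset)
    show "carrier G \<subseteq> N <#> C"
    proof
      fix g assume g: "g \<in> carrier G"
      obtain u v where uv: "u * int ?m + v * int (card N) = 1"
        using cop by (metis bezout_int coprime_imp_gcd_eq_1 of_nat_1 gcd_int_int_eq coprime_commute)
      define y where "y = inv (\<delta> g)"
      have y: "y \<in> N" "y \<in> carrier G" using dN[OF g] sN by (auto simp: y_def sub_inv sub_carrier)
      define n where "n = y [^] u"
      have n: "n \<in> N" "n \<in> carrier G" using y sN by (auto simp: n_def sub_int_pow)
      have "y [^] card N = \<one>"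
        using group.pow_order_eq_1[OF A.is_group, of y] y
        by (simp add: order_def nat_pow_consistent[symmetric])
      then have "y [^] (int (card N) * v) = \<one>" using y by (simp add: int_pow_pow[symmetric] int_pow_int)
      moreover have "y = y [^] (u * int ?m) \<otimes> y [^] (int (card N) * v)"
        using y uv by (simp add: int_pow_mult[symmetric] mult.commute)
      ultimately have "n [^] ?m = y"
        using y by (simp add: n_def int_pow_pow int_pow_int[symmetric])
      then have "\<delta> n = y" using d_N n by simp
      then have "\<delta> (n \<otimes> g) = conj_by n (\<delta> g) \<otimes> y" using crossed n g by simp
      also have "conj_by n (\<delta> g) = \<delta> g"
        using comm[OF n(1) dN[OF g]] n dN[OF g] sub_carrier[OF sN] by (simp add: conj_by_eq_iff_commute)
      also have "\<delta> g \<otimes> y = \<one>" using dN[OF g] sub_carrier[OF sN] by (simp add: y_def)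
      finally have "n \<otimes> g \<in> C" using n g by (simp add: C_def)
      then show "g \<in> N <#> C"
        using set_mult_memI[of "inv n" N "n \<otimes> g" C] n g sN by (simp add: sub_inv)
    qed
  qed
  ultimately show thesis using that by blast
qed

text \<open>\<open>P\<close> acts on the right cosets of \<open>H\<close> with \<open>K\<close> in the kernel. Their number is prime to \<open>p\<close>, so some
coset \<open>Hg\<close> is fixed, which means that \<open>g\<close> conjugates \<open>P\<close> into \<open>H\<close>.\<close>

lemma sylow_conj:
  assumes p: "prime p" and K: "K \<lhd> G" and P: "subgroup P G" "K \<subseteq> P" "index P K = p ^ a"
    and H: "subgroup H G" "K \<subseteq> H" "\<not> p dvd index (carrier G) H"
  obtains g where "g \<in> carrier G" "\<And>x. x \<in> P \<Longrightarrow> conj_by g x \<in> H"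
proof -
  have sK: "subgroup K G" using K normal_imp_subgroup by blast
  interpret P: finite_group "G\<lparr>carrier := P\<rparr>" using P subgroup_finite_group by blast
  let ?E = "rcosets H"
  have invP: "inv\<^bsub>G\<lparr>carrier := P\<rparr>\<^esub> g = inv g" if "g \<in> P" for g
    using that P m_inv_consistent by blast
  let ?\<phi> = "\<lambda>g. \<lambda>C\<in>?E. C #> inv g"
  have E: "C \<subseteq> carrier G" if "C \<in> ?E" for C
    using that H(1) rcosets_part_G by blast
  interpret act: group_action "G\<lparr>carrier := P\<rparr>" ?E ?\<phi>
  proof (rule P.group_actionI)
    fix g C assume g: "g \<in> carrier (G\<lparr>carrier := P\<rparr>)" and C: "C \<in> ?E"
    then have gc: "g \<in> carrier G" using P sub_carrier by simp
    obtain x where x: "x \<in> carrier G" "C = H #> x" using C by (auto simp: RCOSETS_def)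
    then show "C #> inv g \<in> ?E"
      using gc H by (simp add: coset_mult_assoc rcosetsI subgroup.subset)
  next
    fix g h C assume gh: "g \<in> carrier (G\<lparr>carrier := P\<rparr>)" "h \<in> carrier (G\<lparr>carrier := P\<rparr>)"
      and C: "C \<in> ?E"
    then have "g \<in> carrier G" "h \<in> carrier G" using P sub_carrier by simp_all
    then show "C #> inv (g \<otimes>\<^bsub>G\<lparr>carrier := P\<rparr>\<^esub> h) = C #> inv h #> inv g"
      using E[OF C] by (simp add: inv_mult_group coset_mult_assoc)
  qed (use E in simp)
  have ord: "order (G\<lparr>carrier := P\<rparr>) = p ^ a * card K"
    using index_card[OF sK P(1,2)] P(3) by (simp add: order_def)
  have stab: "card K dvd card (stabilizer (G\<lparr>carrier := P\<rparr>) ?\<phi> C)" if C: "C \<in> ?E" for C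
  proof -
    let ?S = "stabilizer (G\<lparr>carrier := P\<rparr>) ?\<phi> C"
    have S: "subgroup ?S G" "?S \<subseteq> P"
      using act.stabilizer_subgroup[OF C] subgroup_carrier_iff[OF P(1)] by auto
    obtain x where x: "x \<in> carrier G" "C = H #> x" using C by (auto simp: RCOSETS_def)
    have "C #> inv k = C" if k: "k \<in> K" for k
    proof -
      have kc: "k \<in> carrier G" using k sK sub_carrier by blast
      have "conj_by x (inv k) \<in> H" using normal_conj_by[OF K x(1)] k sK H by (auto simp: sub_inv)
      moreover have "x \<otimes> inv k \<otimes> inv x = conj_by x (inv k)" by (simp add: conj_by_def)
      ultimately show ?thesis
        using x kc H coset_eq_iff[OF H(1), of "x \<otimes> inv k" x]
        by (simp add: coset_mult_assoc subgroup.subset)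
    qed
    then have "K \<subseteq> ?S" using P C by (auto simp: stabilizer_def)
    then show ?thesis using card_sub_dvd[OF sK S(1)] by blast
  qed
  have "card ?E = index (carrier G) H"
    using card_rcosets_index[OF H(1) subgroup_self] by (simp add: subgroup.subset[OF H(1)])
  then have "\<not> p dvd card {C \<in> ?E. \<forall>g\<in>P. ?\<phi> g C = C}"
    using act.fixed_points_mod_prime[OF _ p ord _ stab] H(3) card_sub_pos[OF sK] fin
    by (simp add: RCOSETS_def)
  then have "{C \<in> ?E. \<forall>g\<in>P. ?\<phi> g C = C} \<noteq> {}" by (metis card.empty dvd_0_right)
  then obtain C where C: "C \<in> ?E" "\<And>g. g \<in> P \<Longrightarrow> C #> inv g = C" by auto
  then obtain x where x: "x \<in> carrier G" "C = H #> x" by (auto simp: RCOSETS_def)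
  have "conj_by x g \<in> H" if g: "g \<in> P" for g
  proof -
    have gc: "g \<in> carrier G" using g P sub_carrier by blast
    have "H #> (x \<otimes> inv g) = H #> x"
      using C(2)[OF g] x gc H by (simp add: coset_mult_assoc subgroup.subset)
    then have "x \<otimes> inv g \<otimes> inv x \<in> H" using coset_eq_iff[OF H(1)] x gc by simp
    then have "inv (x \<otimes> inv g \<otimes> inv x) \<in> H" using H sub_inv by blast
    then show ?thesis using x gc by (simp add: group_word_simps)
  qed
  then show thesis using that x by blast
qed

lemma p_group_center_nontrivial:
  assumes p: "prime p" and ord: "order G = p ^ a" and a: "0 < a"
  obtains z where "z \<in> carrier G" "z \<noteq> \<one>" "\<And>g. g \<in> carrier G \<Longrightarrow> g \<otimes> z = z \<otimes> g"
proof -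
  let ?\<phi> = "\<lambda>g. \<lambda>x\<in>carrier G. conj_by g x"
  interpret act: group_action G "carrier G" ?\<phi>
    by (rule group_actionI) (simp_all add: conj_by_conj_by)
  let ?F = "{x \<in> carrier G. \<forall>g\<in>carrier G. ?\<phi> g x = x}"
  have "p dvd card (carrier G)" using ord a p by (simp add: order_def)
  then have dvd: "p dvd card ?F"
    using act.fixed_points_mod_prime[OF fin p, of a 1] ord by simp
  have "?F \<noteq> {\<one>}"
  proof
    assume "?F = {\<one>}"
    then show False using dvd p by (metis card_1_singleton_iff One_nat_def not_prime_unit)
  qed
  moreover have "\<one> \<in> ?F" by simp
  ultimately obtain z where "z \<in> ?F" "z \<noteq> \<one>" by blast
  then show thesis using that[of z] conj_by_eq_iff_commute[of _ z] by auto
qed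

lemma factor_group_hom:
  assumes "N \<lhd> G" shows "group_hom G (G Mod N) (\<lambda>x. N #> x)"
  using assms normal.r_coset_hom_Mod[OF assms]
  by (simp add: group_hom_def group_hom_axioms_def normal.factorgroup_is_group)

lemma factor_mult: "N \<lhd> G \<Longrightarrow> x \<in> carrier G \<Longrightarrow> y \<in> carrier G \<Longrightarrow>
    (N #> x) \<otimes>\<^bsub>G Mod N\<^esub> (N #> y) = N #> (x \<otimes> y)"
  using group_hom.hom_mult[OF factor_group_hom] by fastforce

lemma factor_carrier: "x \<in> carrier G \<Longrightarrow> N #> x \<in> carrier (G Mod N)"
  by (auto simp: carrier_FactGroup)

lemma factor_order:
  assumes "N \<lhd> G" shows "order (G Mod N) = index (carrier G) N"
  using card_rcosets_index[OF normal_imp_subgroup[OF assms] subgroup_self]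
  by (simp add: order_def FactGroup_def subgroup.subset[OF normal_imp_subgroup[OF assms]])

lemma factor_image_subgroup:
  assumes N: "N \<lhd> G" and H: "subgroup H G" "N \<subseteq> H"
  shows "subgroup ((\<lambda>x. N #> x) ` H) (G Mod N)" "card ((\<lambda>x. N #> x) ` H) = index H N"
proof -
  show "subgroup ((\<lambda>x. N #> x) ` H) (G Mod N)"
    using group_hom.subgroup_img_is_subgroup[OF factor_group_hom[OF N] H(1)] .
  have "rcosets\<^bsub>G\<lparr>carrier := H\<rparr>\<^esub> N = (\<lambda>x. N #> x) ` H" by (auto simp: RCOSETS_def)
  then show "card ((\<lambda>x. N #> x) ` H) = index H N"
    using card_rcosets_index[OF normal_imp_subgroup[OF N] H] by simp
qed

lemma factor_image_mem:
  assumes N: "N \<lhd> G" and H: "subgroup H G" "N \<subseteq> H" and x: "x \<in> carrier G"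
  shows "N #> x \<in> (\<lambda>x. N #> x) ` H \<longleftrightarrow> x \<in> H"
proof
  assume "N #> x \<in> (\<lambda>x. N #> x) ` H"
  then obtain h where h: "h \<in> H" "N #> x = N #> h" by auto
  then have "x \<otimes> inv h \<in> H"
    using coset_eq_iff[OF normal_imp_subgroup[OF N] x, of h] H sub_carrier by blast
  then show "x \<in> H" using sub_cancel_r[OF H(1) sub_inv[OF H(1) h(1)] x] by blast
qed auto

lemma factor_preimage_subgroup:
  assumes N: "N \<lhd> G" and B: "subgroup B (G Mod N)"
  defines "H \<equiv> {g \<in> carrier G. N #> g \<in> B}"
  shows "subgroup H G" "N \<subseteq> H" "(\<lambda>x. N #> x) ` H = B" "index H N = card B"
proof -
  interpret Q: group "G Mod N" using N normal.factorgroup_is_group by blast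
  interpret h: group_hom G "G Mod N" "\<lambda>x. N #> x" using factor_group_hom[OF N] .
  have sN: "subgroup N G" using N normal_imp_subgroup by blast
  show H: "subgroup H G"
  proof (rule subgroupI)
    show "H \<subseteq> carrier G" by (auto simp: H_def)
    show "H \<noteq> {}" using Q.sub_one[OF B] h.hom_one by (auto simp: H_def)
    fix g assume g: "g \<in> H"
    then show "inv g \<in> H" using Q.sub_inv[OF B, of "N #> g"] by (auto simp: H_def)
    fix k assume k: "k \<in> H"
    then show "g \<otimes> k \<in> H"
      using g Q.sub_mult[OF B, of "N #> g" "N #> k"] h.hom_mult[of g k] by (auto simp: H_def)
  qed
  show NH: "N \<subseteq> H"
    using Q.sub_one[OF B] sN by (auto simp: H_def coset_join2 sub_carrier)
  show im: "(\<lambda>x. N #> x) ` H = B"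
    using Q.sub_carrier[OF B] by (fastforce simp: H_def carrier_FactGroup)
  show "index H N = card B" using factor_image_subgroup(2)[OF N H NH] im by simp
qed

lemma sylow_mod_exists:
  assumes N: "N \<lhd> G" and p: "prime p" and dvd: "p ^ a dvd index (carrier G) N"
  obtains P where "subgroup P G" "N \<subseteq> P" "index P N = p ^ a"
proof -
  interpret Q: finite_group "G Mod N" using N factor_finite_group by blast
  obtain m where "order (G Mod N) = p ^ a * m" using dvd factor_order[OF N] by (metis dvdE)
  then obtain B where B: "subgroup B (G Mod N)" "card B = p ^ a"
    using sylow_thm[OF p Q.is_group _ Q.fin, of a m] by auto
  show thesis using factor_preimage_subgroup[OF N B(1)] B(2) by (intro that) auto
qed

end

section \<open>The Schur-Zassenhaus theorem\<close>

context group
begin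

definition commut :: "'a \<Rightarrow> 'a \<Rightarrow> 'a" where
  "commut z x = conj_by z x \<otimes> inv x"

text \<open>The elements that act trivially by conjugation on the section \<open>V/K\<close>.\<close>

definition cent_mod :: "'a set \<Rightarrow> 'a set \<Rightarrow> 'a set" where
  "cent_mod K V = {z \<in> carrier G. \<forall>x\<in>V. commut z x \<in> K}"

lemma commut_closed [simp]: "z \<in> carrier G \<Longrightarrow> x \<in> carrier G \<Longrightarrow> commut z x \<in> carrier G"
  by (simp add: commut_def)

lemma inv_commut: "z \<in> carrier G \<Longrightarrow> x \<in> carrier G \<Longrightarrow> inv (commut z x) = commut x z"
  by (simp add: commut_def group_word_simps)

lemma commut_sym:
  assumes "subgroup K G" "z \<in> carrier G" "x \<in> carrier G" "commut z x \<in> K"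
  shows "commut x z \<in> K"
  using assms inv_commut[of z x] sub_inv by metis

lemma commut_eq_one_iff:
  "z \<in> carrier G \<Longrightarrow> x \<in> carrier G \<Longrightarrow> commut z x = \<one> \<longleftrightarrow> z \<otimes> x = x \<otimes> z"
  by (metis conj_by_closed conj_by_eq_iff_commute commut_def inv_solve_right' l_one one_closed)

lemma conj_by_eq_commut: "z \<in> carrier G \<Longrightarrow> x \<in> carrier G \<Longrightarrow> conj_by z x = commut z x \<otimes> x"
  by (simp add: commut_def m_assoc)

lemma conj_by_consistent:
  "subgroup L G \<Longrightarrow> g \<in> L \<Longrightarrow> group.conj_by (G\<lparr>carrier := L\<rparr>) g x = conj_by g x"
  by (simp add: conj_by_def group.conj_by_def subgroup_imp_group m_inv_consistent)

lemma commut_consistent: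
  "subgroup L G \<Longrightarrow> g \<in> L \<Longrightarrow> x \<in> L \<Longrightarrow> group.commut (G\<lparr>carrier := L\<rparr>) g x = commut g x"
  by (simp add: commut_def group.commut_def subgroup_imp_group m_inv_consistent conj_by_consistent)

lemma normal_commut:
  assumes "N \<lhd> G" "g \<in> carrier G" "x \<in> N"
  shows "commut g x \<in> N" "commut x g \<in> N"
proof -
  have s: "subgroup N G" using assms normal_imp_subgroup by blast
  show "commut g x \<in> N" using assms s normal_conj_by by (simp add: commut_def sub_mult sub_inv)
  then show "commut x g \<in> N" using commut_sym[OF s assms(2)] sub_carrier[OF s assms(3)] by blast
qed

lemma commut_Int_normal:
  assumes "A \<lhd> G" "B \<lhd> G" "a \<in> A" "b \<in> B"
  shows "commut a b \<in> A \<inter> B"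
  using assms normal_commut normal_imp_subgroup sub_carrier by (metis IntI)

lemma set_mult_absorb:
  assumes "subgroup V G" "subgroup X G" "X \<subseteq> V"
  shows "V <#> X = V" "X <#> V = V"
  using assms set_mult_supset[of V X] set_mult_supset[of X V] set_mult_least[of V V X]
    set_mult_least[of V X V] by auto

lemma set_stabilizer_subgroup:
  assumes K: "K \<subseteq> carrier G"
  shows "subgroup {g \<in> carrier G. conj_by g ` K = K} G"
proof (rule subgroupI)
  have "conj_by \<one> ` K = (\<lambda>x. x) ` K" using K by (intro image_cong) auto
  then show "{g \<in> carrier G. conj_by g ` K = K} \<noteq> {}" by auto
  fix g assume g: "g \<in> {g \<in> carrier G. conj_by g ` K = K}"
  have "conj_by (inv g) ` (conj_by g ` K) = (\<lambda>x. x) ` K"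
    unfolding image_image using g K by (intro image_cong) auto
  then show "inv g \<in> {g \<in> carrier G. conj_by g ` K = K}" using g by simp
  fix h assume h: "h \<in> {g \<in> carrier G. conj_by g ` K = K}"
  have "conj_by (g \<otimes> h) ` K = conj_by g ` (conj_by h ` K)"
    unfolding image_image using g h K by (intro image_cong) (auto simp: conj_by_conj_by)
  then show "g \<otimes> h \<in> {g \<in> carrier G. conj_by g ` K = K}" using g h by simp
qed auto

end

context finite_group
begin

text \<open>This turns computations with commutators modulo \<open>K\<close> into commutation in the factor group.\<close>

lemma commut_mod_iff:
  assumes "K \<lhd> G" "z \<in> carrier G" "x \<in> carrier G"
  shows "commut z x \<in> K \<longleftrightarrow>
    (K #> z) \<otimes>\<^bsub>G Mod K\<^esub> (K #> x) = (K #> x) \<otimes>\<^bsub>G Mod K\<^esub> (K #> z)"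
proof -
  have "z \<otimes> x \<otimes> inv (x \<otimes> z) = commut z x" using assms by (simp add: commut_def group_word_simps)
  then show ?thesis
    using coset_eq_iff[OF normal_imp_subgroup[OF assms(1)], of "z \<otimes> x" "x \<otimes> z"] assms
    by (simp only: factor_mult m_closed)
qed

lemma factor_conj_by:
  assumes K: "K \<lhd> G" and g: "g \<in> carrier G" "x \<in> carrier G"
  shows "group.conj_by (G Mod K) (K #> g) (K #> x) = K #> conj_by g x"
proof -
  interpret Q: group "G Mod K" using K normal.factorgroup_is_group by blast
  interpret h: group_hom G "G Mod K" "\<lambda>x. K #> x" using factor_group_hom[OF K] .
  have "Q.conj_by (K #> g) (K #> x) = (K #> g) \<otimes>\<^bsub>G Mod K\<^esub> (K #> x) \<otimes>\<^bsub>G Mod K\<^esub> (K #> inv g)"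
    unfolding Q.conj_by_def h.hom_inv[OF g(1)] ..
  also have "\<dots> = K #> conj_by g x"
    unfolding conj_by_def using g by (simp only: factor_mult[OF K] m_closed inv_closed)
  finally show ?thesis .
qed

lemma cent_mod_subgroup:
  assumes K: "K \<lhd> G" and V: "V \<subseteq> carrier G"
  shows "subgroup (cent_mod K V) G"
proof (rule subgroupI)
  interpret Q: group "G Mod K" using K normal.factorgroup_is_group by blast
  interpret h: group_hom G "G Mod K" "\<lambda>x. K #> x" using factor_group_hom[OF K] .
  have sK: "subgroup K G" using K normal_imp_subgroup by blast
  have iff: "z \<in> cent_mod K V \<longleftrightarrow> z \<in> carrier G \<and> (\<forall>x\<in>V. Q.conj_by (K #> z) (K #> x) = K #> x)" for z
    using V Q.conj_by_eq_iff_commute h.hom_closed commut_mod_iff[OF K] unfolding cent_mod_def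
    by (smt (verit) mem_Collect_eq subsetD)
  show "cent_mod K V \<subseteq> carrier G" by (auto simp: cent_mod_def)
  have "\<one> \<in> cent_mod K V"
    unfolding iff using V h.hom_closed by (auto simp: h.hom_one simp del: one_FactGroup)
  then show "cent_mod K V \<noteq> {}" by blast
  fix z assume z: "z \<in> cent_mod K V"
  show "inv z \<in> cent_mod K V"
    unfolding iff
  proof (intro conjI ballI)
    show "inv z \<in> carrier G" using z iff by simp
    fix x assume x: "x \<in> V"
    then have "Q.conj_by (K #> z) (K #> x) = K #> x" using z iff by blast
    then show "Q.conj_by (K #> inv z) (K #> x) = K #> x"
      using x V z iff Q.conj_by_inv_cancel(1)[of "K #> z" "K #> x"] h.hom_closed
      by (auto simp: h.hom_inv)
  qed
  fix y assume y: "y \<in> cent_mod K V"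
  show "z \<otimes> y \<in> cent_mod K V"
    unfolding iff
  proof (intro conjI ballI)
    show "z \<otimes> y \<in> carrier G" using y z iff by simp
    fix x assume x: "x \<in> V"
    then have "Q.conj_by (K #> z) (Q.conj_by (K #> y) (K #> x)) = K #> x" using y z iff by simp
    then show "Q.conj_by (K #> (z \<otimes> y)) (K #> x) = K #> x"
      using x V y z iff h.hom_closed Q.conj_by_conj_by[of "K #> z" "K #> y" "K #> x"]
        h.hom_mult[of z y] by auto
  qed
qed

lemma cent_mod_normal:
  assumes K: "K \<lhd> G" and V: "V \<lhd> G"
  shows "cent_mod K V \<lhd> G"
proof (rule normal_cjI)
  have Vc: "V \<subseteq> carrier G" using V normal_imp_subgroup subgroup.subset by blast
  show "subgroup (cent_mod K V) G" using cent_mod_subgroup[OF K Vc] .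
  fix g z assume g: "g \<in> carrier G" and z: "z \<in> cent_mod K V"
  then have zc: "z \<in> carrier G" by (simp add: cent_mod_def)
  have "commut (conj_by g z) x \<in> K" if x: "x \<in> V" for x
  proof -
    have xc: "x \<in> carrier G" using x Vc by blast
    have "conj_by (inv g) x \<in> V" using normal_conj_by[OF V] g x by simp
    then have "commut z (conj_by (inv g) x) \<in> K" using z by (simp add: cent_mod_def)
    then have "conj_by g (commut z (conj_by (inv g) x)) \<in> K" using normal_conj_by[OF K g] by blast
    moreover have "conj_by g (commut z (conj_by (inv g) x)) = commut (conj_by g z) x"
      using g zc xc by (simp add: commut_def group_word_simps)
    ultimately show ?thesis by simp
  qed
  then show "conj_by g z \<in> cent_mod K V" using g zc by (simp add: cent_mod_def)
qed

lemma center_mod_nontrivial: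
  assumes p: "prime p" and K: "K \<lhd> G" and P: "subgroup P G" "K \<subseteq> P" "K \<noteq> P" "index P K = p ^ a"
  obtains z where "z \<in> P" "z \<notin> K" "\<And>x. x \<in> P \<Longrightarrow> commut z x \<in> K"
proof -
  have sK: "subgroup K G" using K normal_imp_subgroup by blast
  interpret P: finite_group "G\<lparr>carrier := P\<rparr>" using P subgroup_finite_group by blast
  have KP: "K \<lhd> G\<lparr>carrier := P\<rparr>" using normal_restrict_supergroup K P by blast
  interpret Q: finite_group "G\<lparr>carrier := P\<rparr> Mod K" using P.factor_finite_group[OF KP] .
  have "order (G\<lparr>carrier := P\<rparr> Mod K) = p ^ a" using P.factor_order[OF KP] P(4) by simp
  moreover have "0 < a" using index_1_imp_eq[OF sK P(1,2)] P(3,4) by (cases a) auto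
  ultimately obtain w where w: "w \<in> carrier (G\<lparr>carrier := P\<rparr> Mod K)" "w \<noteq> K"
    "\<And>g. g \<in> carrier (G\<lparr>carrier := P\<rparr> Mod K) \<Longrightarrow>
       g \<otimes>\<^bsub>G\<lparr>carrier := P\<rparr> Mod K\<^esub> w = w \<otimes>\<^bsub>G\<lparr>carrier := P\<rparr> Mod K\<^esub> g"
    using Q.p_group_center_nontrivial[OF p] by (metis one_FactGroup)
  then obtain z where z: "z \<in> P" "w = K #> z" by (auto simp: carrier_FactGroup)
  have "z \<notin> K" using w(2) z sK by (metis coset_join2 sub_carrier)
  moreover have "commut z x \<in> K" if x: "x \<in> P" for x
  proof -
    have "P.commut z x \<in> K"
      using P.commut_mod_iff[OF KP, of z x] w(3)[of "K #> x"] z x P.factor_carrier[of x K] by simp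
    then show ?thesis using commut_consistent[OF P(1) z(1) x] by simp
  qed
  ultimately show thesis using that z by blast
qed

lemma abelian_normal_complement_mod:
  assumes K: "K \<lhd> G" and N: "N \<lhd> G" and KN: "K \<subseteq> N"
    and comm: "\<And>x y. x \<in> N \<Longrightarrow> y \<in> N \<Longrightarrow> commut x y \<in> K"
    and cop: "coprime (index N K) (index (carrier G) N)"
  obtains C where "subgroup C G" "K \<subseteq> C" "C \<inter> N = K" "N <#> C = carrier G"
proof -
  have sK: "subgroup K G" and sN: "subgroup N G" using K N normal_imp_subgroup by auto
  interpret Q: finite_group "G Mod K" using K factor_finite_group by blast
  interpret h: group_hom G "G Mod K" "\<lambda>x. K #> x" using factor_group_hom[OF K] .
  let ?h = "\<lambda>x. K #> x"
  let ?N = "?h ` N"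
  note im = factor_image_subgroup[OF K sN KN]
  have nN: "?N \<lhd> G Mod K"
  proof (rule Q.normal_cjI[OF im(1)])
    fix g x assume "g \<in> carrier (G Mod K)" "x \<in> ?N"
    then obtain g' x' where g': "g' \<in> carrier G" "g = ?h g'" "x' \<in> N" "x = ?h x'"
      by (auto simp: carrier_FactGroup)
    then have "Q.conj_by g x = ?h (conj_by g' x')"
      using factor_conj_by[OF K, of g' x'] sub_carrier[OF sN] by simp
    then show "Q.conj_by g x \<in> ?N" using normal_conj_by[OF N] g' by blast
  qed
  have cN: "x \<otimes>\<^bsub>G Mod K\<^esub> y = y \<otimes>\<^bsub>G Mod K\<^esub> x" if "x \<in> ?N" "y \<in> ?N" for x y
    using that comm commut_mod_iff[OF K] sub_carrier[OF sN] by auto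
  have "index (carrier (G Mod K)) ?N = index (carrier G) N"
  proof (rule Q.index_eqI[OF im(1)])
    show "index (carrier G) N * card ?N = card (carrier (G Mod K))"
      using im(2) factor_order[OF K] index_trans[OF sK sN subgroup_self KN] subgroup.subset[OF sN]
      by (simp add: order_def)
  qed
  then have "coprime (card ?N) (index (carrier (G Mod K)) ?N)" using im(2) cop by simp
  from Q.abelian_normal_complement[OF nN cN this]
  obtain B where B: "subgroup B (G Mod K)" "B \<inter> ?N = {\<one>\<^bsub>G Mod K\<^esub>}"
      "?N <#>\<^bsub>G Mod K\<^esub> B = carrier (G Mod K)" by metis
  define C where "C = {g \<in> carrier G. ?h g \<in> B}"
  note pre = factor_preimage_subgroup[OF K B(1), folded C_def]
  have "C \<inter> N \<subseteq> K"
  proof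
    fix x assume x: "x \<in> C \<inter> N"
    then have "?h x \<in> B \<inter> ?N" by (auto simp: C_def)
    then have "?h x = K" using B by simp
    then show "x \<in> K" using x sK by (metis IntD1 coset_join1 pre(1) sub_carrier subgroup.subset)
  qed
  moreover have "carrier G \<subseteq> N <#> C"
  proof
    fix g assume g: "g \<in> carrier G"
    then have "?h g \<in> ?N <#>\<^bsub>G Mod K\<^esub> B" using B(3) h.hom_closed by simp
    then obtain n b where nb: "n \<in> N" "b \<in> B" "?h g = ?h n \<otimes>\<^bsub>G Mod K\<^esub> b"
      using Q.set_mult_memE by blast
    have nc: "n \<in> carrier G" using nb sub_carrier[OF sN] by blast
    have "?h (inv n \<otimes> g) = b"
      using nb nc g Q.sub_carrier[OF B(1)] h.hom_mult[of "inv n" g] h.hom_inv[of n] h.hom_closed[of n]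
      by (simp del: mult_FactGroup)
    then have "inv n \<otimes> g \<in> C" using nb nc g by (simp add: C_def)
    then show "g \<in> N <#> C"
      using set_mult_memI[of n N "inv n \<otimes> g" C] nb nc g by simp
  qed
  moreover have "N <#> C \<subseteq> carrier G"
    using sN pre(1) by (simp add: setmult_subset_G subgroup.subset)
  ultimately show thesis using pre(1,2) KN by (intro that[of C]) auto
qed

text \<open>Stated for a section \<open>L/K\<close> so that the induction stays inside one group. Take a Sylow
\<open>p\<close>-subgroup \<open>P/K\<close> of \<open>N/K\<close>. By the Frattini argument \<open>L = NM\<close> with \<open>M\<close> the normalizer of \<open>P\<close> in
\<open>L\<close>. If \<open>M\<close> is smaller than \<open>L\<close>, a complement exists in \<open>M\<close>. Otherwise \<open>P\<close> is normal in \<open>L\<close>, and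
the centre \<open>Z/K\<close> of \<open>P/K\<close> gives a nontrivial normal subgroup: first complement \<open>N/Z\<close>, then \<open>Z/K\<close>;
if \<open>Z = N\<close> the abelian case applies.\<close>

theorem schur_zassenhaus_mod:
  assumes "subgroup L G" "K \<lhd> G\<lparr>carrier := L\<rparr>" "N \<lhd> G\<lparr>carrier := L\<rparr>" "K \<subseteq> N"
    and "coprime (index N K) (index L N)"
  shows "\<exists>C. subgroup C G \<and> K \<subseteq> C \<and> C \<subseteq> L \<and> C \<inter> N = K \<and> N <#> C = L"
  using assms
proof (induction "index L K" arbitrary: L K N rule: less_induct)
  case less
  note sL = less.prems(1)
  interpret L: finite_group "G\<lparr>carrier := L\<rparr>" using sL subgroup_finite_group by blast
  have K: "subgroup K G" "K \<subseteq> L" "\<And>g x. g \<in> L \<Longrightarrow> x \<in> K \<Longrightarrow> conj_by g x \<in> K"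
    using less.prems(2) normal_carrier_iff[OF sL] by auto
  have N: "subgroup N G" "N \<subseteq> L" "\<And>g x. g \<in> L \<Longrightarrow> x \<in> N \<Longrightarrow> conj_by g x \<in> N"
    using less.prems(3) normal_carrier_iff[OF sL] by auto
  note KN = less.prems(4)
  have index_less: "index A B < index L K" if "subgroup A G" "subgroup B G" "K \<subseteq> B" "B \<subseteq> A" "A \<subseteq> L"
      "A \<noteq> L \<or> B \<noteq> K" for A B
  proof -
    have "card A \<le> card L" "card K \<le> card B" "A \<noteq> L \<Longrightarrow> card A < card L" "B \<noteq> K \<Longrightarrow> card K < card B"
      using that sub_finite sL by (auto intro: card_mono psubset_card_mono)
    then have le: "card A * card K \<le> card L * card B" "card A * card K < card L * card B"
      using that(6) card_sub_pos[OF sL] card_sub_pos[OF that(2)] card_sub_pos[OF K(1)]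
        card_sub_pos[OF that(1)]
       by (auto intro: mult_mono mult_less_le_imp_less mult_le_less_imp_less)
    have "index A B * (card B * card K) < index L K * (card B * card K)"
      using le(2) index_card[OF that(2,1,4)] index_card[OF K(1) sL K(2)]
      by (metis mult.assoc mult.commute)
    then show ?thesis by simp
  qed
  show ?case
  proof (cases "N = K")
    case True
    have "K <#> L = L" using set_mult_supset(2)[OF K(1) sL] set_mult_least[OF sL K(2)] by blast
    then show ?thesis using True sL K by (intro exI[of _ L]) auto
  next
    case False
    have "index N K \<noteq> 1" using index_1_imp_eq[OF K(1) N(1) KN] False by auto
    then obtain p where p: "prime p" "p dvd index N K" using prime_factor_nat by blast
    define a where "a = multiplicity p (index N K)"
    have idxpos: "0 < index N K" using index_pos[OF K(1) N(1) KN] .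
    have a: "p ^ a dvd index N K" "\<not> p ^ Suc a dvd index N K" "0 < a"
      using idxpos p multiplicity_dvd[of p "index N K"]
        power_dvd_iff_le_multiplicity[of "index N K" p "Suc a"]
        prime_multiplicity_gt_zero_iff[of p "index N K"] prime_gt_1_nat[OF p(1)]
      unfolding a_def by simp_all
    interpret N: finite_group "G\<lparr>carrier := N\<rparr>" using N(1) subgroup_finite_group by blast
    have KNn: "K \<lhd> G\<lparr>carrier := N\<rparr>" using normal_carrier_iff[OF N(1)] K N KN by blast
    obtain P where "subgroup P (G\<lparr>carrier := N\<rparr>)" and P: "K \<subseteq> P" "index P K = p ^ a"
      using N.sylow_mod_exists[OF KNn p(1)] a(1) by auto
    then have sP: "subgroup P G" "P \<subseteq> N" using subgroup_carrier_iff[OF N(1)] by auto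
    have Pc: "P \<subseteq> carrier G" using sP subgroup.subset by blast
    have pP: "\<not> p dvd index N P"
    proof
      assume "p dvd index N P"
      then have "p * p ^ a dvd index N P * index P K" using P by simp
      then show False using a index_trans[OF K(1) sP(1) N(1) P(1) sP(2)] by simp
    qed
    have Lc: "L \<subseteq> carrier G" using sL subgroup.subset by blast
    define M where "M = L \<inter> {l \<in> carrier G. conj_by l ` P = P}"
    have M: "subgroup M G" "M \<subseteq> L"
      unfolding M_def using subgroups_Inter_pair[OF sL set_stabilizer_subgroup[OF Pc]] by auto
    have PM: "P \<subseteq> M"
    proof
      fix x assume x: "x \<in> P"
      then have xc: "x \<in> carrier G" using Pc by blast
      have "conj_by x ` P \<subseteq> P" using x sP by (auto simp: conj_by_def sub_mult sub_inv)
      moreover have "card (conj_by x ` P) = card P"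
        using inj_on_conj_by[OF xc] Pc by (meson card_image inj_on_subset)
      ultimately have "conj_by x ` P = P" using sub_finite[OF sP(1)] by (simp add: card_subset_eq)
      then show "x \<in> M" using x xc sP N by (auto simp: M_def)
    qed
    have frattini: "\<exists>n\<in>N. n \<otimes> l \<in> M" if l: "l \<in> L" for l
    proof -
      have lc: "l \<in> carrier G" using l Lc by blast
      have s1: "subgroup (conj_by l ` P) G" using conj_by_subgroup[OF lc sP(1)] .
      have s2: "conj_by l ` P \<subseteq> N" using N(3)[OF l] sP by blast
      have s3: "K \<subseteq> conj_by l ` P"
      proof
        fix k assume k: "k \<in> K"
        then have "conj_by (inv l) k \<in> P" using K(3)[of "inv l" k] l sL P by (auto simp: sub_inv)
        then show "k \<in> conj_by l ` P" using k lc sub_carrier[OF K(1)] by (force simp: image_iff)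
      qed
      have card_conj_by: "card (conj_by l ` P) = card P"
        using inj_on_conj_by[OF lc] Pc by (meson card_image inj_on_subset)
      then have s4: "index (conj_by l ` P) K = p ^ a" using P by (simp add: index_def)
      obtain n where n: "n \<in> N" "\<And>x. x \<in> conj_by l ` P \<Longrightarrow> N.conj_by n x \<in> P"
        using N.sylow_conj[OF p(1) KNn, of "conj_by l ` P" a P] s1 s2 s3 s4 sP P pP
          subgroup_carrier_iff[OF N(1)] by auto
      have nc: "n \<in> carrier G" using n N sub_carrier by blast
      have "conj_by (n \<otimes> l) x \<in> P" if "x \<in> P" for x
        using n(2)[of "conj_by l x"] conj_by_consistent[OF N(1) n(1)] that Pc nc lc by (auto simp: conj_by_conj_by)
      then have "conj_by (n \<otimes> l) ` P \<subseteq> P" by blast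
      moreover have "card (conj_by (n \<otimes> l) ` P) = card P"
        using inj_on_conj_by[of "n \<otimes> l"] nc lc Pc by (meson card_image inj_on_subset m_closed)
      ultimately have "conj_by (n \<otimes> l) ` P = P" using sub_finite[OF sP(1)] by (simp add: card_subset_eq)
      then have "n \<otimes> l \<in> M" using n(1) l N(2) nc lc sub_mult[OF sL] by (auto simp: M_def)
      then show ?thesis using n(1) by blast
    qed
    have NM: "N <#> M = L"
    proof
      show "N <#> M \<subseteq> L" using set_mult_least[OF sL N(2) M(2)] .
      show "L \<subseteq> N <#> M"
      proof
        fix l assume l: "l \<in> L"
        then obtain n where n: "n \<in> N" "n \<otimes> l \<in> M" using frattini by blast
        then show "l \<in> N <#> M"
          using set_mult_memI[of "inv n" N "n \<otimes> l" M] l Lc N sub_carrier[OF N(1)]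
          by (auto simp: sub_inv)
      qed
    qed
    have NiM: "subgroup (N \<inter> M) G" using subgroups_Inter_pair N M by blast
    show ?thesis
    proof (cases "M = L")
      case False
      have KM: "K \<subseteq> N \<inter> M" using P PM KN by blast
      have 1: "K \<lhd> G\<lparr>carrier := M\<rparr>" "N \<inter> M \<lhd> G\<lparr>carrier := M\<rparr>"
        using normal_carrier_iff[OF M(1)] K N M KM NiM
        by (auto simp: conj_by_def sub_mult sub_inv subset_iff)
      have "index M (N \<inter> M) = index L N"
      proof (rule index_eqI[OF NiM])
        have "index L N * card (N \<inter> M) * card N = card M * card N"
          using card_set_mult[OF N(1) M(1)] NM index_card[OF N(1) sL N(2)]
          by (metis mult.assoc mult.commute)
        then show "index L N * card (N \<inter> M) = card M" using card_sub_pos[OF N(1)] by simp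
      qed
      moreover have "index (N \<inter> M) K dvd index N K"
        using index_trans[OF K(1) NiM N(1) KM] by simp
      ultimately have cop: "coprime (index (N \<inter> M) K) (index M (N \<inter> M))"
        using less.prems(5) by (metis coprime_divisors dvd_refl)
      have "index M K < index L K" using index_less[of M K] M K KM False by blast
      then obtain C where C: "subgroup C G" "K \<subseteq> C" "C \<subseteq> M" "C \<inter> (N \<inter> M) = K" "(N \<inter> M) <#> C = M"
        using less.hyps[OF _ M(1) 1 KM cop] by blast
      have "N <#> C = L"
        using NM C(5) set_mult_assoc[of N "N \<inter> M" C] set_mult_absorb(1)[OF N(1) NiM]
          subgroup.subset[OF N(1)] subgroup.subset[OF NiM] subgroup.subset[OF C(1)] by simp
      then show ?thesis using C M by (intro exI[of _ C]) auto
    next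
      case True
      have Pn: "P \<lhd> G\<lparr>carrier := L\<rparr>"
        using normal_carrier_iff[OF sL] sP N True by (fastforce simp: M_def)
      have "P \<noteq> K"
        using P(2) one_less_power[OF prime_gt_1_nat[OF p(1)] a(3)] index_self[OF K(1)] by auto
      then obtain z where z: "z \<in> P" "z \<notin> K" "\<And>x. x \<in> P \<Longrightarrow> L.commut z x \<in> K"
        using L.center_mod_nontrivial[OF p(1) less.prems(2) normal_imp_subgroup[OF Pn] P(1) _ P(2)]
        by metis
      define Z where "Z = P \<inter> L.cent_mod K P"
      have Zn: "Z \<lhd> G\<lparr>carrier := L\<rparr>"
        unfolding Z_def using L.normal_subgroup_intersect[OF Pn L.cent_mod_normal[OF less.prems(2) Pn]] .
      have Z: "subgroup Z G" "Z \<subseteq> L" "\<And>g x. g \<in> L \<Longrightarrow> x \<in> Z \<Longrightarrow> conj_by g x \<in> Z"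
        using Zn normal_carrier_iff[OF sL] by auto
      have "z \<in> Z" using z sP N by (auto simp: Z_def L.cent_mod_def)
      have KZ: "K \<subseteq> Z"
        using P sP N L.normal_commut(2)[OF less.prems(2)] K by (auto simp: Z_def L.cent_mod_def subset_iff)
      have ZN: "Z \<subseteq> N" using sP by (auto simp: Z_def)
      have "index N K = index N Z * index Z K" using index_trans[OF K(1) Z(1) N(1) KZ ZN] .
      then have cop: "coprime (index N Z) (index L N)" "coprime (index Z K) (index L N)"
        using less.prems(5) by auto
      have "index L Z < index L K" using index_less[of L Z] sL Z KZ z \<open>z \<in> Z\<close> by blast
      then obtain B where B: "subgroup B G" "Z \<subseteq> B" "B \<subseteq> L" "B \<inter> N = Z" "N <#> B = L"
        using less.hyps[OF _ sL Zn less.prems(3) ZN cop(1)] by blast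
      show ?thesis
      proof (cases "N = Z")
        case True
        have "L.commut x y \<in> K" if "x \<in> N" "y \<in> N" for x y
          using that True by (auto simp: Z_def L.cent_mod_def)
        then obtain C where "subgroup C (G\<lparr>carrier := L\<rparr>)" "K \<subseteq> C" "C \<inter> N = K" "N <#> C = L"
          using L.abelian_normal_complement_mod[OF less.prems(2,3) KN] less.prems(5) by auto
        then show ?thesis using subgroup_carrier_iff[OF sL] by blast
      next
        case False
        have BL: "B \<noteq> L" using B(4) N(2) False by blast
        have 1: "K \<lhd> G\<lparr>carrier := B\<rparr>" "Z \<lhd> G\<lparr>carrier := B\<rparr>"
          using normal_carrier_iff[OF B(1)] K Z KZ B by auto
        have "index B Z = index L N"
        proof (rule index_eqI[OF Z(1)])
          have "index L N * card Z * card N = card B * card N"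
            using card_set_mult[OF N(1) B(1)] B index_card[OF N(1) sL N(2)]
            by (metis mult.assoc mult.commute inf_commute)
          then show "index L N * card Z = card B" using card_sub_pos[OF N(1)] by simp
        qed
        then have "coprime (index Z K) (index B Z)" using cop by simp
        moreover have "index B K < index L K" using index_less[of B K] B K KZ BL by blast
        ultimately obtain C where C: "subgroup C G" "K \<subseteq> C" "C \<subseteq> B" "C \<inter> Z = K" "Z <#> C = B"
          using less.hyps[OF _ B(1) 1 KZ] by blast
        have "N <#> C = L"
          using B(5) C(5) set_mult_assoc[of N Z C] set_mult_absorb(1)[OF N(1) Z(1) ZN]
            subgroup.subset[OF N(1)] subgroup.subset[OF Z(1)] subgroup.subset[OF C(1)] by simp
        moreover have "C \<inter> N = K" using C B KN by blast
        ultimately show ?thesis using C B by (intro exI[of _ C]) auto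
      qed
    qed
  qed
qed

end

section \<open>Residuals, Hall subgroups and permutability\<close>

context group
begin

text \<open>\<open>O\<^sup>\<tau>(D)\<close>, the smallest normal subgroup of \<open>D\<close> whose quotient is a \<open>\<tau>\<close>-group. Generation by
\<open>\<tau>'\<close>-elements makes it characteristic in \<open>D\<close> at once; that the quotient is a \<open>\<tau>\<close>-group is shown
below.\<close>

definition tau_residual :: "nat set \<Rightarrow> 'a set \<Rightarrow> 'a set" where
  "tau_residual \<tau> D = generate G {x \<in> D. tau_number (primes_compl \<tau>) (ord x)}"

text \<open>Hall \<open>\<tau>\<close>-subgroups of a subgroup \<open>L\<close>, as subgroups of the ambient group.\<close>

definition Hall :: "nat set \<Rightarrow> 'a set \<Rightarrow> 'a set \<Rightarrow> bool" where
  "Hall \<tau> L H \<longleftrightarrow> subgroup H G \<and> H \<subseteq> L \<and> tau_number \<tau> (card H) \<and>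
     tau_number (primes_compl \<tau>) (index L H)"

text \<open>\<open>\<sigma>\<close>-permutability of \<open>K\<close> in the subgroup \<open>L\<close> for the partition into \<open>\<tau>\<close> and \<open>\<tau>'\<close>.\<close>

definition sigma_perm :: "nat set \<Rightarrow> 'a set \<Rightarrow> 'a set \<Rightarrow> bool" where
  "sigma_perm \<tau> L K \<longleftrightarrow> subgroup K G \<and> K \<subseteq> L \<and>
     (\<exists>E. Hall \<tau> L E) \<and> (\<exists>E. Hall (primes_compl \<tau>) L E) \<and>
     (\<forall>E. Hall \<tau> L E \<or> Hall (primes_compl \<tau>) L E \<longrightarrow> K <#> E = E <#> K)"

lemma Hall_compl_compl [simp]: "Hall (primes_compl (primes_compl \<tau>)) L H = Hall \<tau> L H"
  by (simp add: Hall_def tau_number_compl[symmetric] tau_number_compl_compl)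

lemma sigma_perm_compl: "sigma_perm (primes_compl \<tau>) L K = sigma_perm \<tau> L K"
  by (auto simp: sigma_perm_def)

lemma tau_residual_mem: "x \<in> D \<Longrightarrow> tau_number (primes_compl \<tau>) (ord x) \<Longrightarrow> x \<in> tau_residual \<tau> D"
  by (simp add: tau_residual_def generate.incl)

lemma tau_residual_least:
  assumes "subgroup H G" "\<And>x. x \<in> D \<Longrightarrow> tau_number (primes_compl \<tau>) (ord x) \<Longrightarrow> x \<in> H"
  shows "tau_residual \<tau> D \<subseteq> H"
  unfolding tau_residual_def using assms by (intro generate_subgroup_incl) auto

lemma tau_residual_subset: "subgroup D G \<Longrightarrow> tau_residual \<tau> D \<subseteq> D"
  by (rule tau_residual_least)

lemma tau_residual_subgroup: "subgroup D G \<Longrightarrow> subgroup (tau_residual \<tau> D) G"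
  unfolding tau_residual_def using sub_carrier by (intro generate_is_subgroup) blast

lemma tau_residual_idem:
  assumes "subgroup D G" shows "tau_residual \<tau> (tau_residual \<tau> D) = tau_residual \<tau> D"
  using assms tau_residual_mem tau_residual_subgroup
  by (intro subset_antisym tau_residual_subset tau_residual_least) auto

lemma ord_conj_by_dvd: "g \<in> carrier G \<Longrightarrow> x \<in> carrier G \<Longrightarrow> ord (conj_by g x) dvd ord x"
  by (simp add: pow_eq_id[symmetric] conj_by_pow[symmetric])

lemma tau_residual_normal:
  assumes D: "D \<lhd> G" shows "tau_residual \<tau> D \<lhd> G"
  unfolding tau_residual_def
proof (rule normal_generateI)
  have sD: "subgroup D G" using D normal_imp_subgroup by blast
  show "{x \<in> D. tau_number (primes_compl \<tau>) (ord x)} \<subseteq> carrier G" using sub_carrier[OF sD] by blast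
  fix h g assume "h \<in> {x \<in> D. tau_number (primes_compl \<tau>) (ord x)}" "g \<in> carrier G"
  then show "g \<otimes> h \<otimes> inv g \<in> {x \<in> D. tau_number (primes_compl \<tau>) (ord x)}"
    using normal_conj_by[OF D] ord_conj_by_dvd[of g h] tau_number_dvd sub_carrier[OF sD] unfolding conj_by_def by blast
qed

end

context finite_group
begin

lemma ord_dvd_card: "subgroup H G \<Longrightarrow> x \<in> H \<Longrightarrow> ord x dvd card H"
  using pow_index_mem[OF one_is_normal, of H x] sub_one[of H] sub_carrier[of H x] by (simp add: pow_eq_id)

text \<open>An element of prime order \<open>p \<notin> \<tau>\<close> modulo \<open>O\<^sup>\<tau>(D)\<close> is the product of a \<open>\<tau>'\<close>-element, which lies in
\<open>O\<^sup>\<tau>(D)\<close>, and a \<open>\<tau>\<close>-element, whose order is prime to \<open>p\<close>.\<close>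

lemma tau_residual_index:
  assumes D: "D \<lhd> G" shows "tau_number \<tau> (index D (tau_residual \<tau> D))"
proof (rule ccontr)
  let ?X = "tau_residual \<tau> D"
  have sD: "subgroup D G" using D normal_imp_subgroup by blast
  note X = tau_residual_normal[OF D, of \<tau>] tau_residual_subgroup[OF sD, of \<tau>] tau_residual_subset[OF sD, of \<tau>]
  assume "\<not> tau_number \<tau> (index D ?X)"
  then obtain p where p: "prime p" "p dvd index D ?X" "p \<notin> \<tau>" by (auto simp: tau_number_def)
  interpret D: finite_group "G\<lparr>carrier := D\<rparr>" using subgroup_finite_group[OF sD] .
  have "?X \<lhd> G\<lparr>carrier := D\<rparr>" using normal_restrict_supergroup X sD by blast
  then obtain P where "subgroup P (G\<lparr>carrier := D\<rparr>)" and P: "?X \<subseteq> P" "index P ?X = p"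
    using D.sylow_mod_exists[of ?X p 1] p by auto
  then have sP: "subgroup P G" "P \<subseteq> D" using subgroup_carrier_iff[OF sD] by auto
  have "P \<subseteq> ?X"
  proof
    fix d assume d: "d \<in> P"
    then have dc: "d \<in> carrier G" using sP sub_carrier by blast
    obtain i j :: int where ij: "d = d [^] i \<otimes> d [^] j" "tau_number \<tau> (ord (d [^] i))"
        "tau_number (primes_compl \<tau>) (ord (d [^] j))"
      using tau_parts[OF dc] by blast
    have iP: "d [^] i \<in> P" and "d [^] j \<in> D" using d sP sub_int_pow by auto
    then have j: "d [^] j \<in> ?X" using tau_residual_mem ij(3) by blast
    have "coprime (ord (d [^] i)) p"
      using ij(2) p by (intro tau_number_coprime[of \<tau>])
        (auto simp: tau_number_compl dest: primes_dvd_imp_eq)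
    then have "d [^] i \<in> ?X"
      using coprime_pow_mem[OF X(2), of "d [^] i" "ord (d [^] i)" p] dc
        pow_index_mem[OF X(1) sP(1) P(1) iP] P(2) sub_one[OF X(2)] by simp
    then show "d \<in> ?X" using ij(1) j sub_mult[OF X(2)] by metis
  qed
  then have "P = ?X" using P by blast
  then show False using P(2) index_self[OF X(2)] prime_gt_1_nat[OF p(1)] by simp
qed

lemma factor_pow: "K \<lhd> G \<Longrightarrow> x \<in> carrier G \<Longrightarrow> (K #> x) [^]\<^bsub>G Mod K\<^esub> (n::nat) = K #> (x [^] n)"
  using group_hom.hom_nat_pow[OF factor_group_hom] by fastforce

lemma factor_int_pow: "K \<lhd> G \<Longrightarrow> x \<in> carrier G \<Longrightarrow> (K #> x) [^]\<^bsub>G Mod K\<^esub> (n::int) = K #> (x [^] n)"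
  using group_hom.hom_int_pow[OF factor_group_hom] by fastforce

lemma factor_eq_one:
  "K \<lhd> G \<Longrightarrow> x \<in> carrier G \<Longrightarrow> K #> x = K \<longleftrightarrow> x \<in> K"
  by (metis coset_join1 coset_join2 normal_imp_subgroup subgroup.subset)

text \<open>By Schur-Zassenhaus \<open>D/Y\<close> has a complement \<open>C/Y\<close> in \<open>R/Y\<close>, and it is a direct factor since \<open>R\<close>
centralizes \<open>D/Y\<close>. So \<open>C\<close> contains every \<open>\<tau>'\<close>-element of \<open>R\<close>, hence all of \<open>R\<close>.\<close>

lemma central_tau_section_trivial:
  assumes nor: "Y \<lhd> G" "D \<lhd> G" "R \<lhd> G" and incl: "Y \<subseteq> D" "D \<subseteq> R"
    and tau: "tau_number \<tau> (index D Y)" "tau_number (primes_compl \<tau>) (index R D)"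
    and central: "\<And>r d. r \<in> R \<Longrightarrow> d \<in> D \<Longrightarrow> commut r d \<in> Y"
    and gen: "tau_residual \<tau> R = R"
  shows "D = Y"
proof -
  have sub: "subgroup Y G" "subgroup D G" "subgroup R G" using nor normal_imp_subgroup by auto
  have "Y \<lhd> G\<lparr>carrier := R\<rparr>" "D \<lhd> G\<lparr>carrier := R\<rparr>"
    using nor incl sub normal_restrict_supergroup by auto
  then obtain C where C: "subgroup C G" "Y \<subseteq> C" "C \<subseteq> R" "C \<inter> D = Y" "D <#> C = R"
    using schur_zassenhaus_mod[OF sub(3) _ _ incl(1)] tau_number_coprime[OF tau] by blast
  interpret Q: group "G Mod Y" using nor(1) normal.factorgroup_is_group by blast
  have "index C Y * card D * card Y = index R D * card D * card Y"
    using card_set_mult[OF sub(2) C(1)] C index_card[OF sub(1) C(1,2)] index_card[OF sub(2,3) incl(2)]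
    by (metis inf_commute mult.assoc mult.commute)
  then have idxC: "index C Y = index R D" using card_sub_pos[OF sub(1)] card_sub_pos[OF sub(2)] by simp
  have "x \<in> C" if x: "x \<in> R" "tau_number (primes_compl \<tau>) (ord x)" for x
  proof -
    obtain d c where dc: "d \<in> D" "c \<in> C" "x = d \<otimes> c" using x C(5) set_mult_memE by metis
    have car: "x \<in> carrier G" "d \<in> carrier G" "c \<in> carrier G"
      using dc x sub C(1) sub_carrier by auto
    let ?h = "\<lambda>x. Y #> x"
    let ?n = "ord x * index C Y"
    have hc: "?h d \<in> carrier (G Mod Y)" "?h c \<in> carrier (G Mod Y)" using car factor_carrier by auto
    have "commut c d \<in> Y" using central[of c d] C dc by blast
    then have com: "?h c \<otimes>\<^bsub>G Mod Y\<^esub> ?h d = ?h d \<otimes>\<^bsub>G Mod Y\<^esub> ?h c"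
      using commut_mod_iff[OF nor(1)] car by simp
    have "c [^] index C Y \<in> Y" using pow_index_mem[OF nor(1) C(1,2)] dc by blast
    then have "(c [^] index C Y) [^] ord x \<in> Y" using sub_pow sub by blast
    then have "c [^] ?n \<in> Y" using car by (simp add: nat_pow_pow mult.commute)
    then have c1: "?h c [^]\<^bsub>G Mod Y\<^esub> ?n = Y"
      using factor_pow[OF nor(1) car(3)] factor_eq_one[OF nor(1)] car by simp
    have "x [^] ?n = \<one>" using car by (simp add: nat_pow_pow[symmetric])
    then have "Y = ?h x [^]\<^bsub>G Mod Y\<^esub> ?n"
      using factor_pow[OF nor(1) car(1)] factor_eq_one[OF nor(1) one_closed] sub_one[OF sub(1)]
      by simp
    also have "\<dots> = (?h d \<otimes>\<^bsub>G Mod Y\<^esub> ?h c) [^]\<^bsub>G Mod Y\<^esub> ?n"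
      using factor_mult[OF nor(1) car(2,3)] dc by simp
    also have "\<dots> = ?h d [^]\<^bsub>G Mod Y\<^esub> ?n \<otimes>\<^bsub>G Mod Y\<^esub> ?h c [^]\<^bsub>G Mod Y\<^esub> ?n"
      using Q.pow_mult_distrib[OF com[symmetric] hc] .
    also have "\<dots> = ?h d [^]\<^bsub>G Mod Y\<^esub> ?n"
      using c1 Q.r_one[OF Q.nat_pow_closed[OF hc(1)]] by (simp del: mult_FactGroup)
    finally have "d [^] ?n \<in> Y"
      using factor_pow[OF nor(1) car(2)] factor_eq_one[OF nor(1), of "d [^] ?n"] car by simp
    moreover have "d [^] index D Y \<in> Y" using pow_index_mem[OF nor(1) sub(2) incl(1) dc(1)] .
    moreover have "coprime ?n (index D Y)"
      using x(2) tau idxC tau_number_coprime[of \<tau> "index D Y" ?n] by (simp add: coprime_commute)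
    ultimately have "d \<in> Y" using coprime_pow_mem[OF sub(1) car(2)] by blast
    then show ?thesis using dc C sub_mult by blast
  qed
  then have "R \<subseteq> C" using tau_residual_least[OF C(1), of R \<tau>] gen by simp
  then show ?thesis using C incl by blast
qed

lemma hall_tau_subgroup_iff:
  assumes "subgroup L G"
  shows "hall_tau_subgroup \<tau> (G\<lparr>carrier := L\<rparr>) H \<longleftrightarrow> Hall \<tau> L H"
proof -
  have "card (rcosets\<^bsub>G\<lparr>carrier := L\<rparr>\<^esub> H) = index L H" if "subgroup H G" "H \<subseteq> L"
    using card_rcosets_index that assms by blast
  then show ?thesis
    unfolding hall_tau_subgroup_def Hall_def subgroup_carrier_iff[OF assms] tau_group_def
      tau_number_def order_def
    by (auto simp: primes_compl_def all_primes_def)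
qed

text \<open>If no prime of a block divides the order of \<open>L\<close>, then the trivial subgroup is a Hall subgroup for
this block. Conversely two Hall subgroups, one for each block, form a complete Hall set.\<close>

lemma complete_hall_set_iff:
  assumes L: "subgroup L G"
  shows "(\<exists>\<H>. complete_hall_set (sigma_pi \<tau>) (G\<lparr>carrier := L\<rparr>) \<H>) \<longleftrightarrow>
    (\<exists>E. Hall \<tau> L E) \<and> (\<exists>E. Hall (primes_compl \<tau>) L E)"
proof
  let ?L = "G\<lparr>carrier := L\<rparr>"
  assume "\<exists>\<H>. complete_hall_set (sigma_pi \<tau>) ?L \<H>"
  then obtain \<H> where H: "complete_hall_set (sigma_pi \<tau>) ?L \<H>" by blast
  have "\<exists>E. Hall s L E" if s: "s \<in> sigma_pi \<tau>" for s
  proof (cases "s \<in> sigma_of_group (sigma_pi \<tau>) ?L")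
    case True
    then have "\<exists>!E. E \<in> \<H> \<and> hall_tau_subgroup s ?L E"
      using H unfolding complete_hall_set_def by simp
    then show ?thesis using hall_tau_subgroup_iff[OF L] by auto
  next
    case False
    then have "Hall s L {\<one>}"
      using s triv_subgroup sub_one[OF L]
      by (auto simp: sigma_of_group_def Hall_def tau_number_compl order_def)
    then show ?thesis by blast
  qed
  then show "(\<exists>E. Hall \<tau> L E) \<and> (\<exists>E. Hall (primes_compl \<tau>) L E)" by (simp add: sigma_pi_def)
next
  let ?L = "G\<lparr>carrier := L\<rparr>"
  assume "(\<exists>E. Hall \<tau> L E) \<and> (\<exists>E. Hall (primes_compl \<tau>) L E)"
  then obtain A B where AB: "Hall \<tau> L A" "Hall (primes_compl \<tau>) L B" by blast
  have card: "card L = index L A * card A" "card L = index L B * card B"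
    using AB L index_card by (auto simp: Hall_def)
  have A: "\<not> Hall (primes_compl \<tau>) L A" if "p \<in> primes_compl \<tau>" "prime p" "p dvd card L" for p
    using that AB card prime_dvd_mult_iff[of p "index L A" "card A"]
    by (auto simp: Hall_def tau_number_def primes_compl_def)
  have B: "\<not> Hall \<tau> L B" if "p \<in> \<tau>" "prime p" "p dvd card L" for p
    using that AB card prime_dvd_mult_iff[of p "index L B" "card B"]
    by (auto simp: Hall_def tau_number_def primes_compl_def)
  have "complete_hall_set (sigma_pi \<tau>) ?L {A, B}"
    unfolding complete_hall_set_def hall_tau_subgroup_iff[OF L]
  proof (intro conjI ballI impI)
    fix H assume H: "H \<in> {A, B}"
    then show "subgroup H ?L" using AB by (auto simp: subgroup_carrier_iff[OF L] Hall_def)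
    show "\<exists>s\<in>sigma_pi \<tau>. Hall s L H" using AB H by (auto simp: sigma_pi_def)
  next
    fix s assume s: "s \<in> sigma_of_group (sigma_pi \<tau>) ?L"
    then obtain p where p: "p \<in> s" "prime p" "p dvd card L"
      by (auto simp: sigma_of_group_def order_def)
    have "s = \<tau> \<or> s = primes_compl \<tau>" using s by (auto simp: sigma_of_group_def sigma_pi_def)
    then show "\<exists>!H. H \<in> {A, B} \<and> Hall s L H"
    proof
      assume s: "s = \<tau>"
      then have "\<not> Hall \<tau> L B" using B p by blast
      then show ?thesis using AB s by (intro ex1I[of _ A]) auto
    next
      assume s: "s = primes_compl \<tau>"
      then have "\<not> Hall (primes_compl \<tau>) L A" using A p by blast
      then show ?thesis using AB s by (intro ex1I[of _ B]) auto
    qed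
  qed
  then show "\<exists>\<H>. complete_hall_set (sigma_pi \<tau>) ?L \<H>" by blast
qed

lemma sigma_permutable_iff:
  assumes L: "subgroup L G"
  shows "sigma_permutable (sigma_pi \<tau>) (G\<lparr>carrier := L\<rparr>) K \<longleftrightarrow> sigma_perm \<tau> L K"
  unfolding sigma_permutable_def sigma_perm_def complete_hall_set_iff[OF L] hall_tau_subgroup_iff[OF L]
    subgroup_carrier_iff[OF L]
  by (auto simp: sigma_pi_def)

lemma P_sigma_pi_T_group_iff:
  "P_sigma_pi_T_group \<tau> G \<longleftrightarrow>
    (\<forall>H K. sigma_perm \<tau> (carrier G) H \<and> sigma_perm \<tau> H K \<longrightarrow> sigma_perm \<tau> (carrier G) K)"
proof -
  have "sigma_permutable (sigma_pi \<tau>) G H = sigma_perm \<tau> (carrier G) H" for H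
    using sigma_permutable_iff[OF subgroup_self, of \<tau> H] by simp
  then show ?thesis
    unfolding P_sigma_pi_T_group_def P_sigma_T_group_def
    using sigma_permutable_iff sigma_perm_def by metis
qed

lemma pi_separable_iff:
  "pi_separable \<tau> G \<longleftrightarrow>
    (\<forall>H K. chief_factor G H K \<longrightarrow> tau_number \<tau> (index H K) \<or> tau_number (primes_compl \<tau>) (index H K))"
proof -
  have "order (G\<lparr>carrier := H\<rparr> Mod K) = index H K" if "chief_factor G H K" for H K
  proof -
    have "subgroup K G" "subgroup H G" "K \<subseteq> H"
      using that normal_imp_subgroup by (auto simp: chief_factor_def)
    then show ?thesis using card_rcosets_index by (simp add: order_def FactGroup_def)
  qed
  then show ?thesis by (auto simp: pi_separable_def tau_group_def tau_number_def)
qed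

lemma chief_factor_below:
  assumes "N \<lhd> G" "V \<lhd> G" "N \<subset> V"
  obtains M where "chief_factor G M N" "M \<subseteq> V"
proof -
  let ?S = "{M. M \<lhd> G \<and> N \<subset> M \<and> M \<subseteq> V}"
  have "finite ?S"
    using fin subgroup.subset[OF normal_imp_subgroup[OF assms(2)]]
    by (intro finite_subset[of ?S "Pow (carrier G)"]) auto
  moreover have "?S \<noteq> {}" using assms by blast
  ultimately have "\<exists>M\<in>?S. \<forall>B\<in>?S. B \<subseteq> M \<longrightarrow> M = B" by (rule finite_has_minimal)
  then obtain M where MS: "M \<in> ?S" and minS: "\<forall>B\<in>?S. B \<subseteq> M \<longrightarrow> M = B" by (rule bexE)
  have M: "M \<lhd> G" "N \<subset> M" "M \<subseteq> V" using MS by simp_all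
  have min: "M = B" if "B \<lhd> G" "N \<subset> B" "B \<subseteq> V" "B \<subseteq> M" for B
    using minS that by simp
  have "chief_factor G M N" unfolding chief_factor_def using assms(1) M min by blast
  then show thesis using that M by blast
qed

text \<open>Induction along a chief series from the top: lift a Hall subgroup from \<open>V/M\<close> to \<open>V/N\<close>. If the
chief factor \<open>M/N\<close> is a \<open>\<tau>'\<close>-group, the preimage is replaced by a complement of \<open>M/N\<close> in it.\<close>

lemma hall_mod_exists:
  assumes sep: "pi_separable \<tau> G" and V: "V \<lhd> G" and N: "N \<lhd> G" "N \<subseteq> V"
  shows "\<exists>L. subgroup L G \<and> N \<subseteq> L \<and> L \<subseteq> V \<and> tau_number \<tau> (index L N) \<and>
    tau_number (primes_compl \<tau>) (index V L)"
  using N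
proof (induction "index V N" arbitrary: N rule: less_induct)
  case less
  have sV: "subgroup V G" and sN: "subgroup N G" using V less.prems normal_imp_subgroup by auto
  show ?case
  proof (cases "N = V")
    case True
    then show ?thesis using sV by (intro exI[of _ V]) auto
  next
    case False
    then obtain M where M: "chief_factor G M N" "M \<subseteq> V"
      using chief_factor_below[OF less.prems(1) V] less.prems(2) by blast
    then have Mn: "M \<lhd> G" "N \<subset> M" by (auto simp: chief_factor_def)
    have sM: "subgroup M G" using Mn normal_imp_subgroup by blast
    have pos: "0 < index V M" using index_pos[OF sM sV M(2)] .
    have MN: "index V N = index V M * index M N"
      using index_trans[OF sN sM sV] Mn M by blast
    have "index M N \<noteq> 1" "0 < index M N" using index_1_imp_eq[OF sN sM] index_pos[OF sN sM] Mn by auto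
    then have "index V M < index V N" using MN pos by simp
    then obtain L where L: "subgroup L G" "M \<subseteq> L" "L \<subseteq> V" "tau_number \<tau> (index L M)"
        "tau_number (primes_compl \<tau>) (index V L)"
      using less.hyps[OF _ Mn(1) M(2)] by blast
    show ?thesis
    proof (cases "tau_number \<tau> (index M N)")
      case True
      have "index L N = index L M * index M N" using index_trans[OF sN sM L(1)] Mn L by blast
      then show ?thesis using True L Mn by (intro exI[of _ L]) auto
    next
      case False
      then have t: "tau_number (primes_compl \<tau>) (index M N)"
        using sep M by (auto simp: pi_separable_iff)
      have "N \<lhd> G\<lparr>carrier := L\<rparr>" "M \<lhd> G\<lparr>carrier := L\<rparr>"
        using normal_restrict_supergroup less.prems Mn L by auto
      moreover have "coprime (index M N) (index L M)"
        using tau_number_coprime[OF L(4) t] by (simp add: coprime_commute)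
      ultimately obtain C where C: "subgroup C G" "N \<subseteq> C" "C \<subseteq> L" "C \<inter> M = N" "M <#> C = L"
        using schur_zassenhaus_mod[OF L(1)] Mn by blast
      have "card L * card N = card M * card C" using card_set_mult[OF sM C(1)] C by (simp add: Int_commute)
      then have "index L M * card M * card N = card M * (index C N * card N)"
        using index_card[OF sM L(1,2)] index_card[OF sN C(1,2)] by simp
      then have 1: "index C N = index L M" using card_sub_pos[OF sM] card_sub_pos[OF sN] by simp
      have "index L C * card C * card N = index M N * card N * card C"
        using \<open>card L * card N = card M * card C\<close> index_card[OF C(1) L(1) C(3)] index_card[OF sN sM] Mn
        by auto
      then have "index L C = index M N" using card_sub_pos[OF C(1)] card_sub_pos[OF sN] by simp
      then have "index V C = index V L * index M N" using index_trans[OF C(1) L(1) sV C(3) L(3)] by simp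
      then show ?thesis using 1 C L t by (intro exI[of _ C]) auto
    qed
  qed
qed

lemma hall_exists:
  assumes "pi_separable \<tau> G" "V \<lhd> G"
  obtains E where "Hall \<tau> V E"
proof -
  have "{\<one>} \<subseteq> V" using assms(2) normal_imp_subgroup sub_one by blast
  then show thesis
    using hall_mod_exists[OF assms one_is_normal] that by (auto simp: Hall_def)
qed

lemma pi_separable_compl: "pi_separable (primes_compl \<tau>) G = pi_separable \<tau> G"
  by (auto simp: pi_separable_iff)

lemma P_sigma_pi_T_group_compl: "P_sigma_pi_T_group (primes_compl \<tau>) G = P_sigma_pi_T_group \<tau> G"
  by (simp add: P_sigma_pi_T_group_iff sigma_perm_compl)

end

section \<open>Coprime power automorphisms\<close>

text \<open>An automorphism \<open>x \<mapsto> x\<^sup>t\<close> of a cyclic \<open>p\<close>-group with \<open>t\<close> congruent to 1 modulo \<open>p\<close> has \<open>p\<close>-power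
order. Numerically: the second factor of \<open>t\<^sup>n - 1 = (t - 1)(1 + t + \<dots> + t\<^sup>n\<^sup>-\<^sup>1)\<close> is congruent to
\<open>n\<close> modulo \<open>p\<close>.\<close>

lemma prime_power_dvd_exponent_diff:
  fixes t :: int
  assumes p: "prime p" and n: "\<not> p dvd n" and t: "int p dvd t - 1" and o: "int (p ^ a) dvd t ^ n - 1"
  shows "int (p ^ a) dvd t - 1"
proof -
  let ?s = "\<Sum>i<n. t ^ i"
  have "?s - int n = (\<Sum>i<n. t ^ i - 1)" by (simp add: sum_subtractf)
  moreover have "int p dvd t ^ i - 1" for i
    using t power_diff_1_eq[of t i] by (metis dvd_mult2)
  ultimately have "int p dvd ?s - int n" by (simp add: dvd_sum)
  then have "\<not> int p dvd ?s" using n by (metis dvd_diff_commute dvd_diff_right_iff int_dvd_int_iff)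
  then have "coprime (int (p ^ a)) ?s"
    using p prime_imp_coprime[of "int p" ?s] by simp
  moreover have "t ^ n - 1 = (t - 1) * ?s" by (rule power_diff_1_eq)
  ultimately show ?thesis using o by (simp add: coprime_dvd_mult_left_iff)
qed

context group
begin

definition powers_act :: "'a \<Rightarrow> 'a set \<Rightarrow> bool" where
  "powers_act k V \<longleftrightarrow> k \<in> carrier G \<and> (\<forall>v\<in>V. \<exists>t::int. conj_by k v = v [^] t)"

lemma powers_actD:
  assumes "powers_act k V" "v \<in> V" obtains t :: int where "conj_by k v = v [^] t"
  using assms unfolding powers_act_def by blast

lemma pow_transpose:
  assumes eq: "x [^] (a::int) \<otimes> y [^] (b::int) = x [^] (c::int) \<otimes> y [^] (d::int)"
    and xy: "x \<in> carrier G" "y \<in> carrier G"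
  shows "x [^] (a - c) = y [^] (d - b)"
proof -
  have "inv (x [^] c) \<otimes> x [^] a \<otimes> y [^] b = y [^] d"
    using xy by (simp add: m_assoc eq)
  then have "inv (x [^] c) \<otimes> x [^] a = y [^] d \<otimes> inv (y [^] b)"
    using xy by (simp add: inv_solve_right)
  moreover have "x [^] (a - c) = inv (x [^] c) \<otimes> x [^] a"
    using xy int_pow_mult[of x "- c" a] by (simp add: int_pow_neg)
  ultimately show ?thesis using xy by (simp add: int_pow_diff)
qed

lemma conj_by_pow_iterate:
  assumes "k \<in> carrier G" "z \<in> carrier G" "conj_by k z = z [^] (t::int)"
  shows "conj_by (k [^] (n::nat)) z = z [^] (t ^ n)"
proof (induction n)
  case (Suc n)
  have "conj_by (k [^] Suc n) z = conj_by (k [^] n) (conj_by k z)" using assms by (simp add: conj_by_conj_by[symmetric])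
  also have "\<dots> = conj_by (k [^] n) z [^] t" using assms by (simp add: conj_by_int_pow)
  finally show ?case using Suc assms by (simp add: int_pow_pow mult.commute)
qed (use assms in simp)

lemma conj_by_eq_of_commute:
  "g \<in> carrier G \<Longrightarrow> x \<in> carrier G \<Longrightarrow> g \<otimes> x = x \<otimes> g \<Longrightarrow> conj_by g x = x"
  by (simp add: conj_by_eq_iff_commute)

end

context finite_group
begin

lemma prime_power_ord:
  assumes "prime p" "z \<in> carrier G" "z [^] (p ^ b :: nat) = \<one>"
  obtains a where "ord z = p ^ a"
  using assms pow_eq_id[of z "p ^ b"] divides_primepow_nat[of p "ord z" b] by auto

lemma moved_exponent:
  assumes V: "subgroup V G" and k: "powers_act k V" and n: "k [^] (n::nat) = \<one>" "coprime n (card V)"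
    and p: "prime p" and z: "z \<in> V" "z [^] (p ^ b :: nat) = \<one>" "conj_by k z \<noteq> z"
  obtains t :: int where "conj_by k z = z [^] t" "\<not> int p dvd t - 1"
proof -
  obtain t :: int where t: "conj_by k z = z [^] t" using powers_actD[OF k z(1)] .
  have zc: "z \<in> carrier G" and kc: "k \<in> carrier G"
    using z V k sub_carrier by (auto simp: powers_act_def)
  obtain a where a: "ord z = p ^ a" using prime_power_ord[OF p zc z(2)] .
  have "z \<noteq> \<one>" using z kc by auto
  then have "p dvd ord z" using a ord_eq_1[OF zc] by (cases a) auto
  then have "p dvd card V" using ord_dvd_card[OF V z(1)] by (rule dvd_trans)
  then have pn: "\<not> p dvd n" using n(2) p by (metis coprime_common_divisor not_prime_unit)
  have "\<not> int p dvd t - 1"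
  proof
    assume pt: "int p dvd t - 1"
    have "z [^] (t ^ n) = z [^] (1::int)" using conj_by_pow_iterate[OF kc zc t, of n] n zc by simp
    then have "int (p ^ a) dvd 1 - t ^ n" using int_pow_eq[OF zc] a by metis
    then have "int (p ^ a) dvd t ^ n - 1" by (simp only: dvd_diff_commute)
    then have "int (p ^ a) dvd t - 1" using prime_power_dvd_exponent_diff[OF p pn pt] by blast
    then have "z [^] (1::int) = z [^] t" using int_pow_eq[OF zc] a by metis
    then show False using z t zc by simp
  qed
  then show thesis using that t by blast
qed

text \<open>Put \<open>d = [k\<^sup>-\<^sup>1, z\<^sup>-\<^sup>1]\<close>. It is a power of \<open>z\<close> with exponent prime to \<open>p\<close>, so it generates \<open>\<langle>z\<rangle>\<close>.
Since \<open>k\<close> normalizes all cyclic subgroups of \<open>V\<close>, so does \<open>d\<close>, and therefore \<open>z\<close>. Now \<open>k\<close> and \<open>z\<close>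
both normalize \<open>\<langle>y\<rangle>\<close>, whose automorphism group is abelian, so their commutator \<open>d\<close> centralizes
\<open>y\<close>.\<close>

lemma moved_central:
  assumes V: "subgroup V G" and k: "powers_act k V" "powers_act (inv k) V"
    and n: "k [^] (n::nat) = \<one>" "coprime n (card V)"
    and p: "prime p" and z: "z \<in> V" "z [^] (p ^ b :: nat) = \<one>" "conj_by k z \<noteq> z"
    and y: "y \<in> V"
  shows "z \<otimes> y = y \<otimes> z"
proof -
  have c: "z \<in> carrier G" "k \<in> carrier G" "y \<in> carrier G"
    using z y V k sub_carrier by (auto simp: powers_act_def)
  have "conj_by (inv k) z \<noteq> z" using z(3) c by (metis conj_by_inv_cancel(2))
  moreover have "inv k [^] n = \<one>" using n c by (simp add: nat_pow_inv)
  ultimately obtain t :: int where t: "conj_by (inv k) z = z [^] t" "\<not> int p dvd t - 1"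
    using moved_exponent[OF V k(2) _ n(2) p z(1,2)] by blast
  define d where "d = inv k \<otimes> inv z \<otimes> k \<otimes> z"
  have dc: "d \<in> carrier G" using c by (simp add: d_def)
  have "d = inv (conj_by (inv k) z) \<otimes> z" using c by (simp add: d_def group_word_simps)
  also have "\<dots> = z [^] (1 - t)" using t c
    by (metis int_pow_1 int_pow_closed int_pow_diff int_pow_mult int_pow_neg add.commute uminus_add_conv_diff)
  finally have d: "d = z [^] (1 - t)" .
  obtain a where a: "ord z = p ^ a" using prime_power_ord[OF p c(1) z(2)] .
  have "coprime (int p) (1 - t)"
    using t(2) p prime_imp_coprime[of "int p" "1 - t"] by (simp add: dvd_diff_commute)
  then have "coprime (int (p ^ a)) (1 - t)" by simp
  then obtain u v where "u * int (p ^ a) + v * (1 - t) = 1"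
    by (metis bezout_int coprime_imp_gcd_eq_1)
  then have "v * (1 - t) = 1 - u * int (p ^ a)" by simp
  moreover have "z [^] (1 - u * int (p ^ a)) = z [^] (1::int)"
    using int_pow_eq[OF c(1)] a by auto
  ultimately have zv: "z = d [^] v" using d c by (simp add: int_pow_pow mult.commute)
  have "\<exists>e::int. conj_by d x = x [^] e" if x: "x \<in> V" for x
  proof -
    have xc: "x \<in> carrier G" using x V sub_carrier by blast
    define w where "w = conj_by z x"
    have w: "w \<in> V" "w \<in> carrier G" using x z V c xc by (auto simp: w_def conj_by_def sub_mult sub_inv)
    obtain e where e: "conj_by k w = w [^] (e::int)" using powers_actD[OF k(1) w(1)] .
    obtain f where f: "conj_by (inv k) x = x [^] (f::int)" using powers_actD[OF k(2) x] .
    have "conj_by d x = conj_by (inv k) (conj_by (inv z) (conj_by k w))" using c xc by (simp add: d_def w_def conj_by_conj_by m_assoc)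
    also have "\<dots> = conj_by (inv k) (conj_by (inv z) w [^] e)" using e c w by (simp add: conj_by_int_pow)
    also have "\<dots> = x [^] (f * e)" using f c xc by (simp add: w_def conj_by_int_pow int_pow_pow)
    finally show ?thesis by blast
  qed
  then have dact: "powers_act d V" using dc by (simp add: powers_act_def)
  have "z [^] (1 - t) \<in> V" using z V sub_int_pow by blast
  obtain q :: nat where q: "z = d [^] q"
  proof -
    have pos: "0 < ord d" using ord_ge_1[OF fin dc] by simp
    have "d [^] v = d [^] (v mod int (ord d))"
      using int_pow_eq[OF dc] by (metis dvd_minus_mod minus_diff_eq dvd_minus_iff)
    also have "\<dots> = d [^] nat (v mod int (ord d))"
      using pos by (simp add: int_pow_int[symmetric])
    finally show thesis using that zv by blast
  qed
  have "\<exists>e::int. conj_by (d [^] i) y = y [^] e" for i :: nat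
    using powers_actD[OF dact y] conj_by_pow_iterate[OF dc c(3)] by metis
  then obtain e where e: "conj_by z y = y [^] (e::int)" using q by metis
  obtain f where f: "conj_by k y = y [^] (f::int)" using powers_actD[OF k(1) y] .
  have "conj_by (k \<otimes> z) y = conj_by (z \<otimes> k) y"
    using e f c by (simp add: conj_by_conj_by[symmetric] conj_by_int_pow int_pow_pow mult.commute)
  then have "conj_by (inv (z \<otimes> k)) (conj_by (k \<otimes> z) y) = y" using c by simp
  moreover have "inv (z \<otimes> k) \<otimes> (k \<otimes> z) = d" using c by (simp add: d_def group_word_simps)
  ultimately have "conj_by d y = y" using c by (simp add: conj_by_conj_by)
  then have "d \<otimes> y = y \<otimes> d" using c dc by (simp add: conj_by_eq_iff_commute)
  then have "d [^] q \<otimes> y = y \<otimes> d [^] q" using group_commutes_pow[OF _ dc c(3)] by blast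
  then show ?thesis using q by simp
qed

text \<open>Suppose that \<open>k\<close> fixes \<open>y\<close> and maps \<open>z\<close> to \<open>z\<^sup>t\<close>. As \<open>y\<close> and \<open>z\<close> commute, \<open>k\<close> maps \<open>zy\<close> to some
\<open>(zy)\<^sup>e\<close>, whence \<open>z\<^sup>t\<^sup>-\<^sup>e = y\<^sup>e\<^sup>-\<^sup>1\<close>. This is a power of \<open>z\<close> fixed by \<open>k\<close>, so it is trivial and
\<open>p\<close> divides both \<open>t - e\<close> and \<open>e - 1\<close>.\<close>

lemma moved_all:
  assumes V: "subgroup V G" and k: "powers_act k V" "powers_act (inv k) V"
    and n: "k [^] (n::nat) = \<one>" "coprime n (card V)"
    and p: "prime p" and z: "z \<in> V" "z [^] (p ^ b :: nat) = \<one>" "conj_by k z \<noteq> z"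
    and y: "y \<in> V" "y [^] (p ^ c :: nat) = \<one>" "y \<noteq> \<one>"
  shows "conj_by k y \<noteq> y"
proof
  assume fix_y: "conj_by k y = y"
  have c: "z \<in> carrier G" "k \<in> carrier G" "y \<in> carrier G"
    using z y V k sub_carrier by (auto simp: powers_act_def)
  have com: "z \<otimes> y = y \<otimes> z" using moved_central[OF V k n p z y(1)] .
  obtain t :: int where t: "conj_by k z = z [^] t" "\<not> int p dvd t - 1"
    using moved_exponent[OF V k(1) n p z] .
  obtain e :: int where e: "conj_by k (z \<otimes> y) = (z \<otimes> y) [^] e"
    using powers_actD[OF k(1) sub_mult[OF V z(1) y(1)]] .
  obtain a a' where a: "ord z = p ^ a" "ord y = p ^ a'"
    using prime_power_ord[OF p c(1) z(2)] prime_power_ord[OF p c(3) y(2)] by metis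
  have "z [^] t \<otimes> y = z [^] e \<otimes> y [^] e"
    using e t(1) fix_y c by (simp add: conj_by_mult int_pow_mult_distrib[OF com])
  then have eq: "z [^] (t - e) = y [^] (e - 1)"
    using c pow_transpose[of z t y 1 e e] by simp
  define g where "g = y [^] (e - 1)"
  have gc: "g \<in> carrier G" using c by (simp add: g_def)
  have "conj_by k g = g" using fix_y c by (simp add: g_def conj_by_int_pow)
  moreover have "conj_by k g = g [^] t"
    using t(1) c unfolding g_def eq[symmetric] by (simp add: conj_by_int_pow int_pow_pow mult.commute)
  ultimately have "g [^] t = g [^] (1::int)" using gc by simp
  then have dv: "int (ord g) dvd t - 1" using int_pow_eq[OF gc] by (metis dvd_diff_commute)
  have "g [^] (p ^ a') = \<one>"
    using a(2) c by (simp add: g_def int_pow_int[symmetric] int_pow_pow int_pow_eq_id)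
  then obtain a'' where a'': "ord g = p ^ a''" using prime_power_ord[OF p gc] by blast
  have "a'' = 0" using dv t(2) a'' by (cases a'') (auto dest: dvd_mult_left)
  then have g1: "g = \<one>" using a'' ord_eq_1[OF gc] by simp
  have "z \<noteq> \<one>" using z c by auto
  then have pz: "p dvd ord z" using a(1) ord_eq_1[OF c(1)] by (cases a) auto
  have py: "p dvd ord y" using a(2) ord_eq_1[OF c(3)] y(3) by (cases a') auto
  have y1: "y [^] (e - 1) = \<one>" using g1 by (simp add: g_def)
  then have "int (ord z) dvd t - e" using eq int_pow_eq_id[OF c(1)] by metis
  then have 1: "int p dvd t - e" using pz by (meson dvd_trans int_dvd_int_iff)
  have "int (ord y) dvd e - 1" using y1 int_pow_eq_id[OF c(3)] by metis
  then have 2: "int p dvd e - 1" using py by (meson dvd_trans int_dvd_int_iff)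
  have "int p dvd (t - e) + (e - 1)" using 1 2 by (rule dvd_add)
  then show False using t(2) by simp
qed

text \<open>On the powers of \<open>x\<close> the exponent is that of \<open>x\<close>. If \<open>y\<close> is not a power of \<open>x\<close>, then the
exponents of \<open>x\<close> and \<open>y\<close> both agree with that of \<open>xy\<close>.\<close>

lemma uniform_exponent:
  assumes V: "subgroup V G" and comm: "\<And>x y. x \<in> V \<Longrightarrow> y \<in> V \<Longrightarrow> x \<otimes> y = y \<otimes> x"
    and p: "prime (p::nat)" and el: "\<And>x. x \<in> V \<Longrightarrow> x [^] p = \<one>"
    and k: "powers_act k V"
  obtains t :: int where "\<And>v. v \<in> V \<Longrightarrow> conj_by k v = v [^] t"
proof (cases "V = {\<one>}")
  case True
  then show thesis using that[of 1] k by (simp add: powers_act_def)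
next
  case False
  then obtain x where x: "x \<in> V" "x \<noteq> \<one>" using sub_one[OF V] by blast
  have kc: "k \<in> carrier G" using k by (simp add: powers_act_def)
  obtain t :: int where t: "conj_by k x = x [^] t" using powers_actD[OF k x(1)] .
  have xc: "x \<in> carrier G" using x V sub_carrier by blast
  have ordp: "ord v dvd p" if "v \<in> V" for v
    using el[OF that] pow_eq_id that V sub_carrier by metis
  have "ord x = p" using ordp[OF x(1)] x(2) p xc ord_eq_1 by (metis prime_nat_iff)
  have "conj_by k y = y [^] t" if y: "y \<in> V" for y
  proof -
    have yc: "y \<in> carrier G" using y V sub_carrier by blast
    obtain b :: int where b: "conj_by k y = y [^] b" using powers_actD[OF k y] .
    obtain e :: int where e: "conj_by k (x \<otimes> y) = (x \<otimes> y) [^] e"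
      using powers_actD[OF k sub_mult[OF V x(1) y]] .
    have eq0: "x [^] t \<otimes> y [^] b = x [^] e \<otimes> y [^] e"
      using e t b xc yc kc by (simp add: conj_by_mult int_pow_mult_distrib[OF comm[OF x(1) y]])
    have eq: "x [^] (t - e) = y [^] (e - b)"
      using eq0 xc yc by (rule pow_transpose)
    show ?thesis
    proof (cases "int p dvd e - b")
      case True
      then have "int (ord y) dvd e - b" using ordp[OF y] by (meson dvd_trans int_dvd_int_iff)
      then have yb: "y [^] b = y [^] e" using int_pow_eq[OF yc] by blast
      have "x [^] (t - e) = \<one>"
        using eq \<open>int (ord y) dvd e - b\<close> int_pow_eq_id[OF yc] by simp
      then have "int p dvd t - e" using int_pow_eq_id[OF xc] \<open>ord x = p\<close> by simp
      then have "int (ord y) dvd t - e" using ordp[OF y] by (meson dvd_trans int_dvd_int_iff)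
      then have "y [^] e = y [^] t" using int_pow_eq[OF yc] by blast
      then show ?thesis using b yb by simp
    next
      case False
      then have "coprime (int p) (e - b)" using p by (intro prime_imp_coprime) auto
      then obtain u v where uv: "u * int p + v * (e - b) = 1" by (metis bezout_int coprime_imp_gcd_eq_1)
      have "y [^] (1::int) = y [^] ((e - b) * v)"
        using int_pow_eq[OF yc] uv ordp[OF y]
        by (metis add_diff_cancel_right' dvd_diff_commute dvd_trans dvd_triv_right int_dvd_int_iff mult.commute)
      then have "y = (x [^] (t - e)) [^] v" using eq yc by (simp add: int_pow_pow)
      then have "y = x [^] ((t - e) * v)" using xc by (simp add: int_pow_pow)
      then show ?thesis using t xc kc by (metis conj_by_int_pow int_pow_pow mult.commute)
    qed
  qed
  then show thesis using that by blast
qed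

end

section \<open>Power automorphisms on the sections of a permutability-transitive group\<close>

context group
begin

lemma tau_residual_compl_compl [simp]: "tau_residual (primes_compl (primes_compl \<tau>)) D = tau_residual \<tau> D"
proof -
  have "{x \<in> D. tau_number (primes_compl (primes_compl (primes_compl \<tau>))) (ord x)} =
    {x \<in> D. tau_number (primes_compl \<tau>) (ord x)}" by simp
  then show ?thesis unfolding tau_residual_def by argo
qed

lemma coprime_int_pow_mem:
  assumes H: "subgroup H G" and x: "x \<in> carrier G"
    and "x [^] (m::int) \<in> H" "x [^] (n::int) \<in> H" "coprime m n"
  shows "x \<in> H"
proof -
  obtain u v where uv: "u * m + v * n = 1"
    using assms(5) by (metis bezout_int coprime_imp_gcd_eq_1)
  have "x = x [^] (m * u + n * v)" using uv x by (simp add: mult.commute)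
  also have "\<dots> = (x [^] m) [^] u \<otimes> (x [^] n) [^] v"
    using x by (simp add: int_pow_mult int_pow_pow[symmetric])
  also have "\<dots> \<in> H" using assms by (simp add: sub_int_pow sub_mult)
  finally show ?thesis .
qed

end

context finite_group
begin

text \<open>If \<open>x\<^sup>n\<close> lies in \<open>H\<close> and \<open>p\<close> divides \<open>n\<close>, then \<open>x\<^sup>c\<close> with \<open>c\<close> the \<open>p'\<close>-part of the order of \<open>x\<close>
also lies in \<open>H\<close>, so \<open>n\<close> can be replaced by the smaller number \<open>gcd n c\<close>.\<close>

lemma prime_power_elements_generate:
  assumes H: "subgroup H G" and A: "subgroup A G"
    and pp: "\<And>y p b. y \<in> A \<Longrightarrow> prime p \<Longrightarrow> y [^] (p ^ b :: nat) = \<one> \<Longrightarrow> y \<in> H"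
  shows "A \<subseteq> H"
proof
  fix x assume x: "x \<in> A"
  then have xc: "x \<in> carrier G" using A sub_carrier by blast
  have pos: "0 < ord x" using ord_ge_1[OF fin xc] by simp
  have "x \<in> H" if "x [^] n \<in> H" "0 < n" for n :: nat
    using that
  proof (induction n rule: less_induct)
    case (less n)
    show ?case
    proof (cases "n = 1")
      case True
      then show ?thesis using less.prems xc by simp
    next
      case False
      then obtain p where p: "prime p" "p dvd n" using prime_factor_nat by blast
      have "ord x \<noteq> 0" "\<not> is_unit p" using pos p by auto
      then obtain c where c: "ord x = p ^ multiplicity p (ord x) * c" "\<not> p dvd c"
        by (rule multiplicity_decompose')
      have "(x [^] c) [^] (p ^ multiplicity p (ord x)) = \<one>"
        using c xc by (metis mult.commute nat_pow_pow pow_ord_eq_1)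
      then have "x [^] c \<in> H" using pp[of "x [^] c"] p sub_pow[OF A x] by blast
      then have "x [^] gcd n c \<in> H"
      proof -
        obtain u v where uv: "u * int n + v * int c = gcd (int n) (int c)" using bezout_int by blast
        have "x [^] gcd n c = x [^] (int n * u + int c * v)"
          using uv by (simp add: int_pow_int[symmetric] mult.commute)
        also have "\<dots> = (x [^] n) [^] u \<otimes> (x [^] c) [^] v"
          using xc by (simp add: int_pow_mult int_pow_pow[symmetric] int_pow_int)
        finally show ?thesis
          using less.prems(1) \<open>x [^] c \<in> H\<close> by (simp add: sub_int_pow[OF H] sub_mult[OF H])
      qed
      moreover have "gcd n c < n"
      proof -
        have "gcd n c \<noteq> n"
        proof
          assume "gcd n c = n"
          then have "n dvd c" by (metis gcd_dvd2)
          then show False using p(2) c(2) dvd_trans by blast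
        qed
        then show ?thesis using gcd_le1_nat[of n c] less.prems(2) by linarith
      qed
      moreover have "0 < gcd n c" using less.prems(2) by simp
      ultimately show ?thesis using less.IH by blast
    qed
  qed
  from this[of "ord x"] show "x \<in> H" using xc pos sub_one[OF H] by simp
qed

lemma index_set_mult_dvd:
  assumes "subgroup A G" "subgroup B G" "subgroup (A <#> B) G"
  shows "index (A <#> B) A dvd card B"
proof -
  have AB: "A \<subseteq> A <#> B" using set_mult_supset assms by blast
  have "index (A <#> B) A * card (A \<inter> B) * card A = card B * card A"
    using card_set_mult[OF assms(1,2)] index_card[OF assms(1,3) AB]
    by (metis mult.assoc mult.commute)
  then have "index (A <#> B) A * card (A \<inter> B) = card B" using card_sub_pos[OF assms(1)] by simp
  then show ?thesis by (metis dvd_triv_left)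
qed

lemma index_Int_dvd:
  assumes N: "N \<lhd> G" and AB: "subgroup A G" "subgroup B G" "A \<subseteq> B" "N \<subseteq> B"
  shows "index A (A \<inter> N) dvd index B N"
proof -
  have sN: "subgroup N G" using N normal_imp_subgroup by blast
  have i: "subgroup (A \<inter> N) G" using subgroups_Inter_pair AB sN by blast
  have NA: "subgroup (N <#> A) G" using subgroup_set_mult_normal[OF N AB(1)] by blast
  have incl: "N \<subseteq> N <#> A" "N <#> A \<subseteq> B"
    using set_mult_supset[OF sN AB(1)] set_mult_least AB by auto
  have "index (N <#> A) N * card N * card (A \<inter> N) = card N * (index A (A \<inter> N) * card (A \<inter> N))"
    using card_set_mult[OF sN AB(1)] index_card[OF sN NA incl(1)] index_card[OF i AB(1)]
    by (simp add: Int_commute)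
  then have "index (N <#> A) N = index A (A \<inter> N)" using card_sub_pos[OF sN] card_sub_pos[OF i] by simp
  then show ?thesis using index_trans[OF sN NA AB(2) incl] by simp
qed

lemma Hall_conj_by:
  assumes L: "subgroup L G" and H: "Hall \<tau> L H" and g: "g \<in> L"
  shows "Hall \<tau> L (conj_by g ` H)"
proof -
  have gc: "g \<in> carrier G" using g L sub_carrier by blast
  have sH: "subgroup H G" "H \<subseteq> L" using H by (auto simp: Hall_def)
  then have "card (conj_by g ` H) = card H"
    using inj_on_conj_by[OF gc] subgroup.subset by (meson card_image inj_on_subset)
  moreover have "conj_by g ` H \<subseteq> L" using sH g L by (auto simp: conj_by_def sub_mult sub_inv)
  ultimately show ?thesis using H conj_by_subgroup[OF gc sH(1)] by (simp add: Hall_def index_def)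
qed

lemma tau_elt_of_card:
  "subgroup H G \<Longrightarrow> x \<in> H \<Longrightarrow> tau_number \<tau> (card H) \<Longrightarrow> tau_number \<tau> (ord x)"
  using ord_dvd_card tau_number_dvd by blast

text \<open>The Hall \<open>\<tau>'\<close>-subgroups generate a normal subgroup of \<open>\<tau>\<close>-index, which contains every
\<open>\<tau>'\<close>-element.\<close>

lemma tau_residual_le_of_Hall:
  assumes ex: "Hall (primes_compl \<tau>) (carrier G) E0"
    and K: "K \<subseteq> carrier G"
    and nrm: "\<And>E e. Hall (primes_compl \<tau>) (carrier G) E \<Longrightarrow> e \<in> E \<Longrightarrow> conj_by e ` K = K"
    and r: "r \<in> tau_residual \<tau> (carrier G)"
  shows "conj_by r ` K = K"
proof -
  let ?U = "\<Union>{E. Hall (primes_compl \<tau>) (carrier G) E}"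
  let ?T = "generate G ?U"
  have U: "?U \<subseteq> carrier G" by (auto simp: Hall_def)
  have T: "?T \<lhd> G"
  proof (rule normal_generateI[OF U])
    fix h g assume "h \<in> ?U" "g \<in> carrier G"
    then have "conj_by g h \<in> ?U" using Hall_conj_by[OF subgroup_self] by blast
    then show "g \<otimes> h \<otimes> inv g \<in> ?U" by (simp add: conj_by_def)
  qed
  then have sT: "subgroup ?T G" using normal_imp_subgroup by blast
  have "E0 \<subseteq> ?T" using ex generate.incl[of _ ?U G] by blast
  then have "index (carrier G) E0 = index (carrier G) ?T * index ?T E0"
    using ex sT subgroup_self subgroup.subset[OF sT] by (intro index_trans) (auto simp: Hall_def)
  then have ti: "tau_number \<tau> (index (carrier G) ?T)" using ex by (simp add: Hall_def)
  have "tau_residual \<tau> (carrier G) \<subseteq> ?T"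
  proof (rule tau_residual_least[OF sT])
    fix x assume x: "x \<in> carrier G" "tau_number (primes_compl \<tau>) (ord x)"
    show "x \<in> ?T"
      using tau_elt_mem[OF T subgroup_self subgroup.subset[OF sT] x(1) _ x(2)] ti x(1)
        sub_one[OF sT] by simp
  qed
  moreover have "?T \<subseteq> {g \<in> carrier G. conj_by g ` K = K}"
    using nrm U by (intro generate_subgroup_incl[OF _ set_stabilizer_subgroup[OF K]]) blast
  ultimately show ?thesis using r by blast
qed

context
  fixes \<tau>
  assumes sep: "pi_separable \<tau> G" and pst: "P_sigma_pi_T_group \<tau> G"
begin

text \<open>A Hall subgroup of \<open>V\<close> either covers \<open>V/N\<close> or lies in \<open>N\<close>; in both cases it permutes with \<open>K\<close>. So
\<open>K\<close> is \<open>\<sigma>\<close>-permutable in the normal subgroup \<open>V\<close>, hence in \<open>G\<close>, and \<open>KE\<close> is a subgroup. The index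
of \<open>K\<close> in \<open>KE\<close> is a \<open>\<tau>'\<close>-number, so \<open>V \<inter> KE = K\<close>, and \<open>E\<close> normalizes this intersection.\<close>

lemma Hall_normalizes_section:
  assumes V: "V \<lhd> G" and N: "N \<lhd> G" and tau: "tau_number \<tau> (index V N)"
    and K: "subgroup K G" "N \<subseteq> K" "K \<subseteq> V"
    and E: "Hall (primes_compl \<tau>) (carrier G) E" "e \<in> E"
  shows "conj_by e ` K = K"
proof -
  have sV: "subgroup V G" and sN: "subgroup N G" and sE: "subgroup E G"
    using V N E normal_imp_subgroup by (auto simp: Hall_def)
  have sep_compl: "pi_separable (primes_compl \<tau>) G" using sep pi_separable_compl by simp
  have NV: "N \<subseteq> V" using K by blast
  have "sigma_perm \<tau> (carrier G) V"
    unfolding sigma_perm_def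
    using hall_exists[OF sep normal_self] hall_exists[OF sep_compl normal_self] sV
      subgroup_set_mult_normal(2)[OF V] by (metis Hall_def subgroup.subset)
  moreover have "sigma_perm \<tau> V K"
    unfolding sigma_perm_def
  proof (intro conjI allI impI)
    show "\<exists>F. Hall \<tau> V F" "\<exists>F. Hall (primes_compl \<tau>) V F"
      using hall_exists[OF sep V] hall_exists[OF sep_compl V] by metis+
    fix F assume "Hall \<tau> V F \<or> Hall (primes_compl \<tau>) V F"
    then show "K <#> F = F <#> K"
    proof
      assume F: "Hall \<tau> V F"
      then have sF: "subgroup F G" "F \<subseteq> V" by (auto simp: Hall_def)
      note NF = subgroup_set_mult_normal[OF N sF(1)]
      have FNF: "F \<subseteq> N <#> F" "N \<subseteq> N <#> F" "N <#> F \<subseteq> V"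
        using set_mult_supset[OF sN sF(1)] set_mult_least[OF sV NV sF(2)] by auto
      have "index V F = index V (N <#> F) * index (N <#> F) F"
        using index_trans[OF sF(1) NF(1) sV] FNF by blast
      then have "tau_number (primes_compl \<tau>) (index V (N <#> F))" using F by (simp add: Hall_def)
      then have "V \<subseteq> N <#> F"
        using tau_section_below[OF sV NF(1) sV sN _ NV FNF(2) _ FNF(3) tau]
          set_mult_absorb[OF sV NF(1) FNF(3)] sV by simp
      then have "V \<subseteq> K <#> F" "V \<subseteq> F <#> K"
        using NF(2) mono_set_mult[of N K F F G] mono_set_mult[of F F N K G] K(2) by auto
      moreover have "K <#> F \<subseteq> V" "F <#> K \<subseteq> V"
        using set_mult_least[OF sV] K sF by auto
      ultimately show ?thesis by blast
    next
      assume F: "Hall (primes_compl \<tau>) V F"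
      then have sF: "subgroup F G" "F \<subseteq> V" by (auto simp: Hall_def)
      have "subgroup (F <#> N) G" using subgroup_set_mult_normal[OF N sF(1)] by simp
      then have "F \<subseteq> N"
        using tau_section_below[OF sF(1) sN sV triv_subgroup, of "primes_compl \<tau>"] sF NV tau F
          sub_one[OF sF(1)] sub_one[OF sN] by (simp add: Hall_def)
      then show ?thesis using set_mult_absorb[OF K(1) sF(1)] K by auto
    qed
  qed (use K in auto)
  ultimately have "sigma_perm \<tau> (carrier G) K" using pst P_sigma_pi_T_group_iff by blast
  then have KE: "K <#> E = E <#> K" using E by (simp add: sigma_perm_def)
  let ?B = "K <#> E"
  have sB: "subgroup ?B G" using subgroup_set_mult_comm[OF K(1) sE KE] .
  have KB: "K \<subseteq> ?B" "E \<subseteq> ?B" using set_mult_supset[OF K(1) sE] by auto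
  have i: "subgroup (V \<inter> ?B) G" using subgroups_Inter_pair sV sB by blast
  have "tau_number (primes_compl \<tau>) (index ?B K)"
    using index_set_mult_dvd[OF K(1) sE sB] E(1) tau_number_dvd by (auto simp: Hall_def)
  moreover have "index V N = index V (V \<inter> ?B) * index (V \<inter> ?B) N"
    using K KB by (intro index_trans sN i sV) auto
  then have "tau_number \<tau> (index (V \<inter> ?B) N)" using tau by simp
  moreover have "(V \<inter> ?B) <#> K = V \<inter> ?B" using set_mult_absorb(1)[OF i K(1)] K KB by blast
  ultimately have VB: "V \<inter> ?B \<subseteq> K"
    using tau_section_below[OF i K(1) sB sN, of \<tau>] K KB i by auto
  have ec: "e \<in> carrier G" using E sE sub_carrier by blast
  have "conj_by e ` K \<subseteq> K"
  proof
    fix y assume "y \<in> conj_by e ` K"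
    then obtain x where x: "x \<in> K" "y = conj_by e x" by blast
    then have "y \<in> V" using normal_conj_by[OF V ec] K by blast
    moreover have "y \<in> ?B"
      using x E(2) KB by (auto simp: conj_by_def intro!: sub_mult[OF sB] sub_inv[OF sB])
    ultimately show "y \<in> K" using VB by blast
  qed
  moreover have "card (conj_by e ` K) = card K"
    using inj_on_conj_by[OF ec] subgroup.subset[OF K(1)] by (meson card_image inj_on_subset)
  ultimately show ?thesis using sub_finite[OF K(1)] by (simp add: card_subset_eq)
qed

lemma residual_normalizes_section:
  assumes V: "V \<lhd> G" and N: "N \<lhd> G" and tau: "tau_number \<tau> (index V N)"
    and K: "subgroup K G" "N \<subseteq> K" "K \<subseteq> V"
    and r: "r \<in> tau_residual \<tau> (carrier G)" and x: "x \<in> K"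
  shows "conj_by r x \<in> K"
proof -
  have "pi_separable (primes_compl \<tau>) G" using sep pi_separable_compl by simp
  then obtain E0 where E0: "Hall (primes_compl \<tau>) (carrier G) E0"
    using hall_exists normal_self by blast
  have "conj_by r ` K = K"
    using tau_residual_le_of_Hall[OF E0 subgroup.subset[OF K(1)] _ r]
      Hall_normalizes_section[OF V N tau K] by blast
  then show ?thesis using x by blast
qed

lemma residual_powers_act:
  assumes V: "V \<lhd> G" and N: "N \<lhd> G" "N \<subseteq> V" and tau: "tau_number \<tau> (index V N)"
    and r: "r \<in> tau_residual \<tau> (carrier G)"
  shows "group.powers_act (G Mod N) (N #> r) ((\<lambda>x. N #> x) ` V)"
proof -
  interpret Q: group "G Mod N" using N(1) normal.factorgroup_is_group by blast
  have rc: "r \<in> carrier G" using r tau_residual_subset[OF subgroup_self] by blast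
  have sV: "subgroup V G" using V normal_imp_subgroup by blast
  let ?h = "\<lambda>x. N #> x"
  have "\<exists>t::int. Q.conj_by (?h r) (?h v) = ?h v [^]\<^bsub>G Mod N\<^esub> t" if v: "v \<in> V" for v
  proof -
    have vc: "v \<in> carrier G" using v sV sub_carrier by blast
    then have hv: "?h v \<in> carrier (G Mod N)" using factor_carrier by blast
    let ?B = "generate (G Mod N) {?h v}"
    let ?K = "{g \<in> carrier G. ?h g \<in> ?B}"
    have B: "subgroup ?B (G Mod N)" using Q.generate_is_subgroup hv by simp
    note K = factor_preimage_subgroup[OF N(1) B]
    have "?B \<subseteq> ?h ` V"
      using v factor_image_subgroup(1)[OF N(1) sV N(2)] by (intro Q.generate_subgroup_incl) auto
    then have KV: "?K \<subseteq> V" using factor_image_mem[OF N(1) sV N(2)] by blast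
    have "?h v \<in> ?B" by (rule generate.incl) simp
    then have "conj_by r v \<in> ?K"
      using residual_normalizes_section[OF V N(1) tau K(1,2) KV r] vc by blast
    then have "?h (conj_by r v) \<in> ?B" by blast
    then show ?thesis
      unfolding Q.generate_pow[OF hv] factor_conj_by[OF N(1) rc vc] by blast
  qed
  then show ?thesis using rc factor_carrier by (auto simp: Q.powers_act_def)
qed

end

end

section \<open>The decomposable residual modulo one of its parts\<close>

context group
begin

text \<open>The smallest normal subgroup of \<open>G\<close> with \<open>\<tau>\<close>-decomposable quotient; it plays the role of \<open>D\<close> in
the theorem.\<close>

definition decomp_residual :: "nat set \<Rightarrow> 'a set" where
  "decomp_residual \<tau> = tau_residual \<tau> (carrier G) \<inter> tau_residual (primes_compl \<tau>) (carrier G)"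

lemma decomp_residual_compl: "decomp_residual (primes_compl \<tau>) = decomp_residual \<tau>"
  by (auto simp: decomp_residual_def)

lemma decomp_residual_normal: "decomp_residual \<tau> \<lhd> G"
  unfolding decomp_residual_def using normal_self tau_residual_normal normal_subgroup_intersect by blast

end

context finite_group
begin

lemma residual_index:
  "tau_number (primes_compl \<tau>) (index (tau_residual \<tau> (carrier G)) (decomp_residual \<tau>))"
proof -
  let ?R = "tau_residual \<tau> (carrier G)" and ?S = "tau_residual (primes_compl \<tau>) (carrier G)"
  have "?S \<lhd> G" using normal_self tau_residual_normal by blast
  moreover have "subgroup ?R G" "subgroup ?S G" using tau_residual_subgroup[OF subgroup_self] by auto
  ultimately have "index ?R (?R \<inter> ?S) dvd index (carrier G) ?S"
    using index_Int_dvd subgroup_self subgroup.subset by metis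
  then show ?thesis
    unfolding decomp_residual_def using tau_residual_index[OF normal_self] tau_number_dvd by blast
qed

text \<open>Cauchy's theorem in \<open>V/N\<close>, with a representative that is itself a \<open>p\<close>-element.\<close>

lemma cauchy_mod:
  assumes N: "N \<lhd> G" and V: "subgroup V G" "N \<subseteq> V" and p: "prime p" "p dvd index V N"
  obtains x b where "x \<in> V" "x \<notin> N" "x [^] p \<in> N" "x [^] (p ^ b :: nat) = \<one>"
proof -
  have sN: "subgroup N G" using N normal_imp_subgroup by blast
  interpret V: finite_group "G\<lparr>carrier := V\<rparr>" using subgroup_finite_group[OF V(1)] .
  have "N \<lhd> G\<lparr>carrier := V\<rparr>" using normal_restrict_supergroup N V by blast
  then obtain P where "subgroup P (G\<lparr>carrier := V\<rparr>)" and P: "N \<subseteq> P" "index P N = p"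
    using V.sylow_mod_exists[of N p 1] p by auto
  then have sP: "subgroup P G" "P \<subseteq> V" using subgroup_carrier_iff[OF V(1)] by auto
  have "P \<noteq> N" using P index_self[OF sN] prime_gt_1_nat[OF p(1)] by auto
  then obtain y where y: "y \<in> P" "y \<notin> N" using P by blast
  have yc: "y \<in> carrier G" using y sP sub_carrier by blast
  have yp: "y [^] p \<in> N" using pow_index_mem[OF N sP(1) P(1) y(1)] P by simp
  have "ord y \<noteq> 0" "\<not> is_unit p" using ord_ge_1[OF fin yc] p by auto
  then obtain c where c: "ord y = p ^ multiplicity p (ord y) * c" "\<not> p dvd c"
    by (rule multiplicity_decompose')
  define x where "x = y [^] c"
  have "coprime p c" using c p by (simp add: prime_imp_coprime)
  then have "x \<notin> N" using coprime_pow_mem[OF sN yc yp] y by (auto simp: x_def)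
  moreover have "x \<in> V" using y sP sub_pow by (auto simp: x_def)
  moreover have "x [^] p \<in> N"
    using yp yc sub_pow[OF sN yp, of c] by (simp add: x_def nat_pow_pow mult.commute)
  moreover have "x [^] (p ^ multiplicity p (ord y)) = \<one>"
    using c yc by (metis x_def mult.commute nat_pow_pow pow_ord_eq_1)
  ultimately show thesis using that by blast
qed

lemma commut_mod_conj_by:
  assumes N: "N \<lhd> G" and "k \<in> carrier G" "z \<in> carrier G"
  shows "group.conj_by (G Mod N) (N #> k) (N #> z) = N #> z \<longleftrightarrow> commut k z \<in> N"
  using assms coset_eq_iff[OF normal_imp_subgroup[OF N], of "conj_by k z" z]
  by (simp add: factor_conj_by commut_def)

context
  fixes \<tau>
  assumes sep: "pi_separable \<tau> G" and pst: "P_sigma_pi_T_group \<tau> G"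
begin

context
  fixes V N k p b z
  assumes V: "V \<lhd> G" and N: "N \<lhd> G" "N \<subseteq> V" and tau: "tau_number \<tau> (index V N)"
    and k: "k \<in> tau_residual \<tau> (carrier G)" "tau_number (primes_compl \<tau>) (ord k)"
    and p: "prime p" and z: "z \<in> V" "z [^] (p ^ b :: nat) \<in> N" "commut k z \<notin> N"
begin

text \<open>The hypotheses of the previous section hold in \<open>G/N\<close>. The three lemmas that follow state the
conclusions in \<open>G\<close>.\<close>

lemma section_moved_aux:
  defines "Q \<equiv> G Mod N" and "h \<equiv> \<lambda>x. N #> x"
  shows "finite_group Q" "subgroup (h ` V) Q" "group.powers_act Q (h k) (h ` V)"
    "group.powers_act Q (inv\<^bsub>Q\<^esub> h k) (h ` V)" "h k [^]\<^bsub>Q\<^esub> ord k = \<one>\<^bsub>Q\<^esub>"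
    "coprime (ord k) (card (h ` V))" "h z \<in> h ` V" "h z [^]\<^bsub>Q\<^esub> (p ^ b) = \<one>\<^bsub>Q\<^esub>"
    "group.conj_by Q (h k) (h z) \<noteq> h z" "k \<in> carrier G" "z \<in> carrier G"
proof -
  have sV: "subgroup V G" using V normal_imp_subgroup by blast
  show kc: "k \<in> carrier G" using k tau_residual_subset[OF subgroup_self] by blast
  show zc: "z \<in> carrier G" using z sV sub_carrier by blast
  show "finite_group Q" unfolding Q_def using factor_finite_group[OF N(1)] .
  note im = factor_image_subgroup[OF N(1) sV N(2)]
  show "subgroup (h ` V) Q" unfolding Q_def h_def using im by blast
  show "group.powers_act Q (h k) (h ` V)"
    unfolding Q_def h_def using residual_powers_act[OF sep pst V N tau k(1)] .
  have "inv k \<in> tau_residual \<tau> (carrier G)" using k sub_inv tau_residual_subgroup[OF subgroup_self] by blast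
  from residual_powers_act[OF sep pst V N tau this]
  show "group.powers_act Q (inv\<^bsub>Q\<^esub> h k) (h ` V)"
    unfolding Q_def h_def using group_hom.hom_inv[OF factor_group_hom[OF N(1)] kc] by simp
  show "h k [^]\<^bsub>Q\<^esub> ord k = \<one>\<^bsub>Q\<^esub>"
    unfolding Q_def h_def
    using factor_pow[OF N(1) kc] kc factor_eq_one[OF N(1) one_closed] normal_imp_subgroup[OF N(1)]
    by (simp add: sub_one)
  show "coprime (ord k) (card (h ` V))"
    unfolding h_def using tau_number_coprime[OF tau k(2)] im(2) by (simp add: coprime_commute)
  show "h z \<in> h ` V" using z by blast
  show "h z [^]\<^bsub>Q\<^esub> (p ^ b) = \<one>\<^bsub>Q\<^esub>"
    unfolding Q_def h_def using factor_pow[OF N(1) zc] factor_eq_one[OF N(1)] z zc by simp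
  show "group.conj_by Q (h k) (h z) \<noteq> h z"
    unfolding Q_def h_def using commut_mod_conj_by[OF N(1) kc zc] z by simp
qed

lemma section_moved_central:
  assumes y: "y \<in> V" shows "commut z y \<in> N"
proof -
  interpret Q: finite_group "G Mod N" using section_moved_aux(1) .
  have yc: "y \<in> carrier G" using y V normal_imp_subgroup sub_carrier by blast
  have "(N #> z) \<otimes>\<^bsub>G Mod N\<^esub> (N #> y) = (N #> y) \<otimes>\<^bsub>G Mod N\<^esub> (N #> z)"
    using Q.moved_central[OF section_moved_aux(2-6) p section_moved_aux(7-9), of "N #> y"] y by blast
  then show ?thesis using commut_mod_iff[OF N(1) section_moved_aux(11) yc] by simp
qed

lemma section_moved_all:
  assumes y: "y \<in> V" "y [^] (p ^ c :: nat) \<in> N" "y \<notin> N"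
  shows "commut k y \<notin> N"
proof -
  interpret Q: finite_group "G Mod N" using section_moved_aux(1) .
  have yc: "y \<in> carrier G" using y V normal_imp_subgroup sub_carrier by blast
  have "(N #> y) [^]\<^bsub>G Mod N\<^esub> (p ^ c) = \<one>\<^bsub>G Mod N\<^esub>" "N #> y \<noteq> \<one>\<^bsub>G Mod N\<^esub>"
    using factor_pow[OF N(1) yc] factor_eq_one[OF N(1)] y yc by simp_all
  then have "Q.conj_by (N #> k) (N #> y) \<noteq> N #> y"
    using Q.moved_all[OF section_moved_aux(2-6) p section_moved_aux(7-9), of "N #> y" c] y by blast
  then show ?thesis using commut_mod_conj_by[OF N(1) section_moved_aux(10) yc] by simp
qed

lemma section_moved_exponent:
  obtains t :: int where "conj_by k z \<otimes> inv (z [^] t) \<in> N" "\<not> int p dvd t - 1"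
proof -
  interpret Q: finite_group "G Mod N" using section_moved_aux(1) .
  obtain t :: int where t: "Q.conj_by (N #> k) (N #> z) = (N #> z) [^]\<^bsub>G Mod N\<^esub> t" "\<not> int p dvd t - 1"
    using Q.moved_exponent[OF section_moved_aux(2,3,5,6) p section_moved_aux(7-9)] .
  have "N #> conj_by k z = N #> (z [^] t)"
    using t(1) factor_conj_by[OF N(1) section_moved_aux(10,11)] factor_int_pow[OF N(1) section_moved_aux(11)]
    by simp
  then show thesis
    using that[OF _ t(2)] coset_eq_iff[OF normal_imp_subgroup[OF N(1)]] section_moved_aux(10,11) by simp
qed

end

lemma decomp_sections:
  defines "R \<equiv> tau_residual \<tau> (carrier G)" and "S \<equiv> tau_residual (primes_compl \<tau>) (carrier G)"
    and "D \<equiv> decomp_residual \<tau>" and "X \<equiv> tau_residual \<tau> (decomp_residual \<tau>)"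
  shows "R \<lhd> G" "S \<lhd> G" "D \<lhd> G" "X \<lhd> G" "subgroup R G" "subgroup S G" "subgroup D G" "subgroup X G"
    "D = R \<inter> S" "X \<subseteq> D" "D \<subseteq> R" "D \<subseteq> S" "X \<subseteq> S"
    "tau_number \<tau> (index D X)" "tau_number \<tau> (index S X)" "tau_number \<tau> (index S D)"
    "tau_number (primes_compl \<tau>) (index R D)" "tau_residual \<tau> R = R"
proof -
  show nor: "R \<lhd> G" "S \<lhd> G" "D \<lhd> G" "X \<lhd> G"
    unfolding R_def S_def D_def X_def using normal_self tau_residual_normal decomp_residual_normal by blast+
  then show sub: "subgroup R G" "subgroup S G" "subgroup D G" "subgroup X G"
    using normal_imp_subgroup by auto
  show D: "D = R \<inter> S" "D \<subseteq> R" "D \<subseteq> S" by (auto simp: D_def R_def S_def decomp_residual_def)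
  show XD: "X \<subseteq> D" unfolding X_def using tau_residual_subset sub D_def by blast
  then show "X \<subseteq> S" using D by blast
  show 1: "tau_number \<tau> (index D X)" unfolding X_def D_def using tau_residual_index[OF decomp_residual_normal] .
  show 2: "tau_number \<tau> (index S D)"
    unfolding S_def D_def using residual_index[of "primes_compl \<tau>"] by (simp add: decomp_residual_compl)
  show "tau_number \<tau> (index S X)" using index_trans[OF sub(4,3,2) XD D(3)] 1 2 by simp
  show "tau_number (primes_compl \<tau>) (index R D)" unfolding R_def D_def by (rule residual_index)
  show "tau_residual \<tau> R = R" unfolding R_def using tau_residual_idem[OF subgroup_self] .
qed

text \<open>\<open>R\<close> is generated by the \<open>\<tau>'\<close>-elements and \<open>D\<close> by its elements of prime power order, so \<open>R\<close>
centralizes \<open>D/Y\<close>; but \<open>R\<close> has no nontrivial central \<open>\<tau>\<close>-section of this kind. This is how \<open>D\<close> is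
computed below.\<close>

lemma decomp_eqI:
  assumes Y: "Y \<lhd> G" "tau_residual \<tau> (decomp_residual \<tau>) \<subseteq> Y" "Y \<subseteq> decomp_residual \<tau>"
    and commut: "\<And>k y q b. k \<in> carrier G \<Longrightarrow> tau_number (primes_compl \<tau>) (ord k) \<Longrightarrow> y \<in> decomp_residual \<tau> \<Longrightarrow>
      prime q \<Longrightarrow> y [^] (q ^ b :: nat) = \<one> \<Longrightarrow> commut k y \<in> Y"
  shows "decomp_residual \<tau> = Y"
proof -
  let ?D = "decomp_residual \<tau>" and ?R = "tau_residual \<tau> (carrier G)"
  note f = decomp_sections
  have sY: "subgroup Y G" using Y normal_imp_subgroup by blast
  have Dc: "?D \<subseteq> carrier G" using f(7) subgroup.subset by blast
  have "k \<in> cent_mod Y ?D" if k: "k \<in> carrier G" "tau_number (primes_compl \<tau>) (ord k)" for k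
  proof -
    have "?D \<subseteq> cent_mod Y {k}"
    proof (rule prime_power_elements_generate[OF cent_mod_subgroup[OF Y(1)] f(7)])
      fix y p b assume y: "y \<in> ?D" "prime p" "y [^] (p ^ b :: nat) = \<one>"
      then show "y \<in> cent_mod Y {k}"
        using commut_sym[OF sY k(1) _ commut[OF k y]] Dc by (auto simp: cent_mod_def)
    qed (use k in simp)
    then have "commut k d \<in> Y" if "d \<in> ?D" for d
      using that commut_sym[OF sY] k Dc by (auto simp: cent_mod_def)
    then show ?thesis using k by (simp add: cent_mod_def)
  qed
  then have RY: "?R \<subseteq> cent_mod Y ?D"
    using Dc by (intro tau_residual_least cent_mod_subgroup[OF Y(1)]) auto
  have "index ?D (tau_residual \<tau> ?D) = index ?D Y * index Y (tau_residual \<tau> ?D)"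
    using index_trans[OF f(8) sY f(7) Y(2,3)] .
  then have "tau_number \<tau> (index ?D Y)" using f(14) by simp
  then show ?thesis
    using central_tau_section_trivial[OF Y(1) f(3,1) Y(3) f(11) _ f(17) _ f(18)] RY
    by (auto simp: cent_mod_def)
qed

text \<open>\<open>S/X\<close> is a \<open>\<tau>\<close>-group on which \<open>R\<close> acts by power automorphisms. Every element of prime power order
in \<open>D/X\<close> that is moved by a \<open>\<tau>'\<close>-element is central in \<open>S/X\<close>. So \<open>R\<close> centralizes \<open>D/Y\<close>, where \<open>Y/X
= D/X \<inter> Z(S/X)\<close>, and \<open>D = Y\<close>.\<close>

lemma decomp_central:
  assumes d: "d \<in> decomp_residual \<tau>" and s: "s \<in> tau_residual (primes_compl \<tau>) (carrier G)"
  shows "commut d s \<in> tau_residual \<tau> (decomp_residual \<tau>)"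
proof -
  define R where "R = tau_residual \<tau> (carrier G)"
  define S where "S = tau_residual (primes_compl \<tau>) (carrier G)"
  define D where "D = decomp_residual \<tau>"
  define X where "X = tau_residual \<tau> (decomp_residual \<tau>)"
  note f = decomp_sections[folded R_def S_def X_def, folded D_def]
  define Y where "Y = D \<inter> cent_mod X S"
  have Y: "Y \<lhd> G" unfolding Y_def using normal_subgroup_intersect f cent_mod_normal by blast
  have sY: "subgroup Y G" using Y normal_imp_subgroup by blast
  have XY: "X \<subseteq> Y"
    using f(10) normal_commut(2)[OF f(4)] sub_carrier[OF f(8)] sub_carrier[OF f(6)] by (auto simp: Y_def cent_mod_def)
  have YD: "Y \<subseteq> D" by (simp add: Y_def)
  have "commut k y \<in> Y"
    if k: "k \<in> carrier G" "tau_number (primes_compl \<tau>) (ord k)"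
      and y: "y \<in> D" "prime p" "y [^] (p ^ b :: nat) = \<one>" for k y p b
  proof (cases "commut k y \<in> X")
    case False
    have kR: "k \<in> R" using tau_residual_mem[OF k] by (simp add: R_def)
    have yc: "y \<in> carrier G" using y f sub_carrier by blast
    have "commut y x \<in> X" if x: "x \<in> S" for x
      using section_moved_central[OF f(2,4,13,15) kR[unfolded R_def] k(2) y(2) _ _ False x]
        y f(12) sub_one[OF f(8)] by (metis subsetD)
    then have "y \<in> Y" using y yc by (simp add: Y_def cent_mod_def)
    then show ?thesis using normal_commut(1)[OF Y k(1)] by blast
  qed (use XY in blast)
  then have "D = Y"
    using decomp_eqI[OF Y] XY YD unfolding D_def X_def by blast
  then show ?thesis using d s by (auto simp: Y_def cent_mod_def D_def X_def S_def)
qed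

text \<open>If no \<open>\<tau>'\<close>-element moved all nontrivial \<open>p\<close>-elements of \<open>S/X\<close>, then none would move any, and \<open>R\<close>
would centralize the quotient of the abelian group \<open>D/X\<close> by its \<open>p'\<close>-part. Then \<open>D/X\<close> would be a
\<open>p'\<close>-group.\<close>

lemma decomp_moved:
  assumes p: "prime p" and d: "d \<in> decomp_residual \<tau>" "d [^] (p ^ b :: nat) \<in> tau_residual \<tau> (decomp_residual \<tau>)"
      "d \<notin> tau_residual \<tau> (decomp_residual \<tau>)"
  obtains k where "k \<in> tau_residual \<tau> (carrier G)" "tau_number (primes_compl \<tau>) (ord k)"
    "\<And>y c. y \<in> tau_residual (primes_compl \<tau>) (carrier G) \<Longrightarrow> y [^] (p ^ c :: nat) \<in> tau_residual \<tau> (decomp_residual \<tau>)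
      \<Longrightarrow> y \<notin> tau_residual \<tau> (decomp_residual \<tau>) \<Longrightarrow> commut k y \<notin> tau_residual \<tau> (decomp_residual \<tau>)"
proof -
  define R where "R = tau_residual \<tau> (carrier G)"
  define S where "S = tau_residual (primes_compl \<tau>) (carrier G)"
  define D where "D = decomp_residual \<tau>"
  define X where "X = tau_residual \<tau> (decomp_residual \<tau>)"
  note f = decomp_sections[folded R_def S_def X_def, folded D_def]
  have "\<exists>k\<in>R. tau_number (primes_compl \<tau>) (ord k) \<and>
    (\<forall>y c. y \<in> S \<longrightarrow> y [^] (p ^ c :: nat) \<in> X \<longrightarrow> y \<notin> X \<longrightarrow> commut k y \<notin> X)"
  proof (rule ccontr)
    assume not: "\<not> ?thesis"
    have fixed: "commut k z \<in> X"
      if k: "k \<in> R" "tau_number (primes_compl \<tau>) (ord k)" and z: "z \<in> S" "z [^] (p ^ c :: nat) \<in> X"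
      for k z c
    proof (rule ccontr)
      assume mv: "commut k z \<notin> X"
      obtain y c' where y: "y \<in> S" "y [^] (p ^ c' :: nat) \<in> X" "y \<notin> X" "commut k y \<in> X"
        using not k by blast
      then show False
        using section_moved_all[OF f(2,4,13,15) k[unfolded R_def] p z mv y(1-3)] by simp
    qed
    define Y where "Y = {y \<in> D. \<exists>c::nat. \<not> p dvd c \<and> y [^] c \<in> X}"
    have Dc: "D \<subseteq> carrier G" using f subgroup.subset by blast
    have XY: "X \<subseteq> Y"
    proof
      fix x assume x: "x \<in> X"
      then have "x [^] (1::nat) \<in> X" using sub_carrier[OF f(8)] by simp
      then show "x \<in> Y" using x f(10) p not_prime_unit[of p] unfolding Y_def by (metis (mono_tags, lifting) mem_Collect_eq subsetD)
    qed
    have sY: "subgroup Y G"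
    proof (rule subgroupI)
      show "Y \<subseteq> carrier G" using Dc by (auto simp: Y_def)
      show "Y \<noteq> {}" using XY sub_one[OF f(8)] by blast
      fix y assume y: "y \<in> Y"
      then obtain c :: nat where c: "\<not> p dvd c" "y [^] c \<in> X" "y \<in> D" by (auto simp: Y_def)
      have "inv y [^] c \<in> X" using c Dc sub_inv[OF f(8) c(2)] by (auto simp: nat_pow_inv)
      then show "inv y \<in> Y" using c sub_inv[OF f(7)] by (auto simp: Y_def)
      fix w assume w: "w \<in> Y"
      then obtain e :: nat where e: "\<not> p dvd e" "w [^] e \<in> X" "w \<in> D" by (auto simp: Y_def)
      have car: "y \<in> carrier G" "w \<in> carrier G" using c e Dc by auto
      interpret Q: group "G Mod X" using f(4) normal.factorgroup_is_group by blast
      have "commut y w \<in> X"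
        using decomp_central[of y w] c e f(12) by (auto simp: D_def X_def S_def)
      then have com: "(X #> y) \<otimes>\<^bsub>G Mod X\<^esub> (X #> w) = (X #> w) \<otimes>\<^bsub>G Mod X\<^esub> (X #> y)"
        using commut_mod_iff[OF f(4) car] by simp
      have "y [^] (c * e) \<in> X" "w [^] (c * e) \<in> X"
        using sub_pow[OF f(8) c(2), of e] sub_pow[OF f(8) e(2), of c] car
        by (simp_all add: nat_pow_pow mult.commute)
      then have pw: "X #> y [^] (c * e) = X" "X #> w [^] (c * e) = X"
        using factor_eq_one[OF f(4)] car by simp_all
      have "(X #> (y \<otimes> w)) [^]\<^bsub>G Mod X\<^esub> (c * e) = \<one>\<^bsub>G Mod X\<^esub>"
        using Q.pow_mult_distrib[OF com factor_carrier factor_carrier, of "c * e"] car pw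
          factor_mult[OF f(4) car] factor_pow[OF f(4) car(1)] factor_pow[OF f(4) car(2)]
          Q.r_one[OF Q.one_closed] by simp
      then have "(y \<otimes> w) [^] (c * e) \<in> X"
        using factor_pow[OF f(4), of "y \<otimes> w"] factor_eq_one[OF f(4), of "(y \<otimes> w) [^] (c * e)"] car by simp
      moreover have "\<not> p dvd c * e" using c e p by (simp add: prime_dvd_mult_iff)
      ultimately show "y \<otimes> w \<in> Y" using c e sub_mult[OF f(7)] by (auto simp: Y_def)
    qed
    have Y: "Y \<lhd> G"
    proof (rule normal_cjI[OF sY])
      fix g y assume g: "g \<in> carrier G" and "y \<in> Y"
      then obtain c :: nat where c: "\<not> p dvd c" "y [^] c \<in> X" "y \<in> D" by (auto simp: Y_def)
      have "conj_by g y [^] c \<in> X" using normal_conj_by[OF f(4) g c(2)] conj_by_pow[OF g] c Dc by auto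
      then show "conj_by g y \<in> Y" using c normal_conj_by[OF f(3) g] by (auto simp: Y_def)
    qed
    have YD: "Y \<subseteq> D" by (auto simp: Y_def)
    have "commut k y \<in> Y"
      if k: "k \<in> carrier G" "tau_number (primes_compl \<tau>) (ord k)"
        and y: "y \<in> D" "prime q" "y [^] (q ^ e :: nat) = \<one>" for k y q e
    proof (cases "q = p")
      case True
      have "k \<in> R" using tau_residual_mem[OF k] by (simp add: R_def)
      then show ?thesis using True fixed[OF _ k(2), of y e] y f(12) sub_one[OF f(8)] XY by auto
    next
      case False
      then have "\<not> p dvd q ^ e"
        using p y(2) by (metis prime_dvd_power_nat primes_dvd_imp_eq)
      then have "\<exists>c::nat. \<not> p dvd c \<and> y [^] c \<in> X" using y(3) sub_one[OF f(8)] by metis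
      then have "y \<in> Y" using y(1) by (simp add: Y_def)
      then show ?thesis using normal_commut(1)[OF Y k(1)] by blast
    qed
    then have "D = Y"
      using decomp_eqI[OF Y] XY YD unfolding D_def X_def by blast
    then obtain c :: nat where c: "\<not> p dvd c" "d [^] c \<in> X" using d by (auto simp: Y_def D_def)
    have "coprime (p ^ b) c" using p c by (simp add: prime_imp_coprime)
    then show False
      using coprime_pow_mem[OF f(8) _ d(2)[folded X_def] c(2)] d Dc by (auto simp: X_def D_def)
  qed
  then show thesis using that unfolding R_def S_def X_def by blast
qed

lemma decomp_moved_exponent:
  assumes p: "prime p" and d: "d \<in> decomp_residual \<tau>" "d [^] (p ^ b :: nat) \<in> tau_residual \<tau> (decomp_residual \<tau>)"
      "d \<notin> tau_residual \<tau> (decomp_residual \<tau>)"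
  obtains k and t :: int where "k \<in> tau_residual \<tau> (carrier G)"
    "conj_by k d \<otimes> inv (d [^] t) \<in> tau_residual \<tau> (decomp_residual \<tau>)" "\<not> int p dvd t - 1"
proof -
  note f = decomp_sections
  obtain k where k: "k \<in> tau_residual \<tau> (carrier G)" "tau_number (primes_compl \<tau>) (ord k)"
    "\<And>y c. y \<in> tau_residual (primes_compl \<tau>) (carrier G) \<Longrightarrow> y [^] (p ^ c :: nat) \<in> tau_residual \<tau> (decomp_residual \<tau>)
      \<Longrightarrow> y \<notin> tau_residual \<tau> (decomp_residual \<tau>) \<Longrightarrow> commut k y \<notin> tau_residual \<tau> (decomp_residual \<tau>)"
    using decomp_moved[OF p d] by metis
  have dS: "d \<in> tau_residual (primes_compl \<tau>) (carrier G)" using d f(12) by blast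
  obtain t :: int where "conj_by k d \<otimes> inv (d [^] t) \<in> tau_residual \<tau> (decomp_residual \<tau>)" "\<not> int p dvd t - 1"
    using section_moved_exponent[OF f(2,4,13,15) k(1,2) p dS d(2) k(3)[OF dS d(2,3)]] .
  then show thesis using that k by blast
qed

text \<open>For \<open>p\<close> dividing \<open>|D : X|\<close>, some \<open>\<tau>'\<close>-element \<open>k\<close> of \<open>R\<close> moves every \<open>p\<close>-element \<open>z\<close> of \<open>S\<close>
outside \<open>X\<close>. Modulo \<open>X\<close> the commutator \<open>[k, z]\<close>, which lies in \<open>R \<inter> S = D\<close>, generates \<open>\<langle>z\<rangle>\<close>. So
all \<open>p\<close>-elements of \<open>S\<close> lie in \<open>D\<close>.\<close>

lemma decomp_hall:
  "coprime (index (decomp_residual \<tau>) (tau_residual \<tau> (decomp_residual \<tau>)))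
     (index (tau_residual (primes_compl \<tau>) (carrier G)) (decomp_residual \<tau>))"
proof (rule ccontr)
  define R where "R = tau_residual \<tau> (carrier G)"
  define S where "S = tau_residual (primes_compl \<tau>) (carrier G)"
  define D where "D = decomp_residual \<tau>"
  define X where "X = tau_residual \<tau> (decomp_residual \<tau>)"
  note f = decomp_sections[folded R_def S_def X_def, folded D_def]
  assume "\<not> ?thesis"
  then have "gcd (index D X) (index S D) \<noteq> 1" by (simp add: coprime_iff_gcd_eq_1 D_def X_def S_def)
  then obtain p where p: "prime p" "p dvd index D X" "p dvd index S D"
    using prime_factor_nat by (metis gcd_greatest_iff)
  obtain d where d: "d \<in> D" "d \<notin> X" "d [^] p \<in> X" using cauchy_mod[OF f(4,7,10) p(1,2)] by metis
  then have d': "d \<in> decomp_residual \<tau>" "d [^] (p ^ 1) \<in> tau_residual \<tau> (decomp_residual \<tau>)" "d \<notin> tau_residual \<tau> (decomp_residual \<tau>)"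
    by (auto simp: D_def X_def)
  obtain k where k: "k \<in> R" "tau_number (primes_compl \<tau>) (ord k)"
    "\<And>y c. y \<in> S \<Longrightarrow> y [^] (p ^ c :: nat) \<in> X \<Longrightarrow> y \<notin> X \<Longrightarrow> commut k y \<notin> X"
    using decomp_moved[OF p(1) d'] unfolding R_def S_def X_def by blast
  obtain z b where z: "z \<in> S" "z \<notin> D" "z [^] (p ^ b :: nat) = \<one>"
    using cauchy_mod[OF f(3,6,12) p(1,3)] by metis
  have car: "z \<in> carrier G" "k \<in> carrier G" using z k f(5,6) sub_carrier by auto
  have zX: "z [^] (p ^ b) \<in> X" "z \<notin> X" using z f(10) sub_one[OF f(8)] by auto
  obtain t :: int where t: "conj_by k z \<otimes> inv (z [^] t) \<in> X" "\<not> int p dvd t - 1"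
    using section_moved_exponent[OF f(2,4,13,15) k(1)[unfolded R_def] k(2) p(1) z(1) zX(1)
        k(3)[OF z(1) zX]] .
  have "commut k z \<in> D" using commut_Int_normal[OF f(1,2) k(1) z(1)] f(9) by simp
  moreover have "commut k z = conj_by k z \<otimes> inv (z [^] t) \<otimes> z [^] (t - 1)"
    using car by (simp add: commut_def int_pow_diff m_assoc)
  ultimately have "z [^] (t - 1) \<in> D"
    using sub_cancel_l[OF f(7), of "conj_by k z \<otimes> inv (z [^] t)" "z [^] (t - 1)"] t(1) f(10) car by auto
  moreover have "z [^] int (p ^ b) \<in> D" using z(3) sub_one[OF f(7)] by (simp add: int_pow_int del: of_nat_power)
  moreover have "coprime (t - 1) (int (p ^ b))"
    using t(2) p(1) prime_imp_coprime[of "int p" "t - 1"] by (simp add: coprime_commute)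
  ultimately have "z \<in> D" using coprime_int_pow_mem[OF f(7) car(1)] by blast
  then show False using z by blast
qed

text \<open>If \<open>d\<close> had order 2 modulo \<open>X\<close>, then the exponent \<open>t\<close> of a moving element would be even, and \<open>d\<close>
would be mapped to 1.\<close>

lemma decomp_odd: "odd (index (decomp_residual \<tau>) (tau_residual \<tau> (decomp_residual \<tau>)))"
proof
  note f = decomp_sections
  assume "even (index (decomp_residual \<tau>) (tau_residual \<tau> (decomp_residual \<tau>)))"
  then obtain d where d: "d \<in> decomp_residual \<tau>" "d \<notin> tau_residual \<tau> (decomp_residual \<tau>)"
      "d [^] (2::nat) \<in> tau_residual \<tau> (decomp_residual \<tau>)"
    using cauchy_mod[OF f(4,7,10) two_is_prime_nat] by metis
  obtain k and t :: int where k: "k \<in> tau_residual \<tau> (carrier G)"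
    "conj_by k d \<otimes> inv (d [^] t) \<in> tau_residual \<tau> (decomp_residual \<tau>)" "\<not> int 2 dvd t - 1"
    using decomp_moved_exponent[of 2 d 1] d by auto
  have car: "d \<in> carrier G" "k \<in> carrier G" using d k f(5,7) sub_carrier by auto
  have "even t" using k(3) by simp
  then obtain s where "t = 2 * s" by blast
  then have "d [^] t = (d [^] (2::nat)) [^] s" using car by (simp add: int_pow_pow int_pow_int[symmetric])
  then have "d [^] t \<in> tau_residual \<tau> (decomp_residual \<tau>)" using sub_int_pow[OF f(8) d(3)] by simp
  then have "conj_by k d \<in> tau_residual \<tau> (decomp_residual \<tau>)"
    using k(2) sub_cancel_r[OF f(8) sub_inv[OF f(8)], of "d [^] t" "conj_by k d"] car by simp
  then have "conj_by (inv k) (conj_by k d) \<in> tau_residual \<tau> (decomp_residual \<tau>)" using normal_conj_by[OF f(4)] car by blast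
  then show False using d car by simp
qed

end

end

section \<open>The decomposable residual is an abelian Hall subgroup\<close>

lemma not_coprime_common_prime:
  fixes m n :: nat
  assumes "\<not> coprime m n"
  obtains p where "prime p" "p dvd m" "p dvd n"
proof -
  have "gcd m n \<noteq> 1" using assms coprime_iff_gcd_eq_1 by blast
  then obtain p where "prime p" "p dvd gcd m n" using prime_factor_nat by blast
  then show thesis using that by simp
qed

context finite_group
begin

lemma chief_factor_top:
  assumes "N \<lhd> G" "N \<noteq> {\<one>}"
  obtains W where "chief_factor G N W"
proof -
  let ?S = "{M. M \<lhd> G \<and> M \<subset> N}"
  have sN: "subgroup N G" using assms(1) normal_imp_subgroup by blast
  have "finite ?S"
    using sub_finite[OF sN] by (intro finite_subset[of ?S "Pow N"]) auto
  moreover have "{\<one>} \<in> ?S" using one_is_normal assms(2) sub_one[OF sN] by auto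
  then have "?S \<noteq> {}" by blast
  ultimately have "\<exists>M\<in>?S. \<forall>B\<in>?S. M \<subseteq> B \<longrightarrow> M = B" by (rule finite_has_maximal)
  then obtain M where MS: "M \<in> ?S" and maxS: "\<forall>B\<in>?S. M \<subseteq> B \<longrightarrow> M = B" by (rule bexE)
  have M: "M \<lhd> G" "M \<subset> N" using MS by simp_all
  have max: "M = B" if "B \<lhd> G" "B \<subset> N" "M \<subseteq> B" for B
    using maxS that by simp
  have "chief_factor G N M" unfolding chief_factor_def using assms(1) M max by blast
  then show thesis using that by blast
qed

text \<open>If \<open>g\<close> and \<open>y\<close> map \<open>v\<close> to the same element \<open>u\<close> modulo \<open>W\<close>, then \<open>y\<^sup>-\<^sup>1g\<close> fixes \<open>v\<close> modulo \<open>W\<close>.\<close>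

lemma commut_left_mod:
  assumes W: "W \<lhd> G" and xw: "x \<in> W" "w \<in> W"
    and car: "g \<in> carrier G" "y \<in> carrier G" "v \<in> carrier G" "u \<in> carrier G"
    and eq: "conj_by g v = x \<otimes> u" "conj_by y v = w \<otimes> u"
  shows "commut (inv y \<otimes> g) v \<in> W"
proof -
  have sW: "subgroup W G" using W normal_imp_subgroup by blast
  have c: "x \<in> carrier G" "w \<in> carrier G" using xw sub_carrier[OF sW] by auto
  have "conj_by g v = x \<otimes> inv w \<otimes> conj_by y v" using c car unfolding eq by (simp add: m_assoc)
  then have "conj_by (inv y) (conj_by g v) = conj_by (inv y) (x \<otimes> inv w) \<otimes> conj_by (inv y) (conj_by y v)"
    using conj_by_mult[of "inv y" "x \<otimes> inv w" "conj_by y v"] c car by simp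
  then have "conj_by (inv y \<otimes> g) v = conj_by (inv y) (x \<otimes> inv w) \<otimes> v"
    using car by (simp add: conj_by_conj_by)
  then have "commut (inv y \<otimes> g) v = conj_by (inv y) (x \<otimes> inv w)"
    using c car by (simp add: commut_def m_assoc)
  then show ?thesis using normal_conj_by[OF W] xw car sW by (simp add: sub_mult sub_inv)
qed

context
  fixes \<tau>
  assumes sep: "pi_separable \<tau> G" and pst: "P_sigma_pi_T_group \<tau> G"
begin

lemma sep_compl: "pi_separable (primes_compl \<tau>) G" and pst_compl: "P_sigma_pi_T_group (primes_compl \<tau>) G"
  using sep pst pi_separable_compl P_sigma_pi_T_group_compl by auto

text \<open>Let \<open>X = O\<^sup>\<tau>(D)\<close>, \<open>X' = O\<^sup>\<tau>\<^sup>'(D)\<close> and \<open>N = X \<inter> X'\<close>. The section \<open>N/W\<close> is elementary abelian: were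
it not abelian, its centre would be trivial, so \<open>R\<close> could not move any element of \<open>N/W\<close>; but \<open>R\<close>
contains \<open>N\<close>. Let \<open>y\<close> in \<open>X\<close> be a \<open>q\<close>-element outside \<open>N\<close>. Viewed in \<open>D/X'\<close> it is moved by some
\<open>g\<close> in \<open>S\<close>, so \<open>gyg\<^sup>-\<^sup>1 = n y\<^sup>t\<close> with \<open>n\<close> in \<open>N\<close> and \<open>t - 1\<close> prime to \<open>q\<close>. Since \<open>y\<close> acts on \<open>N/W\<close>
by one exponent, \<open>y\<close> and \<open>gyg\<^sup>-\<^sup>1\<close> act alike, so \<open>y\<^sup>t\<^sup>-\<^sup>1\<close> and then \<open>y\<close> act trivially. Thus \<open>N/W\<close>
is a central \<open>\<tau>\<close>-section of \<open>X = O\<^sup>\<tau>(X)\<close>.\<close>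

lemma no_tau_chief_factor:
  assumes chief: "chief_factor G (tau_residual \<tau> (decomp_residual \<tau>) \<inter> tau_residual (primes_compl \<tau>) (decomp_residual \<tau>)) W"
    and tau: "tau_number \<tau>
      (index (tau_residual \<tau> (decomp_residual \<tau>) \<inter> tau_residual (primes_compl \<tau>) (decomp_residual \<tau>)) W)"
  shows False
proof -
  define R where "R = tau_residual \<tau> (carrier G)"
  define S where "S = tau_residual (primes_compl \<tau>) (carrier G)"
  define D where "D = decomp_residual \<tau>"
  define X where "X = tau_residual \<tau> (decomp_residual \<tau>)"
  define X' where "X' = tau_residual (primes_compl \<tau>) (decomp_residual \<tau>)"
  define N where "N = X \<inter> X'"
  note f = decomp_sections[OF sep pst, folded R_def S_def X_def, folded D_def]
  have X': "X' \<lhd> G" "subgroup X' G" "X' \<subseteq> D" "tau_number (primes_compl \<tau>) (index D X')"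
    using decomp_sections(4,8,10,14)[OF sep_compl pst_compl] by (simp_all add: decomp_residual_compl X'_def D_def)
  have N: "N \<lhd> G" "N \<subseteq> D" "N \<subseteq> R" "N \<subseteq> X"
    using normal_subgroup_intersect[OF f(4) X'(1)] f(10,11) by (auto simp: N_def)
  have sN: "subgroup N G" using N normal_imp_subgroup by blast
  have W: "W \<lhd> G" "W \<subseteq> N" "W \<noteq> N" and ch: "\<And>L. L \<lhd> G \<Longrightarrow> W \<subseteq> L \<Longrightarrow> L \<subseteq> N \<Longrightarrow> L = W \<or> L = N"
    using chief unfolding chief_factor_def X_def[symmetric] X'_def[symmetric] N_def[symmetric] by blast+
  have tau: "tau_number \<tau> (index N W)" using tau by (simp add: N_def X_def X'_def)
  have sW: "subgroup W G" using W normal_imp_subgroup by blast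
  have Nc: "N \<subseteq> carrier G" using sN subgroup.subset by blast
  define C where "C = cent_mod W N"
  have C: "C \<lhd> G" unfolding C_def using cent_mod_normal[OF W(1) N(1)] .
  have sC: "subgroup C G" using C normal_imp_subgroup by blast
  have WC: "W \<subseteq> C" using normal_commut(2)[OF W(1)] sub_carrier[OF sW] Nc by (auto simp: C_def cent_mod_def)
  \<comment> \<open>\<open>N/W\<close> is abelian: by minimality its centre is trivial or everything.\<close>
  have "N \<inter> C = W \<or> N \<inter> C = N"
    using ch[OF normal_subgroup_intersect[OF N(1) C]] W(2) WC by blast
  then have NC: "N \<subseteq> C"
  proof
    assume eq: "N \<inter> C = W"
    have "R \<subseteq> C"
      unfolding R_def
    proof (rule tau_residual_least[OF sC])
      fix k assume k: "k \<in> carrier G" "tau_number (primes_compl \<tau>) (ord k)"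
      have kR: "k \<in> tau_residual \<tau> (carrier G)" using tau_residual_mem[OF k] .
      have "N \<subseteq> cent_mod W {k}"
      proof (rule prime_power_elements_generate[OF cent_mod_subgroup[OF W(1)] sN])
        fix v p b assume v: "v \<in> N" "prime p" "v [^] (p ^ b :: nat) = \<one>"
        have vc: "v \<in> carrier G" using v Nc by blast
        have "commut k v \<in> W"
        proof (rule ccontr)
          assume mv: "commut k v \<notin> W"
          have "commut v y \<in> W" if "y \<in> N" for y
            using section_moved_central[OF sep pst N(1) W(1,2) tau kR k(2) v(2,1) _ mv that] v(3)
              sub_one[OF sW] by metis
          then have "v \<in> W" using eq v vc by (auto simp: C_def cent_mod_def)
          then show False using mv normal_commut(1)[OF W(1) k(1)] by blast
        qed
        then show "v \<in> cent_mod W {k}" using commut_sym[OF sW k(1) vc] vc by (simp add: cent_mod_def)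
      qed (use k in simp)
      then have "commut k v \<in> W" if "v \<in> N" for v
        using that commut_sym[OF sW] k Nc by (auto simp: cent_mod_def)
      then show "k \<in> C" using k by (simp add: C_def cent_mod_def)
    qed
    then show ?thesis using N by blast
  qed blast
  \<comment> \<open>\<open>N/W\<close> has exponent \<open>p\<close>: the elements of order dividing \<open>p\<close> form a nontrivial normal subgroup.\<close>
  have "index N W \<noteq> 1" using index_1_imp_eq[OF sW sN W(2)] W(3) by blast
  then obtain p where p: "prime p" "p dvd index N W" using prime_factor_nat by blast
  interpret Q: finite_group "G Mod W" using W(1) factor_finite_group by blast
  let ?h = "\<lambda>x. W #> x"
  have comm: "?h x \<otimes>\<^bsub>G Mod W\<^esub> ?h y = ?h y \<otimes>\<^bsub>G Mod W\<^esub> ?h x" if "x \<in> N" "y \<in> N" for x y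
    using commut_mod_iff[OF W(1), of x y] that NC Nc by (auto simp: C_def cent_mod_def)
  define P where "P = {v \<in> N. v [^] p \<in> W}"
  have P: "P \<lhd> G"
  proof (rule normal_cjI)
    show "subgroup P G"
    proof (rule subgroupI)
      show "P \<subseteq> carrier G" using Nc by (auto simp: P_def)
      show "P \<noteq> {}" using sub_one[OF sN] sub_one[OF sW] by (auto simp: P_def intro!: exI[of _ \<one>])
      fix x assume x: "x \<in> P"
      then have xN: "x \<in> N" "x \<in> carrier G" "x [^] p \<in> W" using Nc by (auto simp: P_def)
      then show "inv x \<in> P" using sub_inv[OF sN] sub_inv[OF sW] by (simp add: P_def nat_pow_inv)
      fix y assume y: "y \<in> P"
      then have yN: "y \<in> N" "y \<in> carrier G" "y [^] p \<in> W" using Nc by (auto simp: P_def)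
      have "?h (x [^] p) = W" "?h (y [^] p) = W"
        using xN yN factor_eq_one[OF W(1)] by simp_all
      then have "?h (x \<otimes> y) [^]\<^bsub>G Mod W\<^esub> p = \<one>\<^bsub>G Mod W\<^esub>"
        using Q.pow_mult_distrib[OF comm[OF xN(1) yN(1)] factor_carrier factor_carrier, of p] xN yN
          factor_mult[OF W(1) xN(2) yN(2)] factor_pow[OF W(1)] Q.r_one[OF Q.one_closed] by simp
      then have "(x \<otimes> y) [^] p \<in> W"
        using factor_pow[OF W(1), of "x \<otimes> y" p] factor_eq_one[OF W(1), of "(x \<otimes> y) [^] p"] xN yN
        by simp
      then show "x \<otimes> y \<in> P" using sub_mult[OF sN] xN yN by (simp add: P_def)
    qed
    fix g x assume g: "g \<in> carrier G" and x: "x \<in> P"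
    then show "conj_by g x \<in> P"
      using normal_conj_by[OF N(1) g] normal_conj_by[OF W(1) g, of "x [^] p"] conj_by_pow[OF g, of x p] Nc
      by (auto simp: P_def)
  qed
  have "W \<subseteq> P" using W sub_pow[OF sW] by (auto simp: P_def)
  moreover obtain x where "x \<in> N" "x \<notin> W" "x [^] p \<in> W"
    using cauchy_mod[OF W(1) sN W(2) p] by metis
  ultimately have "P = N" using ch[OF P] by (auto simp: P_def)
  then have el: "v [^] p \<in> W" if "v \<in> N" for v using that by (auto simp: P_def)
  have uniform: "\<exists>a::int. \<forall>v\<in>N. conj_by r v \<otimes> inv (v [^] a) \<in> W" if r: "r \<in> R" for r
  proof -
    have rc: "r \<in> carrier G" using r f(5) sub_carrier by blast
    have "\<exists>a::int. \<forall>w\<in>?h ` N. Q.conj_by (?h r) w = w [^]\<^bsub>G Mod W\<^esub> a"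
    proof -
      have "?h v [^]\<^bsub>G Mod W\<^esub> p = \<one>\<^bsub>G Mod W\<^esub>" if "v \<in> N" for v
        using el[OF that] factor_pow[OF W(1), of v p] factor_eq_one[OF W(1), of "v [^] p"] Nc that
        by (simp add: subset_iff)
      then have el': "x [^]\<^bsub>G Mod W\<^esub> p = \<one>\<^bsub>G Mod W\<^esub>" if "x \<in> ?h ` N" for x using that by blast
      have comm': "x \<otimes>\<^bsub>G Mod W\<^esub> y = y \<otimes>\<^bsub>G Mod W\<^esub> x" if "x \<in> ?h ` N" "y \<in> ?h ` N" for x y
        using that comm by blast
      show ?thesis
        using Q.uniform_exponent[OF factor_image_subgroup(1)[OF W(1) sN W(2)] comm' p(1) el'
            residual_powers_act[OF sep pst N(1) W(1,2) tau r[unfolded R_def]]] by metis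
    qed
    then obtain a :: int where a: "\<And>v. v \<in> N \<Longrightarrow> Q.conj_by (?h r) (?h v) = ?h v [^]\<^bsub>G Mod W\<^esub> a" by blast
    have "conj_by r v \<otimes> inv (v [^] a) \<in> W" if v: "v \<in> N" for v
    proof -
      have vc: "v \<in> carrier G" using v Nc by blast
      have "?h (conj_by r v) = ?h (v [^] a)"
        using a[OF v] factor_conj_by[OF W(1) rc vc] factor_int_pow[OF W(1) vc] by simp
      then show ?thesis using coset_eq_iff[OF sW] rc vc by simp
    qed
    then show ?thesis by blast
  qed
  \<comment> \<open>Elements of prime power order suffice, and those in \<open>X'\<close> lie in the abelian section.\<close>
  have XC: "X \<subseteq> C"
  proof (rule prime_power_elements_generate[OF sC f(8)])
    fix y q b assume y: "y \<in> X" "prime q" "y [^] (q ^ b :: nat) = \<one>"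
    have yc: "y \<in> carrier G" using y f(8) sub_carrier by blast
    show "y \<in> C"
    proof (cases "y \<in> X'")
      case True
      then show ?thesis using y NC by (auto simp: N_def)
    next
      case False
      have yD: "y \<in> D" using y f(10) by blast
      have "y \<in> decomp_residual (primes_compl \<tau>)" "y [^] (q ^ b) \<in> tau_residual (primes_compl \<tau>) (decomp_residual (primes_compl \<tau>))"
          "y \<notin> tau_residual (primes_compl \<tau>) (decomp_residual (primes_compl \<tau>))"
        using yD False sub_one[OF X'(2)] y(3) by (simp_all add: decomp_residual_compl D_def X'_def)
      then obtain g and t :: int where g: "g \<in> tau_residual (primes_compl \<tau>) (carrier G)"
          "conj_by g y \<otimes> inv (y [^] t) \<in> X'" "\<not> int q dvd t - 1"
        using decomp_moved_exponent[OF sep_compl pst_compl y(2)] unfolding X'_def decomp_residual_compl by metis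
      have gc: "g \<in> carrier G" using g tau_residual_subset[OF subgroup_self] by blast
      define n where "n = conj_by g y \<otimes> inv (y [^] t)"
      have "n \<in> X"
        using normal_conj_by[OF f(4) gc y(1)] sub_int_pow[OF f(8) y(1)] f(8) by (simp add: n_def sub_mult sub_inv)
      then have nC: "n \<in> C" and nc: "n \<in> carrier G" using g NC sC sub_carrier by (auto simp: N_def n_def)
      have cjg: "conj_by g y = n \<otimes> y [^] t" using gc yc by (simp add: n_def m_assoc)
      have yR: "y \<in> R" using yD f(11) by blast
      obtain a :: int where a: "\<And>v. v \<in> N \<Longrightarrow> conj_by y v \<otimes> inv (v [^] a) \<in> W"
        using uniform[OF yR] by blast
      have "commut (inv y \<otimes> conj_by g y) v \<in> W" if v: "v \<in> N" for v
      proof -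
        have vc: "v \<in> carrier G" using v Nc by blast
        let ?v = "conj_by (inv g) v"
        have v': "?v \<in> N" using normal_conj_by[OF N(1)] gc v by simp
        let ?x = "conj_by y ?v \<otimes> inv (?v [^] a)"
        have "conj_by (conj_by g y) v = conj_by g (conj_by y ?v)" using gc yc vc by (simp add: group_word_simps)
        also have "conj_by y ?v = ?x \<otimes> ?v [^] a" using gc yc vc by (simp add: m_assoc)
        also have "conj_by g (?x \<otimes> ?v [^] a) = conj_by g ?x \<otimes> v [^] a"
          using gc yc vc by (simp add: conj_by_mult conj_by_int_pow)
        finally have 1: "conj_by (conj_by g y) v = conj_by g ?x \<otimes> v [^] a" .
        have 2: "conj_by y v = (conj_by y v \<otimes> inv (v [^] a)) \<otimes> v [^] a" using yc vc by (simp add: m_assoc)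
        show ?thesis
          using commut_left_mod[OF W(1) normal_conj_by[OF W(1) gc a[OF v']] a[OF v] _ yc vc _ 1 2] gc yc vc
          by simp
      qed
      then have "inv y \<otimes> conj_by g y \<in> C" using gc yc by (simp add: C_def cent_mod_def)
      moreover have "inv y \<otimes> conj_by g y = conj_by (inv y) n \<otimes> y [^] (t - 1)"
      proof -
        have "y [^] (t - 1) = inv y \<otimes> y [^] t"
          using yc int_pow_mult[of y "- 1" t] by (simp add: int_pow_neg)
        then show ?thesis using cjg nc yc by (simp add: group_word_simps)
      qed
      moreover have "conj_by (inv y) n \<in> C" using normal_conj_by[OF C] nC yc by simp
      ultimately have "y [^] (t - 1) \<in> C" using sub_cancel_l[OF sC] yc by simp
      moreover have "y [^] int (q ^ b) \<in> C"
        using y(3) sub_one[OF sC] by (simp add: int_pow_int del: of_nat_power)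
      moreover have "coprime (t - 1) (int (q ^ b))"
        using g(3) y(2) prime_imp_coprime[of "int q" "t - 1"] by (simp add: coprime_commute)
      ultimately show ?thesis using coprime_int_pow_mem[OF sC yc] by blast
    qed
  qed
  have "index X N dvd index D X'"
    using index_Int_dvd[OF X'(1) f(8,7,10) X'(3)] by (simp add: N_def)
  then have "tau_number (primes_compl \<tau>) (index X N)" using X'(4) tau_number_dvd by blast
  moreover have "tau_residual \<tau> X = X" unfolding X_def using tau_residual_idem f(7) by (simp add: D_def)
  ultimately have "N = W"
    using central_tau_section_trivial[OF W(1) N(1) f(4) W(2) N(4) tau] XC by (auto simp: C_def cent_mod_def)
  then show False using W by blast
qed

end

context
  fixes \<tau>
  assumes sep: "pi_separable \<tau> G" and pst: "P_sigma_pi_T_group \<tau> G"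
begin

private abbreviation "DD \<equiv> decomp_residual \<tau>"
private abbreviation "X1 \<equiv> tau_residual \<tau> (decomp_residual \<tau>)"
private abbreviation "X2 \<equiv> tau_residual (primes_compl \<tau>) (decomp_residual \<tau>)"

private lemmas sepC = sep_compl[OF sep pst] and pstC = pst_compl[OF sep pst]

text \<open>The two residuals of \<open>D\<close> intersect trivially because \<open>G\<close> has no chief factor with the
intersection on top. So \<open>O\<^sup>\<tau>(D)\<close> is the \<open>\<tau>'\<close>-part of \<open>D\<close>, and \<open>O\<^sup>\<tau>\<^sup>'(D)\<close> is the \<open>\<tau>\<close>-part.\<close>

lemma decomp_residual_parts:
  "X1 \<lhd> G" "X2 \<lhd> G" "subgroup X1 G" "subgroup X2 G" "X1 \<subseteq> DD" "X2 \<subseteq> DD" "subgroup DD G"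
  "X1 \<inter> X2 = {\<one>}" "X1 <#> X2 = DD" "card X2 = index DD X1" "card X1 = index DD X2"
  "tau_number \<tau> (card X2)" "tau_number (primes_compl \<tau>) (card X1)"
proof -
  note f = decomp_sections[OF sep pst]
  note f' = decomp_sections[OF sepC pstC, unfolded decomp_residual_compl]
  show nX: "X1 \<lhd> G" "X2 \<lhd> G" "subgroup X1 G" "subgroup X2 G" "X1 \<subseteq> DD" "X2 \<subseteq> DD" "subgroup DD G"
    using f f' by auto
  have nI: "X1 \<inter> X2 \<lhd> G" using normal_subgroup_intersect nX by blast
  show I: "X1 \<inter> X2 = {\<one>}"
  proof (rule ccontr)
    assume "X1 \<inter> X2 \<noteq> {\<one>}"
    then obtain W where W: "chief_factor G (X1 \<inter> X2) W" using chief_factor_top[OF nI] by blast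
    then consider "tau_number \<tau> (index (X1 \<inter> X2) W)" | "tau_number (primes_compl \<tau>) (index (X1 \<inter> X2) W)"
      using sep by (auto simp: pi_separable_iff)
    then show False
    proof cases
      case 1
      then show ?thesis using no_tau_chief_factor[OF sep pst W] by blast
    next
      case 2
      then show ?thesis
        using no_tau_chief_factor[OF sepC pstC, of W] W by (simp add: decomp_residual_compl Int_commute)
    qed
  qed
  note XX = subgroup_set_mult_normal(1)[OF nX(1,4)]
  have XXD: "X1 <#> X2 \<subseteq> DD" using set_mult_least nX by blast
  note XXs = set_mult_supset[OF nX(3,4)]
  have "index DD (X1 <#> X2) dvd index DD X1" "index DD (X1 <#> X2) dvd index DD X2"
    using index_trans[OF nX(3) XX nX(7) XXs(1) XXD] index_trans[OF nX(4) XX nX(7) XXs(2) XXD] by auto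
  then have "index DD (X1 <#> X2) = 1"
    using f(14) f'(14) tau_number_dvd tau_number_both by blast
  then show XXeq: "X1 <#> X2 = DD" using index_1_imp_eq[OF XX nX(7) XXD] by blast
  have "card DD = card X1 * card X2" using card_set_mult[OF nX(3,4)] I XXeq by simp
  then show c: "card X2 = index DD X1" "card X1 = index DD X2"
    using card_sub_pos[OF nX(3)] card_sub_pos[OF nX(4)] by (simp_all add: index_def)
  show "tau_number \<tau> (card X2)" "tau_number (primes_compl \<tau>) (card X1)"
    using f(14) f'(14) c by simp_all
qed

text \<open>Commutators of the \<open>\<tau>\<close>-part of \<open>D\<close> with \<open>S\<close> lie in both parts of \<open>D\<close>.\<close>

lemma decomp_residual_part_central:
  assumes d: "d \<in> X2" and s: "s \<in> tau_residual (primes_compl \<tau>) (carrier G)"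
  shows "d \<otimes> s = s \<otimes> d"
proof -
  note f = decomp_sections[OF sep pst]
  have c: "d \<in> carrier G" "s \<in> carrier G" using d s decomp_residual_parts(4) f(6) sub_carrier by auto
  have "commut d s \<in> X1" using decomp_central[OF sep pst _ s] d decomp_residual_parts(6) by blast
  moreover have "commut d s \<in> X2" using normal_commut(2)[OF decomp_residual_parts(2) c(2) d] .
  ultimately have "commut d s = \<one>" using decomp_residual_parts(8) by blast
  then show ?thesis using commut_eq_one_iff c by blast
qed

lemma decomp_residual_comm:
  assumes "x \<in> DD" "y \<in> DD" shows "x \<otimes> y = y \<otimes> x"
proof -
  note f = decomp_sections[OF sep pst]
  note f' = decomp_sections[OF sepC pstC, unfolded decomp_residual_compl tau_residual_compl_compl]
  have "commut x y \<in> X1" using decomp_central[OF sep pst] assms f(12) by blast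
  moreover have "commut x y \<in> X2"
    using decomp_central[OF sepC pstC, unfolded decomp_residual_compl tau_residual_compl_compl] assms f(11) by blast
  ultimately have "commut x y = \<one>" using decomp_residual_parts(8) by blast
  then show ?thesis using commut_eq_one_iff assms f(7) sub_carrier by blast
qed

lemma decomp_residual_hall: "coprime (card DD) (index (carrier G) DD)"
proof (rule ccontr)
  note f = decomp_sections[OF sep pst]
  note f' = decomp_sections[OF sepC pstC, unfolded decomp_residual_compl tau_residual_compl_compl]
  let ?R = "tau_residual \<tau> (carrier G)" and ?S = "tau_residual (primes_compl \<tau>) (carrier G)"
  assume "\<not> ?thesis"
  then obtain p where p: "prime p" "p dvd card DD" "p dvd index (carrier G) DD"
    using not_coprime_common_prime by blast
  have card: "card DD = card X1 * card X2"
    using card_set_mult[OF decomp_residual_parts(3,4)] decomp_residual_parts(8,9) by simp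
  have i: "index (carrier G) DD = index (carrier G) ?S * index ?S DD"
      "index (carrier G) DD = index (carrier G) ?R * index ?R DD"
    using index_trans[OF f(7,6) subgroup_self f(12)] index_trans[OF f(7,5) subgroup_self f(11)]
      subgroup.subset[OF f(5)] subgroup.subset[OF f(6)] by auto
  have t: "tau_number (primes_compl \<tau>) (index (carrier G) ?S)" "tau_number \<tau> (index (carrier G) ?R)"
    using tau_residual_index[OF normal_self] by auto
  show False
  proof (cases "p \<in> \<tau>")
    case True
    then have "p dvd index DD X1" "p dvd index ?S DD"
      using p card i(1) t(1) decomp_residual_parts(10,13) by (auto simp: prime_dvd_mult_iff tau_number_compl)
    then show False using decomp_hall[OF sep pst] p(1) by (metis coprime_common_divisor not_prime_unit)
  next
    case False
    then have "p dvd index DD X2" "p dvd index ?R DD"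
      using p card i(2) t(2) decomp_residual_parts(11,12) by (auto simp: prime_dvd_mult_iff tau_number_def)
    then show False
      using decomp_hall[OF sepC pstC, unfolded decomp_residual_compl tau_residual_compl_compl] p(1)
      by (metis coprime_common_divisor not_prime_unit)
  qed
qed

lemma decomp_residual_odd: "odd (card DD)"
proof -
  have "card DD = card X1 * card X2"
    using card_set_mult[OF decomp_residual_parts(3,4)] decomp_residual_parts(8,9) by simp
  then show ?thesis
    using decomp_odd[OF sep pst] decomp_odd[OF sepC pstC, unfolded decomp_residual_compl tau_residual_compl_compl]
      decomp_residual_parts(10,11) by simp
qed

text \<open>\<open>R\<close> normalizes the subgroups of the \<open>\<tau>\<close>-part of \<open>D\<close>, which is a normal \<open>\<tau>\<close>-subgroup of \<open>G\<close>, and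
centralizes the \<open>\<tau>'\<close>-part.\<close>

lemma decomp_residual_residual_powers:
  assumes A: "subgroup A G" "A \<subseteq> DD" and a: "a \<in> A" and r: "r \<in> tau_residual \<tau> (carrier G)"
  shows "conj_by r a \<in> A"
proof -
  note f = decomp_sections[OF sep pst]
  have rc: "r \<in> carrier G" using r f(5) sub_carrier by blast
  have ac: "a \<in> carrier G" using a A sub_carrier by blast
  obtain i j :: int where ij: "a = a [^] i \<otimes> a [^] j" "tau_number \<tau> (ord (a [^] i))"
      "tau_number (primes_compl \<tau>) (ord (a [^] j))"
    using tau_parts[OF ac] by blast
  have iA: "a [^] i \<in> A" "a [^] j \<in> A" using a A sub_int_pow by auto
  have i2: "a [^] i \<in> X2" using tau_residual_mem[of "a [^] i" DD "primes_compl \<tau>"] iA A ij by auto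
  have j1: "a [^] j \<in> X1" using tau_residual_mem[of "a [^] j" DD \<tau>] iA A ij by auto
  have "a [^] i \<in> A \<inter> X2" using iA i2 by blast
  then have "conj_by r (a [^] i) \<in> A \<inter> X2"
    using residual_normalizes_section[OF sep pst decomp_residual_parts(2) one_is_normal, of "A \<inter> X2" r "a [^] i"]
      decomp_residual_parts(4,12) subgroups_Inter_pair[OF A(1) decomp_residual_parts(4)] sub_one[OF A(1)]
      sub_one[OF decomp_residual_parts(4)] r by simp
  moreover have "conj_by r (a [^] j) = a [^] j"
  proof -
    have "commut (a [^] j) r \<in> X2"
      using decomp_central[OF sepC pstC, unfolded decomp_residual_compl tau_residual_compl_compl] j1
        decomp_residual_parts(5) r by blast
    moreover have "commut (a [^] j) r \<in> X1" using normal_commut(2)[OF decomp_residual_parts(1) rc j1] .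
    ultimately have "commut (a [^] j) r = \<one>" using decomp_residual_parts(8) by blast
    then show ?thesis using commut_eq_one_iff[of "a [^] j" r] conj_by_eq_iff_commute[of r "a [^] j"] ac rc by simp
  qed
  moreover have "conj_by r a = conj_by r (a [^] i) \<otimes> conj_by r (a [^] j)"
    using conj_by_mult[OF rc, of "a [^] i" "a [^] j"] ij(1) ac by simp
  ultimately show ?thesis using sub_mult[OF A(1)] iA by simp
qed

end

end

section \<open>Complements of the decomposable residual\<close>

context finite_group
begin

lemma tau_core_restrict:
  assumes M: "subgroup M G"
  shows "tau_core \<tau> (G\<lparr>carrier := M\<rparr>) \<lhd> G\<lparr>carrier := M\<rparr>"
    "subgroup (tau_core \<tau> (G\<lparr>carrier := M\<rparr>)) G" "tau_core \<tau> (G\<lparr>carrier := M\<rparr>) \<subseteq> M"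
    "tau_number \<tau> (card (tau_core \<tau> (G\<lparr>carrier := M\<rparr>)))"
    "N \<lhd> G\<lparr>carrier := M\<rparr> \<Longrightarrow> tau_number \<tau> (card N) \<Longrightarrow> N \<subseteq> tau_core \<tau> (G\<lparr>carrier := M\<rparr>)"
proof -
  interpret M: finite_group "G\<lparr>carrier := M\<rparr>" using subgroup_finite_group[OF M] .
  have iff: "tau_group \<tau> (G\<lparr>carrier := M\<rparr>\<lparr>carrier := N\<rparr>) \<longleftrightarrow> tau_number \<tau> (card N)" for N
    by (simp add: tau_group_def tau_number_def order_def)
  note core = M.tau_core_is_greatest[OF M.fin, where \<tau> = \<tau>, unfolded iff]
  show 1: "tau_core \<tau> (G\<lparr>carrier := M\<rparr>) \<lhd> G\<lparr>carrier := M\<rparr>" using core by blast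
  show "subgroup (tau_core \<tau> (G\<lparr>carrier := M\<rparr>)) G" "tau_core \<tau> (G\<lparr>carrier := M\<rparr>) \<subseteq> M"
    using normal_carrier_iff[OF M] 1 by auto
  show "tau_number \<tau> (card (tau_core \<tau> (G\<lparr>carrier := M\<rparr>)))" using core by blast
  show "N \<lhd> G\<lparr>carrier := M\<rparr> \<Longrightarrow> tau_number \<tau> (card N) \<Longrightarrow> N \<subseteq> tau_core \<tau> (G\<lparr>carrier := M\<rparr>)"
    using core by blast
qed

lemma tau_groups_Int:
  assumes "subgroup A G" "subgroup B G" "tau_number \<tau> (card A)" "tau_number (primes_compl \<tau>) (card B)"
  shows "A \<inter> B = {\<one>}"
proof -
  have s: "subgroup (A \<inter> B) G" using subgroups_Inter_pair assms by blast
  have "card (A \<inter> B) dvd card A" "card (A \<inter> B) dvd card B"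
    using card_sub_dvd[OF s] assms by auto
  then have "card (A \<inter> B) = 1" using assms(3,4) tau_number_dvd tau_number_both by blast
  then show ?thesis using sub_one[OF s] by (metis card_1_singletonE singletonD)
qed

lemma pi_decomposableI:
  assumes M: "subgroup M G" and A: "A \<lhd> G\<lparr>carrier := M\<rparr>" "tau_number \<tau> (card A)"
    and B: "B \<lhd> G\<lparr>carrier := M\<rparr>" "tau_number (primes_compl \<tau>) (card B)" and AB: "M \<subseteq> A <#> B"
  shows "pi_decomposable \<tau> (G\<lparr>carrier := M\<rparr>)"
proof -
  let ?P = "tau_core \<tau> (G\<lparr>carrier := M\<rparr>)" and ?Q = "tau_core (primes_compl \<tau>) (G\<lparr>carrier := M\<rparr>)"
  note P = tau_core_restrict[OF M, where \<tau> = \<tau>] and Q = tau_core_restrict[OF M, where \<tau> = "primes_compl \<tau>"]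
  have "M \<subseteq> ?P <#> ?Q"
    using AB mono_set_mult[OF P(5)[OF A] Q(5)[OF B], of G] by blast
  then have "?P <#> ?Q = M" using set_mult_least[OF M P(3) Q(3)] by blast
  then show ?thesis
    using P(1) Q(1) tau_groups_Int[OF P(2) Q(2) P(4) Q(4)]
    by (simp add: pi_decomposable_def is_internal_direct_product_def)
qed

lemma tau_residual_parts_cover:
  assumes "x \<in> carrier G"
  obtains i j :: int where "x = x [^] i \<otimes> x [^] j" "x [^] i \<in> tau_residual (primes_compl \<tau>) (carrier G)"
    "x [^] j \<in> tau_residual \<tau> (carrier G)"
  using tau_parts[OF assms, of \<tau>] tau_residual_mem[of _ "carrier G"] assms
  by (metis int_pow_closed tau_number_compl_compl)

context
  fixes \<tau>
  assumes sep: "pi_separable \<tau> G" and pst: "P_sigma_pi_T_group \<tau> G"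
begin

lemma decomp_residual_subgroups_normal:
  assumes A: "subgroup A G" "A \<subseteq> decomp_residual \<tau>" and a: "a \<in> A" and g: "g \<in> carrier G"
  shows "conj_by g a \<in> A"
proof -
  note sepC = sep_compl[OF sep pst] and pstC = pst_compl[OF sep pst]
  obtain i j :: int where ij: "g = g [^] i \<otimes> g [^] j" "g [^] i \<in> tau_residual (primes_compl \<tau>) (carrier G)"
    "g [^] j \<in> tau_residual \<tau> (carrier G)" using tau_residual_parts_cover[OF g] .
  have "conj_by (g [^] j) a \<in> A" using decomp_residual_residual_powers[OF sep pst A a ij(3)] .
  then have "conj_by (g [^] i) (conj_by (g [^] j) a) \<in> A"
    using decomp_residual_residual_powers[OF sepC pstC A(1) _ _ ij(2)] A(2) by (simp add: decomp_residual_compl)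
  then show ?thesis using ij(1) g a sub_carrier[OF A(1)] by (simp add: conj_by_conj_by)
qed

lemma decomp_residual_power_automorphism:
  assumes g: "g \<in> carrier G"
  shows "power_automorphism (G\<lparr>carrier := decomp_residual \<tau>\<rparr>) (\<lambda>d. g \<otimes> d \<otimes> inv g)"
proof -
  have sD: "subgroup (decomp_residual \<tau>) G" using decomp_residual_parts(7)[OF sep pst] .
  have im: "conj_by g ` A = A" if A: "subgroup A G" "A \<subseteq> decomp_residual \<tau>" for A
  proof -
    have "conj_by g ` A \<subseteq> A" using decomp_residual_subgroups_normal[OF A _ g] by blast
    moreover have "card (conj_by g ` A) = card A"
      using inj_on_conj_by[OF g] subgroup.subset[OF A(1)] by (meson card_image inj_on_subset)
    ultimately show ?thesis using sub_finite[OF A(1)] by (simp add: card_subset_eq)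
  qed
  have "conj_by g \<in> hom (G\<lparr>carrier := decomp_residual \<tau>\<rparr>) (G\<lparr>carrier := decomp_residual \<tau>\<rparr>)"
    using im[OF sD] sub_carrier[OF sD] g by (auto simp: hom_def conj_by_mult)
  moreover have "bij_betw (conj_by g) (decomp_residual \<tau>) (decomp_residual \<tau>)"
    using im[OF sD] inj_on_subset[OF inj_on_conj_by[OF g] subgroup.subset[OF sD]] by (simp add: bij_betw_def)
  ultimately have "power_automorphism (G\<lparr>carrier := decomp_residual \<tau>\<rparr>) (conj_by g)"
    using im by (simp add: power_automorphism_def iso_def subgroup_carrier_iff[OF sD])
  then show ?thesis by (simp add: conj_by_def[abs_def])
qed

text \<open>A complement \<open>M\<close> of \<open>D\<close> is the product of \<open>M \<inter> S\<close> and \<open>M \<inter> R\<close>, since every element is a product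
of a \<open>\<tau>\<close>-element and a \<open>\<tau>'\<close>-element.\<close>

lemma decomp_residual_complement:
  obtains M where "is_internal_semidirect_product G (decomp_residual \<tau>) M"
    "pi_decomposable \<tau> (G\<lparr>carrier := M\<rparr>)"
proof -
  note f = decomp_sections[OF sep pst]
  let ?D = "decomp_residual \<tau>" and ?R = "tau_residual \<tau> (carrier G)" and ?S = "tau_residual (primes_compl \<tau>) (carrier G)"
  obtain M where M: "subgroup M G" "M \<inter> ?D = {\<one>}" "?D <#> M = carrier G"
    using schur_zassenhaus_mod[OF subgroup_self, of "{\<one>}" ?D] one_is_normal f(3) sub_one[OF f(7)]
      decomp_residual_hall[OF sep pst] by auto
  have nor: "M \<inter> A \<lhd> G\<lparr>carrier := M\<rparr>" if "A \<lhd> G" for A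
    using that normal_carrier_iff[OF M(1)] subgroups_Inter_pair[OF M(1) normal_imp_subgroup[OF that]]
      normal_conj_by[OF that] sub_carrier[OF M(1)] sub_mult[OF M(1)] sub_inv[OF M(1)] by (auto simp: conj_by_def)
  have sI: "subgroup (M \<inter> ?S) G" "subgroup (M \<inter> ?R) G" using subgroups_Inter_pair M(1) f(5,6) by auto
  have "M \<inter> ?S \<inter> ?D = {\<one>}" "M \<inter> ?R \<inter> ?D = {\<one>}"
    using M(2) sub_one[OF sI(1)] sub_one[OF sI(2)] by auto
  then have "card (M \<inter> ?S) dvd index ?S ?D" "card (M \<inter> ?R) dvd index ?R ?D"
    using index_Int_dvd[OF f(3) sI(1) f(6) _ f(12)] index_Int_dvd[OF f(3) sI(2) f(5) _ f(11)] by auto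
  then have t: "tau_number \<tau> (card (M \<inter> ?S))" "tau_number (primes_compl \<tau>) (card (M \<inter> ?R))"
    using f(16,17) tau_number_dvd by auto
  have "M \<subseteq> (M \<inter> ?S) <#> (M \<inter> ?R)"
  proof
    fix m assume m: "m \<in> M"
    then have mc: "m \<in> carrier G" using M sub_carrier by blast
    obtain i j :: int where ij: "m = m [^] i \<otimes> m [^] j" "m [^] i \<in> ?S" "m [^] j \<in> ?R"
      using tau_residual_parts_cover[OF mc] .
    then show "m \<in> (M \<inter> ?S) <#> (M \<inter> ?R)"
      using set_mult_memI[of "m [^] i" "M \<inter> ?S" "m [^] j" "M \<inter> ?R"] sub_int_pow[OF M(1) m] by simp
  qed
  then have "pi_decomposable \<tau> (G\<lparr>carrier := M\<rparr>)"
    using pi_decomposableI[OF M(1) nor[OF f(2)] t(1) nor[OF f(1)] t(2)] by blast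
  moreover have "is_internal_semidirect_product G ?D M"
    using M f(3) by (simp add: is_internal_semidirect_product_def Int_commute)
  ultimately show thesis using that by blast
qed

lemma decomp_residual_core:
  "tau_core \<tau> (G\<lparr>carrier := decomp_residual \<tau>\<rparr>) = tau_residual (primes_compl \<tau>) (decomp_residual \<tau>)"
proof
  note x = decomp_residual_parts[OF sep pst]
  note T = tau_core_restrict[OF x(7), where \<tau> = \<tau>]
  show "tau_residual (primes_compl \<tau>) (decomp_residual \<tau>) \<subseteq> tau_core \<tau> (G\<lparr>carrier := decomp_residual \<tau>\<rparr>)"
    using T(5)[OF normal_restrict_supergroup[OF x(7,2,6)] x(12)] .
  show "tau_core \<tau> (G\<lparr>carrier := decomp_residual \<tau>\<rparr>) \<subseteq> tau_residual (primes_compl \<tau>) (decomp_residual \<tau>)"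
  proof
    fix d assume d: "d \<in> tau_core \<tau> (G\<lparr>carrier := decomp_residual \<tau>\<rparr>)"
    then have "tau_number \<tau> (ord d)" using tau_elt_of_card[OF T(2) _ T(4)] by blast
    then show "d \<in> tau_residual (primes_compl \<tau>) (decomp_residual \<tau>)"
      using d T(3) tau_residual_mem[of d "decomp_residual \<tau>" "primes_compl \<tau>"] by auto
  qed
qed

text \<open>The \<open>\<tau>\<close>-part of \<open>D\<close> is a Hall subgroup of \<open>P\<close>, so it has a complement in \<open>P\<close>; the complement is
normal because \<open>P\<close> is contained in \<open>S\<close>, which centralizes the \<open>\<tau>\<close>-part.\<close>

lemma decomp_residual_normal_complement:
  "\<exists>P. hall_tau_subgroup \<tau> G P \<and>
     has_normal_complement (G\<lparr>carrier := P\<rparr>) (tau_core \<tau> (G\<lparr>carrier := decomp_residual \<tau>\<rparr>))"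
proof -
  note x = decomp_residual_parts[OF sep pst]
  let ?D = "decomp_residual \<tau>" and ?X = "tau_residual (primes_compl \<tau>) (decomp_residual \<tau>)"
    and ?S = "tau_residual (primes_compl \<tau>) (carrier G)"
  obtain P where P: "Hall \<tau> (carrier G) P" using hall_exists[OF sep normal_self] .
  then have sP: "subgroup P G" and tP: "tau_number \<tau> (card P)" by (simp_all add: Hall_def)
  have hP: "hall_tau_subgroup \<tau> G P" using P hall_tau_subgroup_iff[OF subgroup_self, of \<tau> P] by simp
  have XP: "?X \<subseteq> P"
    using tau_section_below[OF x(4) sP subgroup_self triv_subgroup, of \<tau>] P x(12)
      subgroup_set_mult_normal(1)[OF x(2) sP] sub_one[OF x(4)] sub_one[OF sP]
      subgroup.subset[OF x(4)] by (simp add: Hall_def)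
  have elt: "tau_number \<tau> (ord g)" if "g \<in> P" for g using tau_elt_of_card[OF sP that tP] .
  have PS: "P \<subseteq> ?S"
    using elt tau_residual_mem[of _ "carrier G" "primes_compl \<tau>"] sub_carrier[OF sP] by auto
  have "P \<inter> ?D \<subseteq> ?X"
    using elt tau_residual_mem[of _ ?D "primes_compl \<tau>"] by auto
  then have "P \<inter> ?D = ?X" using XP x(6) by blast
  then have "index P ?X dvd index (carrier G) ?D"
    using index_Int_dvd[OF decomp_residual_normal sP subgroup_self, of \<tau>] subgroup.subset[OF sP]
      subgroup.subset[OF x(7)] by simp
  moreover have "card ?X dvd card ?D" using card_sub_dvd x(4,6,7) by blast
  ultimately have cop: "coprime (card ?X) (index P ?X)"
    using decomp_residual_hall[OF sep pst] coprime_divisors by blast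
  obtain C where C: "subgroup C G" "C \<subseteq> P" "C \<inter> ?X = {\<one>}" "?X <#> C = P"
    using schur_zassenhaus_mod[OF sP normal_restrict_supergroup[OF sP one_is_normal] normal_restrict_supergroup[OF sP x(2) XP]]
      cop sub_one[OF sP] sub_one[OF x(4)] by auto
  have "conj_by g c \<in> C" if g: "g \<in> P" and c: "c \<in> C" for g c
  proof -
    obtain y b where yb: "y \<in> ?X" "b \<in> C" "g = y \<otimes> b" using g C(4) set_mult_memE by metis
    have car: "y \<in> carrier G" "b \<in> carrier G" "c \<in> carrier G"
      using yb c C(1) x(4) sub_carrier by auto
    have bc: "conj_by b c \<in> C" using yb c C(1) by (simp add: conj_by_def sub_mult sub_inv)
    then have "conj_by y (conj_by b c) = conj_by b c"
      using decomp_residual_part_central[OF sep pst yb(1)] C(2) PS car conj_by_eq_iff_commute[of y "conj_by b c"] by auto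
    then show ?thesis using bc car yb(3) by (simp add: conj_by_conj_by)
  qed
  then have "C \<lhd> G\<lparr>carrier := P\<rparr>" using normal_carrier_iff[OF sP] C by blast
  then have "has_normal_complement (G\<lparr>carrier := P\<rparr>) ?X"
    unfolding has_normal_complement_def
    using C(3,4) x(4) XP by (intro conjI exI[of _ C]) (auto simp: subgroup_carrier_iff[OF sP])
  then show ?thesis using hP unfolding decomp_residual_core by blast
qed

end

theorem P_sigma_pi_T_group_structure:
  assumes sep: "pi_separable \<tau> G" and pst: "P_sigma_pi_T_group \<tau> G"
  shows "\<exists>D M.
       (is_internal_semidirect_product G D M \<and>
        comm_group (G\<lparr>carrier := D\<rparr>) \<and> hall_subgroup G D \<and> odd (card D) \<and>
        pi_decomposable \<tau> (G\<lparr>carrier := M\<rparr>) \<and>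
        (\<forall>g\<in>carrier G. power_automorphism (G\<lparr>carrier := D\<rparr>) (\<lambda>d. g \<otimes> d \<otimes> inv g))) \<and>
       (\<exists>H. hall_tau_subgroup \<tau> G H \<and>
          has_normal_complement (G\<lparr>carrier := H\<rparr>) (tau_core \<tau> (G\<lparr>carrier := D\<rparr>))) \<and>
       (\<exists>H. hall_tau_subgroup (primes_compl \<tau>) G H \<and>
          has_normal_complement (G\<lparr>carrier := H\<rparr>) (tau_core (primes_compl \<tau>) (G\<lparr>carrier := D\<rparr>)))"
proof -
  let ?D = "decomp_residual \<tau>"
  have sD: "subgroup ?D G" using decomp_residual_parts(7)[OF sep pst] .
  obtain M where M: "is_internal_semidirect_product G ?D M" "pi_decomposable \<tau> (G\<lparr>carrier := M\<rparr>)"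
    using decomp_residual_complement[OF sep pst] .
  have comm: "comm_group (G\<lparr>carrier := ?D\<rparr>)"
    using decomp_residual_comm[OF sep pst] subgroup_imp_group[OF sD]
    by (intro group.group_comm_groupI) auto
  have "card (rcosets ?D) = index (carrier G) ?D"
    using card_rcosets_index[OF sD subgroup_self] subgroup.subset[OF sD] by simp
  then have hall: "hall_subgroup G ?D"
    using sD decomp_residual_hall[OF sep pst] by (simp add: hall_subgroup_def)
  have 3: "\<exists>P. hall_tau_subgroup (primes_compl \<tau>) G P \<and>
     has_normal_complement (G\<lparr>carrier := P\<rparr>) (tau_core (primes_compl \<tau>) (G\<lparr>carrier := ?D\<rparr>))"
    using decomp_residual_normal_complement[OF sep_compl[OF sep pst] pst_compl[OF sep pst]] by (simp add: decomp_residual_compl)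
  show ?thesis
    by (rule exI[of _ ?D], rule exI[of _ M], intro conjI ballI)
      (rule M comm hall decomp_residual_odd[OF sep pst] decomp_residual_power_automorphism[OF sep pst]
        decomp_residual_normal_complement[OF sep pst] 3, assumption?)+
qed

end

section \<open>Subgroups normalized by the residual\<close>

lemma square_dvd_power_diff:
  fixes r :: int
  shows "(r - 1) * (r - 1) dvd r ^ n - 1 - int n * (r - 1)"
    and "r - 1 dvd (\<Sum>i<n. r ^ i) - int n"
proof -
  have "(\<Sum>i<n. r ^ i) - int n = (\<Sum>i<n. r ^ i - 1)" by (simp add: sum_subtractf)
  moreover have "r - 1 dvd r ^ i - 1" for i using power_diff_1_eq[of r i] by simp
  ultimately show d: "r - 1 dvd (\<Sum>i<n. r ^ i) - int n" by (simp add: dvd_sum)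
  have "r ^ n - 1 - int n * (r - 1) = (r - 1) * ((\<Sum>i<n. r ^ i) - int n)"
    using power_diff_1_eq[of r n] by (simp add: algebra_simps)
  then show "(r - 1) * (r - 1) dvd r ^ n - 1 - int n * (r - 1)" using d by simp
qed

context group
begin

text \<open>What the converse uses of conditions (i)-(iii), in a form symmetric in \<open>\<tau>\<close> and \<open>\<tau>'\<close>. The
subgroups \<open>T\<close> and \<open>T'\<close> are the preimages of the \<open>\<tau>\<close>-part and the \<open>\<tau>'\<close>-part of the decomposable
group \<open>G/D\<close>; the last clause is what remains of (ii) and (iii).\<close>

definition power_split :: "nat set \<Rightarrow> 'a set \<Rightarrow> 'a set \<Rightarrow> 'a set \<Rightarrow> bool" where
  "power_split \<tau> D T T' \<longleftrightarrow>
     D \<lhd> G \<and> T \<lhd> G \<and> T' \<lhd> G \<and> T \<inter> T' = D \<and>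
     tau_number (primes_compl \<tau>) (index (carrier G) T) \<and> tau_number \<tau> (index (carrier G) T') \<and>
     coprime (card D) (index (carrier G) D) \<and>
     (\<forall>x\<in>D. \<forall>y\<in>D. x \<otimes> y = y \<otimes> x) \<and>
     (\<forall>A. subgroup A G \<and> A \<subseteq> D \<longrightarrow> A \<lhd> G) \<and>
     (\<forall>x\<in>D. \<forall>g\<in>carrier G. tau_number \<tau> (ord x) \<and> tau_number \<tau> (ord g) \<or>
        tau_number (primes_compl \<tau>) (ord x) \<and> tau_number (primes_compl \<tau>) (ord g) \<longrightarrow>
        x \<otimes> g = g \<otimes> x)"

definition tau_part :: "nat set \<Rightarrow> 'a set \<Rightarrow> 'a set" where
  "tau_part \<tau> D = {d \<in> D. tau_number \<tau> (ord d)}"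

lemma power_split_compl: "power_split \<tau> D T T' \<Longrightarrow> power_split (primes_compl \<tau>) D T' T"
  unfolding power_split_def by (auto simp: Int_commute)

end

context finite_group
begin

lemma tau_part_abelian:
  assumes D: "subgroup D G" and comm: "\<forall>x\<in>D. \<forall>y\<in>D. x \<otimes> y = y \<otimes> x"
  shows "subgroup (tau_part \<tau> D) G" "tau_part \<tau> D \<subseteq> D" "tau_number \<tau> (card (tau_part \<tau> D))"
    "tau_part \<tau> D <#> tau_part (primes_compl \<tau>) D = D"
    "tau_part \<tau> D \<inter> tau_part (primes_compl \<tau>) D = {\<one>}"
    "tau_core \<tau> (G\<lparr>carrier := D\<rparr>) = tau_part \<tau> D"
proof -
  have sub: "subgroup (tau_part \<sigma> D) G" for \<sigma>
  proof (rule subgroupI)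
    show "tau_part \<sigma> D \<subseteq> carrier G" using sub_carrier[OF D] by (auto simp: tau_part_def)
    show "tau_part \<sigma> D \<noteq> {}" using sub_one[OF D] by (auto simp: tau_part_def intro!: exI[of _ \<one>])
    fix x assume x: "x \<in> tau_part \<sigma> D"
    then show "inv x \<in> tau_part \<sigma> D" using sub_inv[OF D] sub_carrier[OF D] by (auto simp: tau_part_def)
    fix y assume y: "y \<in> tau_part \<sigma> D"
    have "ord (x \<otimes> y) dvd ord x * ord y"
      using x y comm sub_carrier[OF D] by (intro ord_mul_divides) (auto simp: tau_part_def)
    moreover have "tau_number \<sigma> (ord x * ord y)" using x y by (simp add: tau_part_def)
    ultimately have "tau_number \<sigma> (ord (x \<otimes> y))" by (rule tau_number_dvd[rotated])
    then show "x \<otimes> y \<in> tau_part \<sigma> D"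
      using x y sub_mult[OF D] by (simp add: tau_part_def)
  qed
  have tau: "tau_number \<sigma> (card (tau_part \<sigma> D))" for \<sigma>
    unfolding tau_number_def
  proof (intro allI impI)
    fix p :: nat assume p: "prime p \<and> p dvd card (tau_part \<sigma> D)"
    have "{\<one>} \<subseteq> tau_part \<sigma> D" using sub_one[OF sub] by blast
    from cauchy_mod[OF one_is_normal sub this, where p = p] p
    obtain x where x: "x \<in> tau_part \<sigma> D" "x \<notin> {\<one>}" "x [^] p \<in> {\<one>}"
      by (metis index_one)
    then have xc: "x \<in> carrier G" using sub_carrier[OF sub] by blast
    have "ord x dvd p" using x xc by (simp add: pow_eq_id)
    moreover have "ord x \<noteq> 1" using x xc ord_eq_1 by auto
    ultimately have "ord x = p" using p by (metis prime_nat_iff)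
    then show "p \<in> \<sigma>" using x p by (auto simp: tau_part_def tau_number_def)
  qed
  show "subgroup (tau_part \<tau> D) G" "tau_number \<tau> (card (tau_part \<tau> D))" using sub tau by auto
  show "tau_part \<tau> D \<subseteq> D" by (auto simp: tau_part_def)
  show "tau_part \<tau> D \<inter> tau_part (primes_compl \<tau>) D = {\<one>}"
    using tau_groups_Int[OF sub sub tau tau] .
  show "tau_part \<tau> D <#> tau_part (primes_compl \<tau>) D = D"
  proof
    show "tau_part \<tau> D <#> tau_part (primes_compl \<tau>) D \<subseteq> D"
      by (rule set_mult_least[OF D]) (auto simp: tau_part_def)
    show "D \<subseteq> tau_part \<tau> D <#> tau_part (primes_compl \<tau>) D"
    proof
      fix d assume d: "d \<in> D"
      then have dc: "d \<in> carrier G" using D sub_carrier by blast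
      obtain i j :: int where ij: "d = d [^] i \<otimes> d [^] j" "tau_number \<tau> (ord (d [^] i))"
          "tau_number (primes_compl \<tau>) (ord (d [^] j))"
        using tau_parts[OF dc] by blast
      then show "d \<in> tau_part \<tau> D <#> tau_part (primes_compl \<tau>) D"
        using set_mult_memI[of "d [^] i" "tau_part \<tau> D" "d [^] j" "tau_part (primes_compl \<tau>) D"]
          sub_int_pow[OF D d] by (simp add: tau_part_def)
    qed
  qed
  show "tau_core \<tau> (G\<lparr>carrier := D\<rparr>) = tau_part \<tau> D"
  proof
    note T = tau_core_restrict[OF D, where \<tau> = \<tau>]
    have "conj_by g x = x" if "g \<in> D" "x \<in> tau_part \<tau> D" for g x
      using that comm conj_by_eq_of_commute[of g x] sub_carrier[OF D] by (auto simp: tau_part_def)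
    then have "tau_part \<tau> D \<lhd> G\<lparr>carrier := D\<rparr>"
      using normal_carrier_iff[OF D] sub[of \<tau>] by (auto simp: tau_part_def)
    then show "tau_part \<tau> D \<subseteq> tau_core \<tau> (G\<lparr>carrier := D\<rparr>)" using T(5) tau by blast
    show "tau_core \<tau> (G\<lparr>carrier := D\<rparr>) \<subseteq> tau_part \<tau> D"
      using tau_elt_of_card[OF T(2) _ T(4)] T(3) by (auto simp: tau_part_def)
  qed
qed

lemma subgroup_Int_normal_mult:
  assumes N: "N \<lhd> G" and B: "subgroup B G" and K: "subgroup K G" "K \<subseteq> B"
  shows "subgroup ((N \<inter> B) <#> K) G"
proof -
  have sN: "subgroup (N \<inter> B) G" using subgroups_Inter_pair normal_imp_subgroup[OF N] B by blast
  interpret B: finite_group "G\<lparr>carrier := B\<rparr>" using subgroup_finite_group[OF B] .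
  have "N \<inter> B \<lhd> G\<lparr>carrier := B\<rparr>"
    using normal_carrier_iff[OF B] sN normal_conj_by[OF N] sub_carrier[OF B] sub_mult[OF B] sub_inv[OF B]
    by (auto simp: conj_by_def)
  then have "subgroup ((N \<inter> B) <#> K) (G\<lparr>carrier := B\<rparr>)"
    using B.subgroup_set_mult_normal(1)[of "N \<inter> B" K] subgroup_carrier_iff[OF B] K by simp
  then show ?thesis using subgroup_carrier_iff[OF B] by blast
qed

context
  fixes \<tau> D T T'
  assumes ps: "power_split \<tau> D T T'"
begin

private abbreviation "A \<equiv> tau_part \<tau> D"
private abbreviation "A' \<equiv> tau_part (primes_compl \<tau>) D"

lemma power_split_facts:
  "D \<lhd> G" "T \<lhd> G" "T' \<lhd> G" "subgroup D G" "subgroup T G" "subgroup T' G"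
  "T \<inter> T' = D" "D \<subseteq> T" "D \<subseteq> T'"
  "tau_number (primes_compl \<tau>) (index (carrier G) T)" "tau_number \<tau> (index (carrier G) T')"
  "coprime (card D) (index (carrier G) D)" "\<forall>x\<in>D. \<forall>y\<in>D. x \<otimes> y = y \<otimes> x"
  using ps normal_imp_subgroup unfolding power_split_def by blast+

private lemmas part = tau_part_abelian[OF power_split_facts(4,13), where \<tau> = \<tau>]
private lemmas part' = tau_part_abelian[OF power_split_facts(4,13), where \<tau> = "primes_compl \<tau>"]

lemma power_split_more:
  "A \<lhd> G" "A' \<lhd> G" "tau_number \<tau> (index T D)" "tau_number (primes_compl \<tau>) (index T' D)"
  "index D A = card A'" "tau_number (primes_compl \<tau>) (index T' A)"
proof -
  note f = power_split_facts
  show nor: "A \<lhd> G" "A' \<lhd> G" using ps part(1,2) part'(1,2) unfolding power_split_def by blast+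
  have "index T (T \<inter> T') dvd index (carrier G) T'" "index T' (T' \<inter> T) dvd index (carrier G) T"
    using index_Int_dvd[OF f(3,5) subgroup_self] index_Int_dvd[OF f(2,6) subgroup_self]
      subgroup.subset[OF f(5)] subgroup.subset[OF f(6)] by auto
  then show t: "tau_number \<tau> (index T D)" "tau_number (primes_compl \<tau>) (index T' D)"
    using f(7,10,11) tau_number_dvd by (auto simp: Int_commute)
  have "card A * card A' = card D" using card_set_mult[OF part(1) part'(1)] part(4,5) by simp
  then show i: "index D A = card A'" by (intro index_eqI[OF part(1)]) (simp add: mult.commute)
  show "tau_number (primes_compl \<tau>) (index T' A)"
    using index_trans[OF part(1) f(4,6) part(2) f(9)] t i part'(3) by simp
qed

lemma power_split_exponent:
  assumes "d \<in> D" "g \<in> carrier G" obtains r :: int where "conj_by g d = d [^] r"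
proof -
  have dc: "d \<in> carrier G" using assms power_split_facts(4) sub_carrier by blast
  have "generate G {d} \<subseteq> D" using assms power_split_facts(4) by (intro generate_subgroup_incl) auto
  then have "generate G {d} \<lhd> G"
    using ps generate_is_subgroup[of "{d}"] dc unfolding power_split_def by auto
  then have "conj_by g d \<in> generate G {d}" using normal_conj_by assms generate.incl[of d "{d}" G] by blast
  then show thesis using that unfolding generate_pow[OF dc] by blast
qed

lemma power_split_commute:
  assumes "x \<in> D" "g \<in> carrier G" "tau_number \<tau> (ord x)" "tau_number \<tau> (ord g)"
  shows "x \<otimes> g = g \<otimes> x"
  using ps assms unfolding power_split_def by blast

lemma power_split_commute':
  assumes "x \<in> D" "g \<in> carrier G" "tau_number (primes_compl \<tau>) (ord x)"
    "tau_number (primes_compl \<tau>) (ord g)"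
  shows "x \<otimes> g = g \<otimes> x"
  using ps assms unfolding power_split_def by blast

lemma tau_elt_in_T: "g \<in> carrier G \<Longrightarrow> tau_number \<tau> (ord g) \<Longrightarrow> g \<in> T"
  using tau_elt_mem[OF power_split_facts(2) subgroup_self, of g "ord g" \<tau>] power_split_facts(10)
    subgroup.subset[OF power_split_facts(5)] sub_one[OF power_split_facts(5)] by simp

lemma tau_elt_in_T': "g \<in> carrier G \<Longrightarrow> tau_number (primes_compl \<tau>) (ord g) \<Longrightarrow> g \<in> T'"
  using tau_elt_mem[OF power_split_facts(3) subgroup_self, of g "ord g" "primes_compl \<tau>"]
    power_split_facts(11) subgroup.subset[OF power_split_facts(6)] sub_one[OF power_split_facts(6)]
  by simp

text \<open>Let \<open>E\<close> be a Hall \<open>\<tau>'\<close>-subgroup of \<open>H\<close>. Then \<open>k = ae\<close> with \<open>a\<close> in \<open>A \<inter> H\<close> and \<open>e\<close> in \<open>E\<close>. For \<open>y\<close>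
in \<open>A \<inter> H\<close> the subgroup \<open>K \<cdot> yEy\<^sup>-\<^sup>1\<close> meets \<open>A\<close> inside \<open>K\<close>, for reasons of order, and contains
\<open>k\<^sup>-\<^sup>1 \<cdot> yey\<^sup>-\<^sup>1\<close>, which lies in \<open>A\<close>. This gives the claim for \<open>A \<inter> H\<close>. For a general \<open>x\<close> in \<open>A\<close>
on which \<open>k\<close> acts with exponent \<open>r\<close>, the element \<open>[x, k] = x\<^sup>1\<^sup>-\<^sup>r\<close> lies in \<open>A \<inter> H\<close>, so \<open>x\<close> to the
power \<open>(r - 1)\<^sup>2\<close> lies in \<open>K\<close>; the action of \<open>k\<close> being coprime, \<open>x\<^sup>r\<^sup>-\<^sup>1\<close> itself lies in \<open>K\<close>.\<close>

lemma permutable_normalized_part: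
  assumes H: "subgroup H G" and DH: "\<And>d h. d \<in> D \<Longrightarrow> h \<in> H \<Longrightarrow> conj_by d h \<in> H"
    and K: "sigma_perm \<tau> H K" and k: "k \<in> K" "tau_number (primes_compl \<tau>) (ord k)" and x: "x \<in> A"
  shows "conj_by x k \<in> K"
proof -
  note f = power_split_facts and m = power_split_more
  have sK: "subgroup K G" "K \<subseteq> H" using K by (auto simp: sigma_perm_def)
  obtain E where E: "Hall (primes_compl \<tau>) H E" using K by (auto simp: sigma_perm_def)
  then have sE: "subgroup E G" "E \<subseteq> H" "tau_number (primes_compl \<tau>) (card E)"
    "tau_number \<tau> (index H E)" by (auto simp: Hall_def)
  have car: "k \<in> carrier G" "x \<in> carrier G" "k \<in> H"
    using k x sK part(1) sub_carrier by auto
  have AT': "A \<subseteq> T'" using part(2) f(9) by blast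
  have ET': "E \<subseteq> T'"
    using tau_elt_of_card[OF sE(1) _ sE(3)] tau_elt_in_T' sub_carrier[OF sE(1)] by blast
  \<comment> \<open>\<open>AE \<inter> H\<close> has \<open>\<tau>\<close>-index in \<open>H\<close>, and \<open>(T' \<inter> H)/(A \<inter> H)\<close> is a \<open>\<tau>'\<close>-group, so \<open>k \<in> T' \<inter> H \<subseteq> AE\<close>.\<close>
  have sAE: "subgroup (A <#> E) G" using subgroup_set_mult_normal[OF m(1) sE(1)] by blast
  let ?B = "(A <#> E) \<inter> H"
  have sB: "subgroup ?B G" using subgroups_Inter_pair sAE H by blast
  have EB: "E \<subseteq> ?B" using set_mult_supset[OF part(1) sE(1)] sE(2) by blast
  have sTH: "subgroup (T' \<inter> H) G" and sAH: "subgroup (A \<inter> H) G"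
    using subgroups_Inter_pair f(6) part(1) H by auto
  have BT: "?B \<subseteq> T' \<inter> H" using set_mult_least[OF f(6) AT' ET'] by blast
  have AB: "A \<inter> H \<subseteq> ?B" using set_mult_supset[OF part(1) sE(1)] by blast
  have "index H E = index H ?B * index ?B E" using index_trans[OF sE(1) sB H EB] by blast
  then have 1: "tau_number \<tau> (index H ?B)" using sE(4) by simp
  have "index (T' \<inter> H) (T' \<inter> H \<inter> A) dvd index T' A"
    using index_Int_dvd[OF m(1) sTH f(6) _ AT'] by blast
  moreover have "T' \<inter> H \<inter> A = A \<inter> H" using AT' by blast
  ultimately have 2: "tau_number (primes_compl \<tau>) (index (T' \<inter> H) (A \<inter> H))"
    using m(6) tau_number_dvd by metis
  have "T' \<inter> H \<subseteq> ?B"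
    using tau_section_below[OF sTH sB H sAH _ _ AB _ _ 2] 1 set_mult_absorb(1)[OF sTH sB BT] sTH AT'
    by auto
  then have "k \<in> A <#> E" using tau_elt_in_T'[OF car(1) k(2)] car(3) by blast
  then obtain a e where ae: "a \<in> A" "e \<in> E" "k = a \<otimes> e" by (rule set_mult_memE)
  have ec: "a \<in> carrier G" "e \<in> carrier G" using ae part(1) sE(1) sub_carrier by auto
  \<comment> \<open>\<open>K\<close> also permutes with the conjugate of \<open>E\<close> by \<open>y\<close>, which is again a Hall subgroup of \<open>H\<close>.\<close>
  have key: "inv k \<otimes> conj_by y e \<in> K" if y: "y \<in> A \<inter> H" for y
  proof -
    have yc: "y \<in> carrier G" using y part(1) sub_carrier by blast
    let ?E = "conj_by y ` E"
    have hE: "Hall (primes_compl \<tau>) H ?E" using Hall_conj_by[OF H E] y by blast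
    then have sE': "subgroup ?E G" "tau_number (primes_compl \<tau>) (card ?E)" by (auto simp: Hall_def)
    have KE: "K <#> ?E = ?E <#> K" using K hE by (simp add: sigma_perm_def)
    have sKE: "subgroup (K <#> ?E) G" using subgroup_set_mult_comm[OF sK(1) sE'(1) KE] .
    note KKE = set_mult_supset[OF sK(1) sE'(1)]
    have i: "subgroup (A \<inter> (K <#> ?E)) G" using subgroups_Inter_pair part(1) sKE by blast
    have "card (A \<inter> (K <#> ?E)) dvd card A" using card_sub_dvd[OF i part(1)] by blast
    then have "tau_number \<tau> (card (A \<inter> (K <#> ?E)))" using part(3) tau_number_dvd by blast
    moreover have "tau_number (primes_compl \<tau>) (index (K <#> ?E) K)"
      using index_set_mult_dvd[OF sK(1) sE'(1) sKE] sE'(2) tau_number_dvd by blast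
    ultimately have le: "A \<inter> (K <#> ?E) \<subseteq> K"
      using tau_section_below[OF i sK(1) sKE triv_subgroup
          subgroup_Int_normal_mult[OF m(1) sKE sK(1) KKE(1)], of \<tau>] KKE(1) sub_one[OF i] sub_one[OF sK(1)]
      by simp
    have "inv k \<otimes> conj_by y e \<in> K <#> ?E"
      using ae(2) sub_inv[OF sK(1) k(1)] by (intro set_mult_memI) auto
    moreover have "inv k \<otimes> conj_by y e = conj_by (inv e) (inv a \<otimes> y) \<otimes> inv y"
      using ae(3) ec yc by (simp add: group_word_simps)
    then have "inv k \<otimes> conj_by y e \<in> A"
      using normal_conj_by[OF m(1)] ec ae(1) y part(1) by (simp add: sub_mult sub_inv)
    ultimately show ?thesis using le by blast
  qed
  have "inv k \<otimes> e \<in> K" using key[of \<one>] sub_one[OF sAH] ec by simp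
  then have eK: "e \<in> K" using sub_cancel_l[OF sK(1) sub_inv[OF sK(1) k(1)]] ec by simp
  have aK: "a \<in> K" using k(1) ae(3) sub_cancel_r[OF sK(1) eK] ec by simp
  have inH: "conj_by y k \<in> K" if y: "y \<in> A \<inter> H" for y
  proof -
    have yc: "y \<in> carrier G" using y part(1) sub_carrier by blast
    have "conj_by y e \<in> K"
      using key[OF y] sub_cancel_l[OF sK(1) sub_inv[OF sK(1) k(1)]] yc ec by simp
    moreover have "conj_by y a = a"
      using f(13) y ae(1) part(2) yc ec by (intro conj_by_eq_of_commute) auto
    ultimately show ?thesis using ae(3) yc ec aK sK(1) by (simp add: conj_by_mult sub_mult)
  qed
  \<comment> \<open>From here on \<open>x\<close> need not lie in \<open>H\<close>, but \<open>[x, k]\<close> does, because \<open>D\<close> normalizes \<open>H\<close>.\<close>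
  have xD: "x \<in> D" using x part(2) by blast
  obtain r :: int where r: "conj_by k x = x [^] r" using power_split_exponent[OF xD car(1)] .
  have cmx: "commut (x [^] (i::int)) k = x [^] (i * (1 - r))" for i
  proof -
    have "commut (x [^] i) k = x [^] i \<otimes> inv (conj_by k (x [^] i))"
      using car by (simp add: commut_def group_word_simps)
    also have "conj_by k (x [^] i) = x [^] (r * i)" using r car by (simp add: conj_by_int_pow int_pow_pow)
    finally show ?thesis
      using car int_pow_diff[of x i "r * i"] by (simp add: algebra_simps)
  qed
  have y: "commut x k = x [^] (1 - r)" using cmx[of 1] car by simp
  have "commut x k \<in> A" using normal_commut(2)[OF m(1) car(1) x] .
  moreover have "commut x k \<in> H" using DH[OF xD car(3)] car H by (simp add: commut_def sub_mult sub_inv)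
  ultimately have "conj_by (x [^] (1 - r)) k \<in> K" using inH y by simp
  then have "commut (x [^] (1 - r)) k \<in> K" using sK(1) k(1) by (simp add: commut_def sub_mult sub_inv)
  then have sq: "x [^] ((r - 1) * (r - 1)) \<in> K" using cmx[of "1 - r"] by (simp add: algebra_simps)
  let ?n = "ord k"
  have "conj_by (k [^] ?n) x = x [^] (r ^ ?n)" using conj_by_pow_iterate[OF car(1,2) r] .
  then have "x [^] (1::int) = x [^] (r ^ ?n)" using car by simp
  then have one: "x [^] (r ^ ?n - 1) = \<one>"
    using int_pow_eq[OF car(2)] int_pow_eq_id[OF car(2)] by blast
  obtain w where w: "r ^ ?n - 1 - int ?n * (r - 1) = (r - 1) * (r - 1) * w"
    using square_dvd_power_diff(1)[of r ?n] by blast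
  have "x [^] (int ?n * (r - 1)) = x [^] (r ^ ?n - 1) \<otimes> inv ((x [^] ((r - 1) * (r - 1))) [^] w)"
  proof -
    have eqn: "int ?n * (r - 1) = (r ^ ?n - 1) - (r - 1) * (r - 1) * w" using w by linarith
    show ?thesis
      unfolding eqn int_pow_diff[OF car(2), of "r ^ ?n - 1" "(r - 1) * (r - 1) * w"]
        int_pow_pow[OF car(2), of "(r - 1) * (r - 1)" w] ..
  qed
  also have "\<dots> \<in> K"
    unfolding one
    by (rule sub_mult[OF sK(1) sub_one[OF sK(1)] sub_inv[OF sK(1) sub_int_pow[OF sK(1) sq]]])
  finally have "(x [^] (r - 1)) [^] ?n \<in> K"
    using car by (simp add: int_pow_pow int_pow_int[symmetric] mult.commute)
  moreover have "(x [^] (r - 1)) [^] ord x \<in> K"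
    using car sub_one[OF sK(1)] int_pow_eq_id[of x "(r - 1) * int (ord x)"]
    by (simp add: int_pow_pow int_pow_int[symmetric])
  moreover have "coprime ?n (ord x)"
    using tau_number_coprime[of \<tau> "ord x" ?n] x k(2) by (simp add: tau_part_def coprime_commute)
  ultimately have "x [^] (r - 1) \<in> K" using coprime_pow_mem[OF sK(1)] car by blast
  then have "commut x k \<in> K"
    using sub_inv[OF sK(1)] y car int_pow_neg[of x "r - 1"] by auto
  then show ?thesis using conj_by_eq_commut[of x k] car k(1) sK(1) by (simp add: sub_mult)
qed

lemma permutable_normalized_by_part:
  assumes H: "subgroup H G" and DH: "\<And>d h. d \<in> D \<Longrightarrow> h \<in> H \<Longrightarrow> conj_by d h \<in> H"
    and K: "sigma_perm \<tau> H K" and k: "k \<in> K" and x: "x \<in> A"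
  shows "conj_by x k \<in> K"
proof -
  have sK: "subgroup K G" using K by (auto simp: sigma_perm_def)
  have kc: "k \<in> carrier G" and xc: "x \<in> carrier G" using k x sK part(1) sub_carrier by auto
  obtain i j :: int where ij: "k = k [^] i \<otimes> k [^] j" "tau_number \<tau> (ord (k [^] i))"
      "tau_number (primes_compl \<tau>) (ord (k [^] j))"
    using tau_parts[OF kc] by blast
  have K': "k [^] i \<in> K" "k [^] j \<in> K" using sub_int_pow[OF sK k] by auto
  have "conj_by x (k [^] i) = k [^] i"
    using power_split_commute[of x "k [^] i"] x ij(2) kc xc
    by (intro conj_by_eq_of_commute) (auto simp: tau_part_def)
  moreover have "conj_by x (k [^] j) \<in> K"
    using permutable_normalized_part[OF H DH K K'(2) ij(3) x] .
  ultimately show ?thesis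
    using conj_by_mult[OF xc, of "k [^] i" "k [^] j"] ij(1) kc K' sub_mult[OF sK] by simp
qed

text \<open>It suffices to treat three kinds of elements of \<open>K\<close>, of which every element is a product:
elements of \<open>D\<close>, for which conjugation only changes the exponent; \<open>\<tau>\<close>-elements, which are products
of an element of \<open>K \<inter> D\<close> and one of \<open>E\<close>; and \<open>\<tau>'\<close>-elements of order prime to \<open>|D|\<close>, which commute
with \<open>E\<close> modulo the \<open>\<tau>\<close>-part of \<open>D\<close>.\<close>

lemma Hall_product_swap:
  assumes K: "subgroup K G" and DK: "\<And>d k. d \<in> D \<Longrightarrow> k \<in> K \<Longrightarrow> conj_by d k \<in> K"
    and E: "Hall \<tau> (carrier G) E" and a: "a \<in> K" and e: "e \<in> E"
  shows "a \<otimes> e \<in> E <#> K"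
proof -
  note f = power_split_facts and m = power_split_more
  have sE: "subgroup E G" "tau_number \<tau> (card E)" "tau_number (primes_compl \<tau>) (index (carrier G) E)"
    using E by (auto simp: Hall_def)
  have Ec: "E \<subseteq> carrier G" and Kc: "K \<subseteq> carrier G" and Dc: "D \<subseteq> carrier G"
    using sE(1) K f(4) subgroup.subset by auto
  have AE: "A \<subseteq> E"
    using tau_section_below[OF part(1) sE(1) subgroup_self triv_subgroup, of \<tau>] part(3) sE(3)
      subgroup_set_mult_normal(1)[OF m(1) sE(1)] sub_one[OF part(1)] sub_one[OF sE(1)] Ec
      subgroup.subset[OF part(1)] by simp
  have normal_elt: "d [^] (i::int) \<in> K" if "d \<in> K" for d i using that sub_int_pow[OF K] by blast
  have swapD: "d \<otimes> g \<in> E <#> K" if d: "d \<in> K" "d \<in> D" and g: "g \<in> E" for d g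
  proof -
    have c: "d \<in> carrier G" "g \<in> carrier G" using d g Kc Ec by auto
    obtain r :: int where "conj_by (inv g) d = d [^] r" using power_split_exponent[OF d(2), of "inv g"] c by blast
    then have "d \<otimes> g = g \<otimes> d [^] r" using c by (simp add: conj_by_def m_assoc inv_solve_left')
    then show ?thesis using g normal_elt[OF d(1)] set_mult_memI by metis
  qed
  have swap_tau: "b \<otimes> g \<in> E <#> K" if b: "b \<in> K" "tau_number \<tau> (ord b)" and g: "g \<in> E" for b g
  proof -
    have c: "b \<in> carrier G" "g \<in> carrier G" using b g Kc Ec by auto
    have ET: "E \<subseteq> T" using tau_elt_of_card[OF sE(1) _ sE(2)] tau_elt_in_T Ec by blast
    have sDE: "subgroup (D <#> E) G" using subgroup_set_mult_normal(1)[OF f(1) sE(1)] .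
    have DET: "D <#> E \<subseteq> T" using set_mult_least[OF f(5,8) ET] .
    note DEs = set_mult_supset[OF f(4) sE(1)]
    have "index (carrier G) E = index (carrier G) (D <#> E) * index (D <#> E) E"
      using index_trans[OF sE(1) sDE subgroup_self DEs(2)] subgroup.subset[OF sDE] by blast
    then have "tau_number (primes_compl \<tau>) (index (carrier G) (D <#> E))" using sE(3) by simp
    then have "T \<subseteq> D <#> E"
      using tau_section_below[OF f(5) sDE subgroup_self f(4) _ f(8) DEs(1) _ _ m(3)]
        set_mult_absorb(1)[OF f(5) sDE DET] f(5) subgroup.subset[OF f(5)] subgroup.subset[OF sDE] by simp
    then obtain d e0 where de: "d \<in> D" "e0 \<in> E" "b = d \<otimes> e0"
      using tau_elt_in_T[OF c(1) b(2)] set_mult_memE by (metis subsetD)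
    obtain d1 d2 where dd: "d1 \<in> A" "d2 \<in> A'" "d = d1 \<otimes> d2" using de(1) part(4) set_mult_memE by metis
    have ddc: "d1 \<in> carrier G" "d2 \<in> carrier G" "e0 \<in> carrier G"
      using dd de part(1) part'(1) Ec sub_carrier by auto
    define e1 where "e1 = d1 \<otimes> e0"
    have e1: "e1 \<in> E" "e1 \<in> carrier G" using dd(1) AE de(2) sE(1) ddc by (auto simp: e1_def sub_mult)
    have d2D: "d2 \<in> D" using dd(2) part'(2) by blast
    have "d1 \<otimes> d2 = d2 \<otimes> d1" using f(13) dd part(2) part'(2) by blast
    then have be: "b = d2 \<otimes> e1" using de(3) dd(3) ddc by (simp add: e1_def m_assoc)
    obtain r :: int where r: "conj_by b d2 = d2 [^] r" using power_split_exponent[OF d2D c(1)] .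
    have "commut d2 b \<in> K" using DK[OF d2D b(1)] b(1) K by (simp add: commut_def sub_mult sub_inv)
    moreover have "commut d2 b = d2 [^] (1 - r)"
    proof -
      have "commut d2 b = d2 \<otimes> inv (conj_by b d2)" using c ddc by (simp add: commut_def group_word_simps)
      then show ?thesis using r ddc int_pow_diff[of d2 1 r] by simp
    qed
    ultimately have "inv (d2 [^] (1 - r)) \<in> K" using sub_inv[OF K] by simp
    then have dr: "d2 [^] (r - 1) \<in> K" using ddc int_pow_neg[of d2 "1 - r"] by simp
    have pw: "e1 [^] (i::nat) = d2 [^] (- (\<Sum>j<i. r ^ j)) \<otimes> b [^] i" for i
    proof (induction i)
      case 0
      then show ?case by simp
    next
      case (Suc i)
      have e1b: "e1 = inv d2 \<otimes> b" using be e1 ddc by simp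
      have cjb: "conj_by (b [^] i) (inv d2) = d2 [^] (- (r ^ i))"
        using conj_by_pow_iterate[OF c(1) ddc(2) r, of i] c ddc by (simp add: conj_by_inv int_pow_neg)
      have "e1 [^] Suc i = d2 [^] (- (\<Sum>j<i. r ^ j)) \<otimes> b [^] i \<otimes> (inv d2 \<otimes> b)"
        using Suc e1b by simp
      also have "\<dots> = d2 [^] (- (\<Sum>j<i. r ^ j)) \<otimes> conj_by (b [^] i) (inv d2) \<otimes> b [^] Suc i"
        using c ddc by (simp add: conj_by_def m_assoc)
      also have "\<dots> = d2 [^] (- (\<Sum>j<Suc i. r ^ j)) \<otimes> b [^] Suc i"
        unfolding cjb using ddc int_pow_mult[of d2 "- (\<Sum>j<i. r ^ j)" "- (r ^ i)"] by simp
      finally show ?case .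
    qed
    define n where "n = ord b * card E"
    have "ord e1 dvd card E" using ord_dvd_card[OF sE(1) e1(1)] .
    then have "e1 [^] n = \<one>" "b [^] n = \<one>" using e1 c by (auto simp: n_def pow_eq_id)
    then have "d2 [^] (- (\<Sum>j<n. r ^ j)) = \<one>" using pw[of n] ddc by simp
    then have s1: "d2 [^] (\<Sum>j<n. r ^ j) = \<one>" using ddc by (simp add: int_pow_neg)
    obtain w where w: "(\<Sum>j<n. r ^ j) - int n = (r - 1) * w"
      using square_dvd_power_diff(2)[of r n] by blast
    then have eqn: "int n = (\<Sum>j<n. r ^ j) - (r - 1) * w" by simp
    have "d2 [^] int n = d2 [^] (\<Sum>j<n. r ^ j) \<otimes> inv ((d2 [^] (r - 1)) [^] w)"
      unfolding eqn int_pow_diff[OF ddc(2), of "\<Sum>j<n. r ^ j" "(r - 1) * w"]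
        int_pow_pow[OF ddc(2), of "r - 1" w] ..
    then have "d2 [^] n = inv ((d2 [^] (r - 1)) [^] w)" using s1 ddc by (simp add: int_pow_int)
    then have "d2 [^] n \<in> K" using sub_int_pow[OF K dr] sub_inv[OF K] by simp
    moreover have "d2 [^] ord d2 \<in> K" using ddc sub_one[OF K] by simp
    moreover have "coprime n (ord d2)"
      using tau_number_coprime[of \<tau> n "ord d2"] b(2) sE(2) dd(2) by (simp add: n_def tau_part_def)
    ultimately have d2K: "d2 \<in> K" using coprime_pow_mem[OF K ddc(2)] by blast
    have "b \<otimes> g = d2 \<otimes> (e1 \<otimes> g)" using be c ddc e1 by (simp add: m_assoc)
    then show ?thesis using swapD[OF d2K d2D sub_mult[OF sE(1) e1(1) g]] by simp
  qed
  have swap_tau': "b \<otimes> g \<in> E <#> K"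
    if b: "b \<in> K" "tau_number (primes_compl \<tau>) (ord b)" "coprime (ord b) (card D)" and g: "g \<in> E" for b g
  proof -
    have c: "b \<in> carrier G" "g \<in> carrier G" using b g Kc Ec by auto
    define z where "z = inv b \<otimes> conj_by (inv g) b"
    have zc: "z \<in> carrier G" using c by (simp add: z_def)
    have "b \<in> T'" "g \<in> T"
      using tau_elt_in_T'[OF c(1) b(2)] tau_elt_in_T[OF c(2)] tau_elt_of_card[OF sE(1) g sE(2)] by auto
    then have "commut (inv g) (inv b) \<in> T \<inter> T'"
      using commut_Int_normal[OF f(2,3)] sub_inv f(5,6) by simp
    then have "commut (inv b) (inv g) \<in> D" using commut_sym[OF f(4)] f(7) c by simp
    moreover have "z = commut (inv b) (inv g)" using c by (simp add: z_def commut_def group_word_simps)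
    ultimately have zD: "z \<in> D" by simp
    obtain z1 z2 where zz: "z1 \<in> A" "z2 \<in> A'" "z = z1 \<otimes> z2" using zD part(4) set_mult_memE by metis
    have zzc: "z1 \<in> carrier G" "z2 \<in> carrier G" using zz part(1) part'(1) sub_carrier by auto
    have z12: "z1 \<otimes> z2 = z2 \<otimes> z1" using f(13) zz part(2) part'(2) by blast
    have bz: "conj_by (inv g) b = b \<otimes> z" using c by (simp add: z_def)
    let ?n = "ord b"
    have bzn: "(b \<otimes> z) [^] ?n = \<one>" unfolding bz[symmetric] using c by (simp add: conj_by_pow[symmetric])
    have z2b: "z2 \<otimes> b = b \<otimes> z2"
      using power_split_commute'[of z2 b] zz(2) b(2) c by (auto simp: tau_part_def)
    have com: "(b \<otimes> z1) \<otimes> z2 = z2 \<otimes> (b \<otimes> z1)"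
      using z12 z2b c zzc by (metis m_assoc)
    have "(b \<otimes> z1) [^] ?n \<otimes> z2 [^] ?n = \<one>"
      using bzn pow_mult_distrib[OF com, of ?n] zz(3) c zzc by (simp add: m_assoc)
    moreover have "(b \<otimes> z1) [^] ?n \<in> A"
    proof -
      have "A #> (b \<otimes> z1) = A #> b"
        using coset_eq_iff[OF part(1), of "b \<otimes> z1" b] normal_conj_by[OF m(1) c(1) zz(1)] c zzc
        by (simp add: conj_by_def)
      then have "A #> (b \<otimes> z1) [^] ?n = A #> b [^] ?n"
        using factor_pow[OF m(1), of "b \<otimes> z1" ?n] factor_pow[OF m(1), of b ?n] c zzc by simp
      then have "A #> (b \<otimes> z1) [^] ?n = A"
        using c coset_join2[OF one_closed part(1) sub_one[OF part(1)]] by simp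
      then show ?thesis using factor_eq_one[OF m(1)] c zzc by simp
    qed
    ultimately have "z2 [^] ?n \<in> A"
      using sub_cancel_l[OF part(1), of "(b \<otimes> z1) [^] ?n" "z2 [^] ?n"] zzc sub_one[OF part(1)] by simp
    moreover have "z2 [^] ?n \<in> A'" using sub_pow[OF part'(1) zz(2)] .
    ultimately have "z2 [^] ?n \<in> {\<one>}" using part(5) by blast
    moreover have "z2 [^] card D \<in> {\<one>}"
      using ord_dvd_card[OF f(4), of z2] zz(2) part'(2) zzc by (auto simp: pow_eq_id)
    ultimately have "z2 \<in> {\<one>}" using coprime_pow_mem[OF triv_subgroup zzc(2)] b(3) by blast
    then have "conj_by (inv g) b = b \<otimes> z1" using bz zz(3) zzc by simp
    then have "b \<otimes> g = g \<otimes> (b \<otimes> z1)" using c zzc by (simp add: conj_by_def m_assoc inv_solve_left')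
    also have "\<dots> = (g \<otimes> conj_by b z1) \<otimes> b" using c zzc by (simp add: conj_by_def m_assoc)
    also have "\<dots> \<in> E <#> K"
      using normal_conj_by[OF m(1) c(1) zz(1)] AE g b(1) sE(1) by (intro set_mult_memI sub_mult) auto
    finally show ?thesis .
  qed
  have swap_mult: "b \<otimes> b' \<otimes> g \<in> E <#> K"
    if b: "b \<in> K" "b' \<in> K" and s: "\<And>g. g \<in> E \<Longrightarrow> b \<otimes> g \<in> E <#> K" "\<And>g. g \<in> E \<Longrightarrow> b' \<otimes> g \<in> E <#> K"
      and g: "g \<in> E" for b b' g
  proof -
    obtain g' k where 1: "g' \<in> E" "k \<in> K" "b' \<otimes> g = g' \<otimes> k" using s(2)[OF g] set_mult_memE by metis
    obtain g'' k' where 2: "g'' \<in> E" "k' \<in> K" "b \<otimes> g' = g'' \<otimes> k'" using s(1)[OF 1(1)] set_mult_memE by metis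
    have c: "b \<in> carrier G" "b' \<in> carrier G" "g \<in> carrier G" "g' \<in> carrier G" "k \<in> carrier G"
      "g'' \<in> carrier G" "k' \<in> carrier G" using b g 1 2 Ec Kc by auto
    have "b \<otimes> b' \<otimes> g = b \<otimes> (g' \<otimes> k)" using c 1(3) by (simp add: m_assoc)
    also have "\<dots> = (b \<otimes> g') \<otimes> k" using c by (simp add: m_assoc)
    also have "\<dots> = g'' \<otimes> (k' \<otimes> k)" using c 2(3) by (simp add: m_assoc)
    finally show ?thesis using 1 2 K by (auto intro!: set_mult_memI sub_mult)
  qed
  have ac: "a \<in> carrier G" using a Kc by blast
  obtain i j :: int where ij: "a = a [^] i \<otimes> a [^] j" "tau_number \<tau> (ord (a [^] i))"
      "tau_number (primes_compl \<tau>) (ord (a [^] j))"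
    using tau_parts[OF ac] by blast
  define b where "b = a [^] j"
  have b: "b \<in> K" "b \<in> carrier G" using normal_elt[OF a] ac by (auto simp: b_def)
  let ?\<rho> = "{p. p dvd card D}"
  obtain i' j' :: int where ij': "b = b [^] i' \<otimes> b [^] j'" "tau_number ?\<rho> (ord (b [^] i'))"
      "tau_number (primes_compl ?\<rho>) (ord (b [^] j'))"
    using tau_parts[OF b(2)] by blast
  have pK: "b [^] i' \<in> K" "b [^] j' \<in> K" "a [^] i \<in> K" using normal_elt a b by auto
  have "tau_number (primes_compl ?\<rho>) (index (carrier G) D)"
    unfolding tau_number_compl using f(12) coprime_common_divisor not_prime_unit by blast
  then have "b [^] i' \<in> D"
    using tau_elt_mem[OF f(1) subgroup_self Dc, of "b [^] i'" "ord (b [^] i')" ?\<rho>] ij'(2) b(2)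
      sub_one[OF f(4)] by simp
  then have s1: "b [^] i' \<otimes> g \<in> E <#> K" if "g \<in> E" for g using swapD pK(1) that by blast
  have "coprime (ord (b [^] j')) (card D)"
  proof (rule ccontr)
    assume "\<not> ?thesis"
    then obtain p where "prime p" "p dvd ord (b [^] j')" "p dvd card D"
      by (rule not_coprime_common_prime)
    then show False using ij'(3) unfolding tau_number_compl by blast
  qed
  moreover have "tau_number (primes_compl \<tau>) (ord (b [^] j'))"
  proof -
    have "(b [^] j') [^] int (ord b) = \<one>" using b(2) by (simp add: int_pow_pow int_pow_eq_id)
    then have "ord (b [^] j') dvd ord b" using b(2) by (simp add: int_pow_int pow_eq_id)
    then show ?thesis using ij(3) tau_number_dvd by (auto simp: b_def)
  qed
  ultimately have s2: "b [^] j' \<otimes> g \<in> E <#> K" if "g \<in> E" for g using swap_tau' pK(2) that by blast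
  have s3: "b \<otimes> g \<in> E <#> K" if "g \<in> E" for g
    using swap_mult[OF pK(1,2) s1 s2 that] ij'(1) by simp
  show ?thesis
    using swap_mult[OF pK(3) b(1) swap_tau[OF pK(3) ij(2)] s3 e] ij(1) by (simp add: b_def)
qed

lemma Hall_product_commute:
  assumes K: "subgroup K G" and DK: "\<And>d k. d \<in> D \<Longrightarrow> k \<in> K \<Longrightarrow> conj_by d k \<in> K"
    and E: "Hall \<tau> (carrier G) E"
  shows "K <#> E = E <#> K"
proof -
  have sE: "subgroup E G" using E by (simp add: Hall_def)
  have "K <#> E \<subseteq> E <#> K"
  proof
    fix x assume "x \<in> K <#> E"
    then obtain a e where "a \<in> K" "e \<in> E" "x = a \<otimes> e" by (rule set_mult_memE)
    then show "x \<in> E <#> K" using Hall_product_swap[OF K DK E] by blast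
  qed
  moreover have "card (K <#> E) * card (K \<inter> E) = card (E <#> K) * card (K \<inter> E)"
    using card_set_mult[OF K sE] card_set_mult[OF sE K] by (simp add: Int_commute mult.commute)
  then have "card (K <#> E) = card (E <#> K)"
    using card_sub_pos[OF subgroups_Inter_pair[OF K sE]] by simp
  moreover have "finite (E <#> K)"
    using fin finite_subset setmult_subset_G sE K by (meson subgroup.subset)
  ultimately show ?thesis by (simp add: card_subset_eq)
qed

end

end

section \<open>The characterization\<close>

context finite_group
begin

text \<open>Since \<open>H \<inter> T\<close> covers the chief factor and \<open>H \<inter> N\<close> does not contribute, \<open>H/K\<close> is a section of
\<open>T/N\<close>.\<close>

lemma chief_factor_index_dvd:
  assumes HK: "chief_factor G H K" and N: "N \<lhd> G" and T: "T \<lhd> G" "N \<subseteq> T"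
    and HN: "H \<inter> N \<subseteq> K" and HT: "\<not> H \<inter> T \<subseteq> K"
  shows "index H K dvd index T N"
proof -
  have n: "H \<lhd> G" "K \<lhd> G" "K \<subseteq> H" and ch: "\<And>L. L \<lhd> G \<Longrightarrow> K \<subseteq> L \<Longrightarrow> L \<subseteq> H \<Longrightarrow> L = K \<or> L = H"
    using HK by (auto simp: chief_factor_def)
  have s: "subgroup H G" "subgroup K G" "subgroup T G" "subgroup N G"
    using n N T normal_imp_subgroup by auto
  have nI: "H \<inter> T \<lhd> G" using normal_subgroup_intersect n T by blast
  have sI: "subgroup (H \<inter> T) G" "subgroup (K \<inter> T) G" "subgroup (H \<inter> N) G"
    using subgroups_Inter_pair s by auto
  note KI = set_mult_supset[OF s(2) sI(1)]
  have "K <#> (H \<inter> T) \<lhd> G" using normal_subgroup_set_mult_closed[OF n(2) nI] .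
  moreover have "K <#> (H \<inter> T) \<subseteq> H" using set_mult_least[OF s(1) n(3)] by blast
  ultimately have eq: "K <#> (H \<inter> T) = H" using ch[of "K <#> (H \<inter> T)"] KI HT by blast
  have "K \<inter> (H \<inter> T) = K \<inter> T" using n(3) by blast
  then have "card H * card (K \<inter> T) = card K * card (H \<inter> T)"
    using card_set_mult[OF s(2) sI(1)] eq by simp
  moreover have "card H = index H K * card K" using index_card[OF s(2,1) n(3)] by simp
  moreover have "card (H \<inter> T) = index (H \<inter> T) (K \<inter> T) * card (K \<inter> T)"
  proof -
    have "K \<inter> T \<subseteq> H \<inter> T" using n(3) by blast
    then show ?thesis using index_card[OF sI(2,1)] by simp
  qed
  ultimately have "index H K = index (H \<inter> T) (K \<inter> T)"
    using card_sub_pos[OF s(2)] card_sub_pos[OF sI(2)] by simp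
  moreover have "index (H \<inter> T) (H \<inter> N) = index (H \<inter> T) (K \<inter> T) * index (K \<inter> T) (H \<inter> N)"
    using T(2) HN n(3) by (intro index_trans sI) auto
  moreover have "index (H \<inter> T) (H \<inter> T \<inter> N) dvd index T N"
    using index_Int_dvd[OF N sI(1) s(3) _ T(2)] by blast
  moreover have "H \<inter> T \<inter> N = H \<inter> N" using T(2) by blast
  ultimately show ?thesis by (metis dvd_mult_left)
qed

text \<open>Each chief factor is a section of one of the factors of the series \<open>1 \<le> A \<le> D \<le> T \<le> G\<close>, which are
alternately \<open>\<tau>\<close>-groups and \<open>\<tau>'\<close>-groups.\<close>

lemma power_split_pi_separable:
  assumes ps: "power_split \<tau> D T T'"
  shows "pi_separable \<tau> G"
  unfolding pi_separable_iff
proof (intro allI impI)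
  fix H K assume HK: "chief_factor G H K"
  note f = power_split_facts[OF ps] and m = power_split_more[OF ps]
    and a = tau_part_abelian[OF f(4,13), where \<tau> = \<tau>]
    and a' = tau_part_abelian[OF f(4,13), where \<tau> = "primes_compl \<tau>"]
  let ?A = "tau_part \<tau> D"
  have HKn: "H \<lhd> G" "K \<lhd> G" "K \<subset> H" using HK by (auto simp: chief_factor_def)
  have 1: "H \<inter> {\<one>} \<subseteq> K" using sub_one[OF normal_imp_subgroup[OF HKn(2)]] by blast
  have Hc: "H \<subseteq> carrier G" using subgroup.subset[OF normal_imp_subgroup[OF HKn(1)]] .
  consider "\<not> H \<inter> ?A \<subseteq> K" | "H \<inter> ?A \<subseteq> K" "\<not> H \<inter> D \<subseteq> K" | "H \<inter> D \<subseteq> K" "\<not> H \<inter> T \<subseteq> K"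
    | "H \<inter> T \<subseteq> K" by blast
  then show "tau_number \<tau> (index H K) \<or> tau_number (primes_compl \<tau>) (index H K)"
  proof cases
    case 1
    then have "index H K dvd card ?A"
      using chief_factor_index_dvd[OF HK one_is_normal m(1) _ \<open>H \<inter> {\<one>} \<subseteq> K\<close>] sub_one[OF a(1)] by simp
    then show ?thesis using a(3) tau_number_dvd by blast
  next
    case 2
    then have "index H K dvd index D ?A" using chief_factor_index_dvd[OF HK m(1) f(1) a(2)] by blast
    then show ?thesis using m(5) a'(3) tau_number_dvd by metis
  next
    case 3
    then have "index H K dvd index T D" using chief_factor_index_dvd[OF HK f(1,2,8)] by blast
    then show ?thesis using m(3) tau_number_dvd by blast
  next
    case 4
    have "\<not> H \<inter> carrier G \<subseteq> K" using HKn(3) Hc by blast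
    then have "index H K dvd index (carrier G) T"
      using chief_factor_index_dvd[OF HK f(2) normal_self subgroup.subset[OF f(5)] 4] by blast
    then show ?thesis using f(10) tau_number_dvd by blast
  qed
qed

lemma permutable_normalized:
  assumes ps: "power_split \<tau> D T T'" and H: "subgroup H G"
    and DH: "\<And>d h. d \<in> D \<Longrightarrow> h \<in> H \<Longrightarrow> conj_by d h \<in> H"
    and K: "sigma_perm \<tau> H K" and d: "d \<in> D" and k: "k \<in> K"
  shows "conj_by d k \<in> K"
proof -
  note f = power_split_facts[OF ps] and a = tau_part_abelian[OF f(4,13), where \<tau> = \<tau>]
  note ps' = power_split_compl[OF ps]
  have K': "sigma_perm (primes_compl \<tau>) H K" using K sigma_perm_compl by simp
  obtain x y where xy: "x \<in> tau_part \<tau> D" "y \<in> tau_part (primes_compl \<tau>) D" "d = x \<otimes> y"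
    using d a(4) set_mult_memE by metis
  have "k \<in> carrier G" using k K sub_carrier by (auto simp: sigma_perm_def)
  moreover have "x \<in> carrier G" "y \<in> carrier G"
    using xy sub_carrier[OF f(4)] by (auto simp: tau_part_def)
  moreover have "conj_by x (conj_by y k) \<in> K"
    using permutable_normalized_by_part[OF ps H DH K _ xy(1)]
      permutable_normalized_by_part[OF ps' H DH K' k xy(2)] by blast
  ultimately show ?thesis using xy(3) by (simp add: conj_by_conj_by)
qed

text \<open>\<open>D\<close> normalizes \<open>G\<close>, hence \<open>H\<close>, hence \<open>K\<close>; and subgroups normalized by \<open>D\<close> permute with all Hall
subgroups.\<close>

lemma power_split_P_sigma_pi_T_group:
  assumes ps: "power_split \<tau> D T T'"
  shows "P_sigma_pi_T_group \<tau> G"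
  unfolding P_sigma_pi_T_group_iff
proof (intro allI impI)
  fix H K assume HK: "sigma_perm \<tau> (carrier G) H \<and> sigma_perm \<tau> H K"
  note f = power_split_facts[OF ps]
  have sH: "subgroup H G" and sK: "subgroup K G" "K \<subseteq> carrier G"
    using HK subgroup.subset by (auto simp: sigma_perm_def)
  have closed: "conj_by d h \<in> carrier G" if "d \<in> D" "h \<in> carrier G" for d h
    using that sub_carrier[OF f(4)] by simp
  have DH: "conj_by d h \<in> H" if "d \<in> D" "h \<in> H" for d h
    using permutable_normalized[OF ps subgroup_self closed conjunct1[OF HK] that] .
  have DK: "conj_by d k \<in> K" if "d \<in> D" "k \<in> K" for d k
    using permutable_normalized[OF ps sH DH conjunct2[OF HK] that] by blast
  have KE: "K <#> E = E <#> K" if "Hall \<tau> (carrier G) E \<or> Hall (primes_compl \<tau>) (carrier G) E" for E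
    using that Hall_product_commute[OF ps sK(1) DK]
      Hall_product_commute[OF power_split_compl[OF ps] sK(1) DK] by blast
  have "\<exists>E. Hall \<tau> (carrier G) E" "\<exists>E. Hall (primes_compl \<tau>) (carrier G) E"
    using HK unfolding sigma_perm_def by blast+
  then show "sigma_perm \<tau> (carrier G) K"
    unfolding sigma_perm_def by (intro conjI allI impI sK KE)
qed

lemma decomposable_complement_split:
  assumes sd: "is_internal_semidirect_product G D M" and dec: "pi_decomposable \<tau> (G\<lparr>carrier := M\<rparr>)"
  defines "P \<equiv> tau_core \<tau> (G\<lparr>carrier := M\<rparr>)" and "Q \<equiv> tau_core (primes_compl \<tau>) (G\<lparr>carrier := M\<rparr>)"
  shows "D <#> P \<lhd> G" "tau_number (primes_compl \<tau>) (index (carrier G) (D <#> P))"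
    "(D <#> P) \<inter> (D <#> Q) = D"
proof -
  have D: "D \<lhd> G" and M: "subgroup M G" "D \<inter> M = {\<one>}" "D <#> M = carrier G"
    using sd by (auto simp: is_internal_semidirect_product_def)
  have sD: "subgroup D G" using D normal_imp_subgroup by blast
  note p = tau_core_restrict[OF M(1), where \<tau> = \<tau>, folded P_def]
    and q = tau_core_restrict[OF M(1), where \<tau> = "primes_compl \<tau>", folded Q_def]
  have PQ: "P \<inter> Q = {\<one>}" "P <#> Q = M"
    using dec by (auto simp: pi_decomposable_def is_internal_direct_product_def P_def Q_def)
  have sDP: "subgroup (D <#> P) G" using subgroup_set_mult_normal(1)[OF D p(2)] .
  note DPs = set_mult_supset[OF sD p(2)]
  show "D <#> P \<lhd> G"
  proof (rule normal_cjI[OF sDP])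
    fix g x assume g: "g \<in> carrier G" and x: "x \<in> D <#> P"
    obtain d m where dm: "d \<in> D" "m \<in> M" "g = d \<otimes> m" using g M(3) set_mult_memE by metis
    obtain d' y where dy: "d' \<in> D" "y \<in> P" "x = d' \<otimes> y" using x set_mult_memE by metis
    have c: "d \<in> carrier G" "m \<in> carrier G" "d' \<in> carrier G" "y \<in> carrier G"
      using dm dy sD M(1) p(2) sub_carrier by auto
    have "conj_by m y \<in> P" using p(1) normal_carrier_iff[OF M(1)] dm(2) dy(2) by blast
    then have "conj_by m x \<in> D <#> P"
      using normal_conj_by[OF D c(2) dy(1)] c dy(3) by (auto simp: conj_by_mult intro: set_mult_memI)
    then have "conj_by d (conj_by m x) \<in> D <#> P"
      using dm(1) DPs(1) sub_mult[OF sDP] sub_inv[OF sDP] unfolding conj_by_def[of d] by blast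
    then show "conj_by g x \<in> D <#> P" using c dm(3) dy(3) by (simp add: conj_by_conj_by)
  qed
  have cDP: "card (D <#> P) = card D * card P"
  proof -
    have "D \<inter> P = {\<one>}" using M(2) p(3) sub_one[OF sD] sub_one[OF p(2)] by blast
    then show ?thesis using card_set_mult[OF sD p(2)] by simp
  qed
  have "card M = card P * card Q" using card_set_mult[OF p(2) q(2)] PQ by simp
  moreover have "card (carrier G) = card D * card M" using card_set_mult[OF sD M(1)] M by simp
  ultimately have "index (carrier G) (D <#> P) = card Q"
    using cDP by (intro index_eqI[OF sDP]) simp
  then show "tau_number (primes_compl \<tau>) (index (carrier G) (D <#> P))" using q(4) by simp
  show "(D <#> P) \<inter> (D <#> Q) = D"
  proof
    show "D \<subseteq> (D <#> P) \<inter> (D <#> Q)" using DPs(1) set_mult_supset(1)[OF sD q(2)] by blast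
    show "(D <#> P) \<inter> (D <#> Q) \<subseteq> D"
    proof
      fix x assume "x \<in> (D <#> P) \<inter> (D <#> Q)"
      then obtain d y d' z where *: "d \<in> D" "y \<in> P" "x = d \<otimes> y" "d' \<in> D" "z \<in> Q" "x = d' \<otimes> z"
        using set_mult_memE by (metis IntE)
      have c: "d \<in> carrier G" "d' \<in> carrier G" "y \<in> carrier G" "z \<in> carrier G"
        using * sD p(2) q(2) sub_carrier by auto
      have "inv d' \<otimes> (d \<otimes> y) = z" using * c by (metis inv_cancel(1))
      then have e: "inv d' \<otimes> d = z \<otimes> inv y" using c by (simp add: inv_solve_right m_assoc)
      have "inv d' \<otimes> d \<in> D" using * sD by (simp add: sub_mult sub_inv)
      moreover have "z \<otimes> inv y \<in> M" using * p(3) q(3) M(1) by (auto intro!: sub_mult sub_inv)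
      ultimately have "z \<otimes> inv y = \<one>" using e M(2) by auto
      then have "z = y" using c inv_solve_right'[of \<one> z y] by simp
      then have "y = \<one>" using * PQ by auto
      then show "x \<in> D" using * c by simp
    qed
  qed
qed

text \<open>The \<open>\<tau>\<close>-part of \<open>D\<close> and its normal complement centralize each other, so a whole Hall \<open>\<tau>\<close>-subgroup
centralizes the \<open>\<tau>\<close>-part. The centralizer is normal of \<open>\<tau>'\<close>-index, so it contains all
\<open>\<tau>\<close>-elements.\<close>

lemma normal_complement_centralizes:
  assumes D: "subgroup D G" and comm: "\<forall>x\<in>D. \<forall>y\<in>D. x \<otimes> y = y \<otimes> x"
    and pw: "\<forall>A. subgroup A G \<and> A \<subseteq> D \<longrightarrow> A \<lhd> G"
    and H: "hall_tau_subgroup \<tau> G H"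
    and nc: "has_normal_complement (G\<lparr>carrier := H\<rparr>) (tau_core \<tau> (G\<lparr>carrier := D\<rparr>))"
    and x: "x \<in> D" "tau_number \<tau> (ord x)" and g: "g \<in> carrier G" "tau_number \<tau> (ord g)"
  shows "x \<otimes> g = g \<otimes> x"
proof -
  let ?A = "tau_part \<tau> D"
  note a = tau_part_abelian[OF D comm, where \<tau> = \<tau>]
  have A: "?A \<lhd> G" using pw a(1,2) by blast
  have hH: "Hall \<tau> (carrier G) H" using H hall_tau_subgroup_iff[OF subgroup_self, of \<tau> H] by simp
  then have sH: "subgroup H G" "tau_number (primes_compl \<tau>) (index (carrier G) H)" by (auto simp: Hall_def)
  have AH: "?A \<subseteq> H"
    using nc subgroup_carrier_iff[OF sH(1)] unfolding has_normal_complement_def a(6) by blast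
  obtain N where N: "N \<lhd> G\<lparr>carrier := H\<rparr>" "?A \<inter> N = {\<one>}" "?A <#> N = H"
    using nc unfolding has_normal_complement_def a(6) by auto
  have sN: "subgroup N G" "N \<subseteq> H" "\<And>h n. h \<in> H \<Longrightarrow> n \<in> N \<Longrightarrow> conj_by h n \<in> N"
    using N(1) normal_carrier_iff[OF sH(1)] by auto
  let ?C = "cent_mod {\<one>} ?A"
  have C: "?C \<lhd> G" using cent_mod_normal[OF one_is_normal A] .
  have sC: "subgroup ?C G" using C normal_imp_subgroup by blast
  have "N \<subseteq> ?C"
  proof
    fix n assume n: "n \<in> N"
    have nc: "n \<in> carrier G" using n sN sub_carrier by blast
    have "commut n y = \<one>" if y: "y \<in> ?A" for y
    proof -
      have yc: "y \<in> carrier G" using y a(1) sub_carrier by blast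
      have "commut n y = n \<otimes> conj_by y (inv n)" using nc yc by (simp add: commut_def group_word_simps)
      moreover have "conj_by y (inv n) \<in> N" using sN(3)[of y "inv n"] y AH n sub_inv[OF sN(1)] by blast
      ultimately have "commut n y \<in> N" using n sub_mult[OF sN(1)] by simp
      moreover have "commut n y \<in> ?A" using normal_commut(1)[OF A nc y] .
      ultimately show ?thesis using N(2) by blast
    qed
    then show "n \<in> ?C" using nc by (simp add: cent_mod_def)
  qed
  moreover have "?A \<subseteq> ?C"
    using comm commut_eq_one_iff sub_carrier[OF D] by (auto simp: cent_mod_def tau_part_def)
  ultimately have HC: "H \<subseteq> ?C" using set_mult_least[OF sC] N(3) by blast
  have "index (carrier G) H = index (carrier G) ?C * index ?C H"
    using index_trans[OF sH(1) sC subgroup_self HC subgroup.subset[OF sC]] .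
  then have "tau_number (primes_compl \<tau>) (index (carrier G) ?C)" using sH(2) by simp
  then have "g \<in> ?C"
    using tau_elt_mem[OF C subgroup_self subgroup.subset[OF sC] g(1) _ g(2)] g(1) sub_one[OF sC] by simp
  moreover have "x \<in> ?A" using x by (simp add: tau_part_def)
  ultimately have "commut g x = \<one>" by (auto simp: cent_mod_def)
  then show ?thesis using commut_eq_one_iff[OF g(1) sub_carrier[OF D x(1)]] by simp
qed

theorem structure_power_split:
  assumes sd: "is_internal_semidirect_product G D M" and comm: "comm_group (G\<lparr>carrier := D\<rparr>)"
    and hall: "hall_subgroup G D" and dec: "pi_decomposable \<tau> (G\<lparr>carrier := M\<rparr>)"
    and pa: "\<forall>g\<in>carrier G. power_automorphism (G\<lparr>carrier := D\<rparr>) (\<lambda>d. g \<otimes> d \<otimes> inv g)"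
    and H: "hall_tau_subgroup \<tau> G H"
      "has_normal_complement (G\<lparr>carrier := H\<rparr>) (tau_core \<tau> (G\<lparr>carrier := D\<rparr>))"
    and H': "hall_tau_subgroup (primes_compl \<tau>) G H'"
      "has_normal_complement (G\<lparr>carrier := H'\<rparr>) (tau_core (primes_compl \<tau>) (G\<lparr>carrier := D\<rparr>))"
  shows "\<exists>T T'. power_split \<tau> D T T'"
proof -
  have D: "D \<lhd> G" using sd by (simp add: is_internal_semidirect_product_def)
  have sM: "subgroup M G" using sd by (simp add: is_internal_semidirect_product_def)
  have sD: "subgroup D G" using D normal_imp_subgroup by blast
  have comm': "\<forall>x\<in>D. \<forall>y\<in>D. x \<otimes> y = y \<otimes> x"
    using comm_monoid.m_comm[OF comm_group.axioms(1)[OF comm]] by simp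
  have pw: "\<forall>A. subgroup A G \<and> A \<subseteq> D \<longrightarrow> A \<lhd> G"
  proof (intro allI impI)
    fix A assume A: "subgroup A G \<and> A \<subseteq> D"
    then have "(\<lambda>d. g \<otimes> d \<otimes> inv g) ` A = A" if "g \<in> carrier G" for g
      using pa that by (auto simp: power_automorphism_def subgroup_carrier_iff[OF sD])
    then show "A \<lhd> G" using A by (intro normal_cjI) (auto simp: conj_by_def)
  qed
  have "card (rcosets D) = index (carrier G) D"
    using card_rcosets_index[OF sD subgroup_self subgroup.subset[OF sD]] by simp
  then have cop: "coprime (card D) (index (carrier G) D)" using hall by (simp add: hall_subgroup_def)
  let ?P = "tau_core \<tau> (G\<lparr>carrier := M\<rparr>)" and ?Q = "tau_core (primes_compl \<tau>) (G\<lparr>carrier := M\<rparr>)"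
  note 1 = decomposable_complement_split[OF sd dec]
  have "tau_core (primes_compl (primes_compl \<tau>)) (G\<lparr>carrier := M\<rparr>) = ?P"
    using tau_core_restrict[OF sM, where \<tau> = \<tau>]
      tau_core_restrict[OF sM, where \<tau> = "primes_compl (primes_compl \<tau>)"]
    by (metis subset_antisym tau_number_compl_compl)
  moreover from this have "pi_decomposable (primes_compl \<tau>) (G\<lparr>carrier := M\<rparr>)"
  proof -
    have "?P \<lhd> G\<lparr>carrier := M\<rparr>" "?Q \<lhd> G\<lparr>carrier := M\<rparr>" using tau_core_restrict(1)[OF sM] by blast+
    then have "?Q <#>\<^bsub>G\<lparr>carrier := M\<rparr>\<^esub> ?P = ?P <#>\<^bsub>G\<lparr>carrier := M\<rparr>\<^esub> ?Q"
      using group.commut_normal[OF subgroup_imp_group[OF sM]] normal_imp_subgroup by blast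
    then show ?thesis
      using dec \<open>tau_core (primes_compl (primes_compl \<tau>)) (G\<lparr>carrier := M\<rparr>) = ?P\<close>
      unfolding pi_decomposable_def is_internal_direct_product_def by (metis Int_commute)
  qed
  ultimately have 2: "D <#> ?Q \<lhd> G" "tau_number \<tau> (index (carrier G) (D <#> ?Q))"
    using decomposable_complement_split[OF sd, of "primes_compl \<tau>"] by auto
  have "power_split \<tau> D (D <#> ?P) (D <#> ?Q)"
    unfolding power_split_def
    using D 1 2 cop comm' pw normal_complement_centralizes[OF sD comm' pw H]
      normal_complement_centralizes[OF sD comm' pw H'] by blast
  then show ?thesis by blast
qed

end

theorem corollary1p6:
  fixes G :: "('a, 'b) monoid_scheme" and \<pi> :: "nat set"
  assumes "group G" and "finite (carrier G)"
    and "finite \<pi>" and "\<pi> \<subseteq> all_primes"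
  shows "pi_separable \<pi> G \<and> P_sigma_pi_T_group \<pi> G \<longleftrightarrow>
    (\<exists>D M.
       (is_internal_semidirect_product G D M \<and>
        comm_group (G\<lparr>carrier := D\<rparr>) \<and> hall_subgroup G D \<and> odd (card D) \<and>
        pi_decomposable \<pi> (G\<lparr>carrier := M\<rparr>) \<and>
        (\<forall>g\<in>carrier G.
           power_automorphism (G\<lparr>carrier := D\<rparr>) (\<lambda>d. g \<otimes>\<^bsub>G\<^esub> d \<otimes>\<^bsub>G\<^esub> inv\<^bsub>G\<^esub> g))) \<and>
       (\<exists>H. hall_tau_subgroup \<pi> G H \<and>
          has_normal_complement (G\<lparr>carrier := H\<rparr>)
            (tau_core \<pi> (G\<lparr>carrier := D\<rparr>))) \<and>
       (\<exists>H. hall_tau_subgroup (primes_compl \<pi>) G H \<and>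
          has_normal_complement (G\<lparr>carrier := H\<rparr>)
            (tau_core (primes_compl \<pi>) (G\<lparr>carrier := D\<rparr>))))"
    (is "_ \<longleftrightarrow> ?structure")
proof -
  interpret finite_group G
    using assms(1,2) by (simp add: finite_group_def finite_group_axioms_def)
  show ?thesis
  proof
    assume "pi_separable \<pi> G \<and> P_sigma_pi_T_group \<pi> G"
    then show ?structure using P_sigma_pi_T_group_structure by blast
  next
    assume ?structure
    then obtain D T T' where "power_split \<pi> D T T'"
      using structure_power_split by metis
    then show "pi_separable \<pi> G \<and> P_sigma_pi_T_group \<pi> G"
      using power_split_pi_separable power_split_P_sigma_pi_T_group by blast
  qed
qed

end
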